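(* Let $M\subset\mathbb{C}^{n+1}$ be a real smooth hypersurface and $p\in M$, and suppose the Levi form at $p$ has $r$ positive and $s$ negative eigenvalues with $r+s<n$. Let $g_{\bar\alpha\beta}=\epsilon_\beta\delta_{\alpha\beta}$ ($\alpha,\beta=1,\dots,n$) where $\epsilon_\beta=1$ for $\beta\le r$, $\epsilon_\beta=-1$ for $r<\beta\le r+s$, $\epsilon_\beta=0$ for $\beta>r+s$, and let $h_{\bar\alpha\bar\beta\gamma}\in\mathbb{C}$ ($\alpha,\beta=1,\dots,n$, $\gamma=r+s+1,\dots,n$) be symmetric in $\alpha,\beta$. Then there exist local holomorphic coordinates $Z=(z,w)\in\mathbb{C}^n\times\mathbb{C}$, vanishing at $p$, in which $M$ is defined near $p$ by $\rho=0$ with $$\rho(Z,\bar Z)=-\operatorname{Im}w+\sum_{\alpha,\beta}g_{\bar\alpha\beta}\bar z^\alpha z^\beta+2\operatorname{Re}\Big(\sum_{\alpha,\beta=1}^n\sum_{\gamma=r+s+1}^n h_{\bar\alpha\bar\beta\gamma}\bar z^\alpha\bar z^\beta z^\gamma\Big)+\tilde R(z,\bar z,\operatorname{Re}w),$$ with $\tilde R$ vanishing to weighted order $4$ at $0$, if and only if there exist a basis $L_{\bar1},\dots,L_{\bar n}$ of CR vector fields near $p$ (with $L_\alpha=\overline{L_{\bar\alpha}}$) and a nonvanishing characteristic form $\theta$ near $p$ such that $\langle\mathcal T_{L_{\bar\alpha}}\theta,L_\beta\rangle_p=g_{\bar\alpha\beta}$ for all $\alpha,\beta$ and $\langle\mathcal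 T_{L_{\bar\alpha}}\mathcal T_{L_{\bar\beta}}\theta,L_\gamma\rangle_p=h_{\bar\alpha\bar\beta\gamma}$ for $\alpha,\beta=1,\dots,n$, $\gamma=r+s+1,\dots,n$.
   Context: CR vector fields: smooth sections of $T^{0,1}M$; characteristic forms: smooth sections of $T^0M$ (real covectors annihilating $T^cM$). $\mathcal T_L\omega=\frac1{2i}L\lrcorner d\omega$; the pairing satisfies $\langle d\omega,Y\wedge Z\rangle=Y\langle\omega,Z\rangle-Z\langle\omega,Y\rangle-\langle\omega,[Y,Z]\rangle$. By Theorem 2.9 these values depend only on the values of the fields at $p$; they are the components of the Levi form (second order tensor) and of the third order tensor. Weighted order: $z,\bar z$ weight one, $\operatorname{Re}w$ weight two. *)

theory Defs
  imports "HOL-Analysis.Analysis"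
begin

type_synonym 'n amb = "(complex ^ 'n) \<times> complex"

definition Jc :: "'n::finite amb \<Rightarrow> 'n amb" where
  "Jc v = ((\<chi> j. \<i> * (fst v $ j)), \<i> * snd v)"

fun dd :: "'a::real_normed_vector list \<Rightarrow> ('a \<Rightarrow> 'b::real_normed_vector) \<Rightarrow> 'a \<Rightarrow> 'b" where
  "dd [] f = f"
| "dd (v # vs) f = (\<lambda>x. vector_derivative (\<lambda>t::real. dd vs f (x + t *\<^sub>R v)) (at 0))"

definition cinf_on :: "'a::real_normed_vector set \<Rightarrow> ('a \<Rightarrow> 'b::real_normed_vector) \<Rightarrow> bool" where
  "cinf_on U f \<longleftrightarrow> open U \<and>
     (\<forall>vs. continuous_on U (dd vs f) \<and>
        (\<forall>v. \<forall>x\<in>U. ((\<lambda>t::real. dd vs f (x + t *\<^sub>R v)) has_vector_derivative dd (v # vs) f x) (at 0)))"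

definition real_hypersurface :: "'a::real_normed_vector set \<Rightarrow> bool" where
  "real_hypersurface M \<longleftrightarrow> (\<forall>q\<in>M. \<exists>U (\<rho>::'a \<Rightarrow> real). q \<in> U \<and> cinf_on U \<rho> \<and>
       (\<forall>x\<in>U. \<exists>v. dd [v] \<rho> x \<noteq> 0) \<and> M \<inter> U = {x\<in>U. \<rho> x = 0})"

definition tangent_vec :: "'a::real_normed_vector set \<Rightarrow> 'a \<Rightarrow> 'a \<Rightarrow> bool" where
  "tangent_vec M x v \<longleftrightarrow> (\<forall>U (f::'a \<Rightarrow> real). x \<in> U \<and> cinf_on U f \<and> (\<forall>y\<in>M \<inter> U. f y = 0)
       \<longrightarrow> dd [v] f x = 0)"

text \<open>A complex vector field A + i B, given by two real vector fields (ambient extensions).\<close>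
type_synonym 'a cvf = "('a \<Rightarrow> 'a) \<times> ('a \<Rightarrow> 'a)"

definition act :: "'a::real_normed_vector cvf \<Rightarrow> ('a \<Rightarrow> complex) \<Rightarrow> 'a \<Rightarrow> complex" where
  "act X f x = dd [fst X x] f x + \<i> * dd [snd X x] f x"

definition rbr :: "('a::real_normed_vector \<Rightarrow> 'a) \<Rightarrow> ('a \<Rightarrow> 'a) \<Rightarrow> 'a \<Rightarrow> 'a" where
  "rbr A B x = dd [A x] B x - dd [B x] A x"

definition br :: "'a::real_normed_vector cvf \<Rightarrow> 'a cvf \<Rightarrow> 'a cvf" where
  "br X Y = ((\<lambda>x. rbr (fst X) (fst Y) x - rbr (snd X) (snd Y) x),
             (\<lambda>x. rbr (fst X) (snd Y) x + rbr (snd X) (fst Y) x))"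

definition cnjv :: "'a::real_normed_vector cvf \<Rightarrow> 'a cvf" where
  "cnjv X = (fst X, (\<lambda>x. - snd X x))"

text \<open>A (complex) one-form, seen through its pairing with complex vector fields.\<close>
type_synonym 'a cform = "'a cvf \<Rightarrow> 'a \<Rightarrow> complex"

definition thform :: "('a::real_inner \<Rightarrow> 'a) \<Rightarrow> 'a cform" where
  "thform c X x = Complex (c x \<bullet> fst X x) (c x \<bullet> snd X x)"

text \<open>T_L omega = (1/2i) L _| d omega, via the invariant formula for d.\<close>
definition Top :: "'a::real_normed_vector cvf \<Rightarrow> 'a cform \<Rightarrow> 'a cform" where
  "Top L \<omega> X x = (act L (\<omega> X) x - act X (\<omega> L) x - \<omega> (br L X) x) / (2 * \<i>)"

definition cscal :: "complex \<Rightarrow> 'a::real_vector \<times> 'a \<Rightarrow> 'a \<times> 'a" where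
  "cscal c ab = (Re c *\<^sub>R fst ab - Im c *\<^sub>R snd ab, Im c *\<^sub>R fst ab + Re c *\<^sub>R snd ab)"

text \<open>Smooth section of T^{0,1}M on M \<inter> U (with a smooth ambient extension on U).\<close>
definition CR_field :: "'n::finite amb set \<Rightarrow> 'n amb set \<Rightarrow> 'n amb cvf \<Rightarrow> bool" where
  "CR_field M U L \<longleftrightarrow> cinf_on U (fst L) \<and> cinf_on U (snd L) \<and>
     (\<forall>x\<in>M \<inter> U. snd L x = Jc (fst L x) \<and> tangent_vec M x (fst L x) \<and> tangent_vec M x (Jc (fst L x)))"

definition CR_basis :: "'n::finite amb set \<Rightarrow> 'n amb set \<Rightarrow> ('n \<Rightarrow> 'n amb cvf) \<Rightarrow> bool" where
  "CR_basis M U Lb \<longleftrightarrow> (\<forall>\<alpha>. CR_field M U (Lb \<alpha>)) \<and>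
     (\<forall>x\<in>M \<inter> U.
        (\<forall>c::'n \<Rightarrow> complex. (\<Sum>\<alpha>\<in>UNIV. cscal (c \<alpha>) (fst (Lb \<alpha>) x, snd (Lb \<alpha>) x)) = (0, 0)
            \<longrightarrow> (\<forall>\<alpha>. c \<alpha> = 0)) \<and>
        (\<forall>a. tangent_vec M x a \<and> tangent_vec M x (Jc a) \<longrightarrow>
            (\<exists>c::'n \<Rightarrow> complex. (\<Sum>\<alpha>\<in>UNIV. cscal (c \<alpha>) (fst (Lb \<alpha>) x, snd (Lb \<alpha>) x)) = (a, Jc a))))"

definition char_form :: "'n::finite amb set \<Rightarrow> 'n amb set \<Rightarrow> ('n amb \<Rightarrow> 'n amb) \<Rightarrow> bool" where
  "char_form M U c \<longleftrightarrow> cinf_on U c \<and>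
     (\<forall>x\<in>M \<inter> U. (\<forall>v. tangent_vec M x v \<and> tangent_vec M x (Jc v) \<longrightarrow> c x \<bullet> v = 0) \<and>
                 (\<exists>v. tangent_vec M x v \<and> c x \<bullet> v \<noteq> 0))"

definition unitary_mat :: "('n::finite \<Rightarrow> 'n \<Rightarrow> complex) \<Rightarrow> bool" where
  "unitary_mat U \<longleftrightarrow> (\<forall>i j. (\<Sum>k\<in>UNIV. cnj (U k i) * U k j) = (if i = j then 1 else 0))"

definition herm_inertia :: "('n::finite \<Rightarrow> 'n \<Rightarrow> complex) \<Rightarrow> nat \<Rightarrow> nat \<Rightarrow> bool" where
  "herm_inertia A r s \<longleftrightarrow> (\<exists>U (d::'n \<Rightarrow> real). unitary_mat U \<and>
      (\<forall>i j. A i j = (\<Sum>k\<in>UNIV. U i k * complex_of_real (d k) * cnj (U j k))) \<and>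
      card {k. d k > 0} = r \<and> card {k. d k < 0} = s)"

definition holo_on :: "'n::finite amb set \<Rightarrow> ('n amb \<Rightarrow> 'n amb) \<Rightarrow> bool" where
  "holo_on U \<Phi> \<longleftrightarrow> open U \<and>
     (\<forall>x\<in>U. \<exists>D. (\<Phi> has_derivative D) (at x) \<and> (\<forall>v. D (Jc v) = Jc (D v)))"

definition hol_coords :: "'n::finite amb set \<Rightarrow> ('n amb \<Rightarrow> 'n amb) \<Rightarrow> bool" where
  "hol_coords U \<Phi> \<longleftrightarrow> holo_on U \<Phi> \<and> inj_on \<Phi> U \<and> open (\<Phi> ` U) \<and>
     (\<exists>\<Psi>. holo_on (\<Phi> ` U) \<Psi> \<and> (\<forall>x\<in>U. \<Psi> (\<Phi> x) = x))"

text \<open>Indices 1..n are the elements of a finite linearly ordered type; pos gives the 1-based position.\<close>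
definition pos :: "'n::{finite,linorder} \<Rightarrow> nat" where
  "pos b = card {a. a \<le> b}"

definition eps :: "nat \<Rightarrow> nat \<Rightarrow> 'n::{finite,linorder} \<Rightarrow> complex" where
  "eps r s b = (if pos b \<le> r then 1 else if pos b \<le> r + s then -1 else 0)"

definition gmat :: "nat \<Rightarrow> nat \<Rightarrow> 'n::{finite,linorder} \<Rightarrow> 'n \<Rightarrow> complex" where
  "gmat r s \<alpha> \<beta> = (if \<alpha> = \<beta> then eps r s \<beta> else 0)"

text \<open>Weights: z-directions weight 1, Re w direction weight 2.\<close>
definition wt :: "(complex ^ 'n::finite) \<times> real \<Rightarrow> nat" where
  "wt v = (if snd v = 0 then 1 else 2)"

definition weighted_vanish4 :: "((complex ^ 'n::finite) \<times> real \<Rightarrow> real) \<Rightarrow> bool" where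
  "weighted_vanish4 R \<longleftrightarrow> (\<exists>U. 0 \<in> U \<and> cinf_on U R \<and>
     (\<forall>vs. set vs \<subseteq> Basis \<and> sum_list (map wt vs) < 4 \<longrightarrow> dd vs R 0 = 0))"

definition rho_model :: "nat \<Rightarrow> nat \<Rightarrow> ('n::{finite,linorder} \<Rightarrow> 'n \<Rightarrow> 'n \<Rightarrow> complex)
     \<Rightarrow> ((complex ^ 'n::{finite,linorder}) \<times> real \<Rightarrow> real) \<Rightarrow> ('n::{finite,linorder}) amb \<Rightarrow> real" where
  "rho_model r s h R Z = (let z = fst Z; w = snd Z in
      - Im w
      + Re (\<Sum>\<alpha>\<in>UNIV. \<Sum>\<beta>\<in>UNIV. gmat r s \<alpha> \<beta> * cnj (z $ \<alpha>) * z $ \<beta>)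
      + 2 * Re (\<Sum>\<alpha>\<in>UNIV. \<Sum>\<beta>\<in>UNIV. \<Sum>\<gamma>\<in>{\<gamma>. r + s < pos \<gamma>}.
                   h \<alpha> \<beta> \<gamma> * cnj (z $ \<alpha>) * cnj (z $ \<beta>) * z $ \<gamma>)
      + R (z, Re w))"

end

theory Submission
  imports Defs "HOL-Complex_Analysis.Cauchy_Integral_Formula"
begin

text \<open>
  Let \<open>\<rho>\<close> be a local defining function. On the tangent spaces of \<open>M\<close> a characteristic form is a multiple
  \<open>\<lambda>\<close> of \<open>d\<rho> \<circ> J\<close>, and differentiating the tangency relations \<open>d\<rho> (L) = 0\<close> along \<open>M\<close> turns the
  Levi form into \<open>\<lambda> D\<^sup>2\<rho> (L, L'\<^sup>*)\<close>, where \<open>L'\<^sup>*\<close> is the conjugate of \<open>L'\<close>. If \<open>D\<^sup>2\<rho>\<close> at \<open>p\<close> pairs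
  the conjugate of \<open>L''\<close> trivially with all vectors of type (0,1), then all derivatives of the fields cancel in
  the third order tensor, and it equals \<open>\<lambda> / (2 \<i>) D\<^sup>3\<rho> (L, L', L''\<^sup>*)\<close>. These expressions only see the
  differential of a holomorphic change of coordinates, so for a hypersurface in the form of the theorem they can be
  read off the model: it yields the tensors of every frame with the right values at \<open>p\<close>.

  This proves the implication from coordinates to frames. Conversely, a linear change of coordinates
  adapts the frame and the form at \<open>p\<close>, and a polynomial one removes all terms of weighted order at most three
  except \<open>g\<close> and some terms \<open>h'\<close> along the null directions. By the first part \<open>h'\<close> is the
  third order tensor of the given frame, that is, \<open>h' = h\<close>.
\<close>

subsection \<open>Smooth functions\<close>

text \<open>The relations that define CR fields and characteristic forms hold on \<open>M\<close>
  only, while the fields themselves are ambient. Such a relation may be differentiated in tangent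
  directions and in no others, and each computation with \<open>Top\<close> is arranged accordingly.
  The obstacle is the third order tensor. It contains derivatives of all three fields, and the
  derivative of \<open>Lb\<close> may well be transverse to \<open>M\<close>. For this reason the
  null condition is required for \<open>lev2\<close> with an arbitrary vector in the first slot.
  This is a condition on the defining function as well as on \<open>M\<close>; for the model it
  holds because terms \<open>z * Re w\<close> have weight three and are absent from the remainder.
  In the converse direction the cubic coefficients \<open>h'\<close> are never computed. The
  polynomial change of coordinates has the identity as differential at the origin, so the frame
  keeps its values at the point, and the formula for frames with these values identifies
  \<open>h'\<close> on the null directions, which are the only ones that the model reads.\<close>

lemma dd_append: "dd (vs @ ws) f = dd vs (dd ws f)"
  by (induction vs) auto

text \<open>As a simp rule this equation would break every list of directions into nested
  \<open>vector_derivative\<close> terms.\<close>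

declare dd.simps(2) [simp del]

lemma dd_Cons: "dd (v # vs) f = dd [v] (dd vs f)"
  by (simp add: dd.simps(2))

lemma has_vector_derivative_imp_dd:
  "((\<lambda>t::real. f (x + t *\<^sub>R v)) has_vector_derivative d) (at 0) \<Longrightarrow> dd [v] f x = d"
  by (simp add: dd.simps(2) vector_derivative_at)

lemma eventually_line_mem:
  fixes x v :: "'a::real_normed_vector"
  assumes "open U" "x \<in> U"
  shows "\<forall>\<^sub>F t::real in nhds 0. x + t *\<^sub>R v \<in> U"
proof -
  have "((\<lambda>t::real. x + t *\<^sub>R v) \<longlongrightarrow> x + 0 *\<^sub>R v) (nhds 0)"
    by (intro tendsto_intros filterlim_ident)
  then show ?thesis
    using assms by (auto dest: topological_tendstoD)
qed

text \<open>Openness is essential: a derivative along a line sees the germ at \<open>t = 0\<close>,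
  so the induction needs agreement at all nearby points and not only at \<open>x\<close>.\<close>

lemma dd_cong:
  assumes "open U" "\<And>x. x \<in> U \<Longrightarrow> f x = g x" "x \<in> U"
  shows "dd vs f x = dd vs g x"
  using assms(3)
proof (induction vs arbitrary: x)
  case Nil
  then show ?case using assms(2) by simp
next
  case (Cons v vs)
  have "\<forall>\<^sub>F t in nhds 0. t \<in> UNIV \<longrightarrow> dd vs f (x + t *\<^sub>R v) = dd vs g (x + t *\<^sub>R v)"
    using eventually_line_mem[OF assms(1) Cons.prems, of v] by eventually_elim (use Cons.IH in auto)
  then show ?case
    by (simp add: vector_derivative_cong_eq dd.simps(2))
qed

lemma cinf_on_open: "cinf_on U f \<Longrightarrow> open U"
  by (simp add: cinf_on_def)

lemma cinf_on_deriv: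
  "cinf_on U f \<Longrightarrow> x \<in> U \<Longrightarrow> ((\<lambda>t::real. dd vs f (x + t *\<^sub>R v)) has_vector_derivative dd (v # vs) f x) (at 0)"
  unfolding cinf_on_def by blast

lemma cinf_on_continuous_dd: "cinf_on U f \<Longrightarrow> continuous_on U (dd vs f)"
  unfolding cinf_on_def by blast

lemma cinf_on_continuous: "cinf_on U f \<Longrightarrow> continuous_on U f"
  using cinf_on_continuous_dd[of U f "[]"] by simp

lemma cinf_on_dd:
  assumes "cinf_on U f"
  shows "cinf_on U (dd ws f)"
  unfolding cinf_on_def
proof (intro conjI allI ballI)
  show "open U" using assms by (rule cinf_on_open)
  fix vs
  show "continuous_on U (dd vs (dd ws f))"
    using cinf_on_continuous_dd[OF assms, of "vs @ ws"] by (simp add: dd_append)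
  fix v x
  assume "x \<in> U"
  then show "((\<lambda>t. dd vs (dd ws f) (x + t *\<^sub>R v)) has_vector_derivative dd (v # vs) (dd ws f) x) (at 0)"
    using cinf_on_deriv[OF assms, of x "vs @ ws" v] by (simp add: dd_append flip: append_Cons)
qed

lemma cinf_on_subset:
  assumes "cinf_on U f" "open V" "V \<subseteq> U"
  shows "cinf_on V f"
  using assms unfolding cinf_on_def by (meson continuous_on_subset subsetD)

text \<open>It suffices to exhibit a class of continuous functions that contains \<open>f\<close>
  and is closed under derivatives along lines, since each \<open>dd vs f\<close> then coincides on
  \<open>U\<close> with a member of the class. Most closure properties below come down to guessing
  the right class.\<close>

lemma cinf_on_coinduct:
  fixes f :: "'a::real_normed_vector \<Rightarrow> 'b::real_normed_vector"
  assumes "open U" "P f"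
    and cont: "\<And>g. P g \<Longrightarrow> continuous_on U g"
    and step: "\<And>g v. P g \<Longrightarrow> \<exists>g'. P g' \<and>
      (\<forall>x\<in>U. ((\<lambda>t::real. g (x + t *\<^sub>R v)) has_vector_derivative g' x) (at 0))"
  shows "cinf_on U f"
proof -
  have ex: "\<exists>g. P g \<and> (\<forall>x\<in>U. dd vs f x = g x)" for vs
  proof (induction vs)
    case Nil
    then show ?case using assms(2) by auto
  next
    case (Cons v vs)
    then obtain g where g: "P g" "\<forall>x\<in>U. dd vs f x = g x" by blast
    obtain g' where g': "P g'" "\<forall>x\<in>U. ((\<lambda>t::real. g (x + t *\<^sub>R v)) has_vector_derivative g' x) (at 0)"
      using step[OF g(1)] by blast
    have "dd (v # vs) f x = g' x" if "x \<in> U" for x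
    proof -
      have "dd (v # vs) f x = dd [v] (dd vs f) x" by (simp add: dd_Cons[of v vs])
      also have "\<dots> = dd [v] g x"
        by (rule dd_cong[OF assms(1)]) (use g that in auto)
      also have "\<dots> = g' x"
        using g'(2) that by (auto intro: has_vector_derivative_imp_dd)
      finally show ?thesis .
    qed
    then show ?case using g'(1) by blast
  qed
  show ?thesis
    unfolding cinf_on_def
  proof (intro conjI allI ballI)
    show "open U" by fact
    fix vs
    obtain g where g: "P g" "\<forall>x\<in>U. dd vs f x = g x" using ex by blast
    show "continuous_on U (dd vs f)"
      using cont[OF g(1)] g(2) by (simp cong: continuous_on_cong)
    fix v x
    assume x: "x \<in> U"
    obtain g' where g': "P g'" "\<forall>x\<in>U. ((\<lambda>t::real. g (x + t *\<^sub>R v)) has_vector_derivative g' x) (at 0)"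
      using step[OF g(1)] by blast
    have ev: "\<forall>\<^sub>F t in nhds 0. g (x + t *\<^sub>R v) = dd vs f (x + t *\<^sub>R v)"
      using eventually_line_mem[OF assms(1) x, of v] by eventually_elim (use g in auto)
    have der: "((\<lambda>t. dd vs f (x + t *\<^sub>R v)) has_vector_derivative g' x) (at 0)"
      using g'(2) x ev g(2)
      by (subst has_vector_derivative_cong_ev[where g="\<lambda>t. g (x + t *\<^sub>R v)"])
         (auto elim: eventually_mono)
    then show "((\<lambda>t. dd vs f (x + t *\<^sub>R v)) has_vector_derivative dd (v # vs) f x) (at 0)"
      using has_vector_derivative_imp_dd[OF der] by (simp add: dd_Cons[of v vs])
  qed
qed

lemma cinf_on_cong:
  assumes "cinf_on U f" "\<And>x. x \<in> U \<Longrightarrow> f x = g x"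
  shows "cinf_on U g"
proof (rule cinf_on_coinduct[where P="\<lambda>h. \<exists>k. cinf_on U k \<and> (\<forall>x\<in>U. k x = h x)"])
  show U: "open U" using assms(1) by (rule cinf_on_open)
  show "\<exists>k. cinf_on U k \<and> (\<forall>x\<in>U. k x = g x)" using assms by blast
  fix h assume "\<exists>k. cinf_on U k \<and> (\<forall>x\<in>U. k x = h x)"
  then obtain k where k: "cinf_on U k" "\<forall>x\<in>U. k x = h x" by blast
  show "continuous_on U h"
    using cinf_on_continuous[OF k(1)] k(2) by (simp cong: continuous_on_cong)
  fix v
  have "((\<lambda>t. h (x + t *\<^sub>R v)) has_vector_derivative dd [v] k x) (at 0)" if "x \<in> U" for x
  proof -
    have "\<forall>\<^sub>F t in nhds 0. k (x + t *\<^sub>R v) = h (x + t *\<^sub>R v)"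
      using eventually_line_mem[OF U that, of v] by eventually_elim (use k in auto)
    then show ?thesis
      using cinf_on_deriv[OF k(1) that, of "[]" v] that k(2)
      by (subst has_vector_derivative_cong_ev[where g="\<lambda>t. k (x + t *\<^sub>R v)"])
         (auto elim: eventually_mono)
  qed
  then show "\<exists>g'. (\<exists>k. cinf_on U k \<and> (\<forall>x\<in>U. k x = g' x)) \<and>
      (\<forall>x\<in>U. ((\<lambda>t. h (x + t *\<^sub>R v)) has_vector_derivative g' x) (at 0))"
    using cinf_on_dd[OF k(1)] by blast
qed

text \<open>Continuous partial derivatives give a linear approximation, one coordinate at a time;
  \<open>S\<close> holds the coordinates already moved. Along the next segment the mean value
  inequality bounds the new error by the oscillation of \<open>dd [b] f\<close> near
  \<open>x\<close>.\<close>

lemma cinf_on_partial_increment: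
  fixes f :: "'a::euclidean_space \<Rightarrow> 'b::real_normed_vector"
  assumes f: "cinf_on U f" and x: "x \<in> U" and "finite S" "S \<subseteq> Basis" "0 < e"
  shows "\<exists>d>0. \<forall>h. norm h < d \<longrightarrow>
     norm (f (x + (\<Sum>b\<in>S. (h \<bullet> b) *\<^sub>R b)) - f x - (\<Sum>b\<in>S. (h \<bullet> b) *\<^sub>R dd [b] f x)) \<le> e * norm h"
  using assms(3,4,5)
proof (induction S arbitrary: e rule: finite_induct)
  case empty
  show ?case by (rule exI[of _ 1]) (use empty in simp)
next
  case (insert b S)
  obtain d1 where d1: "d1 > 0" "\<And>h. norm h < d1 \<Longrightarrow>
     norm (f (x + (\<Sum>b\<in>S. (h \<bullet> b) *\<^sub>R b)) - f x - (\<Sum>b\<in>S. (h \<bullet> b) *\<^sub>R dd [b] f x)) \<le> e / 2 * norm h"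
    using insert.IH[of "e/2"] insert.prems by auto
  have "continuous_on U (dd [b] f)"
    by (rule cinf_on_continuous_dd[OF f])
  then have "isCont (dd [b] f) x"
    using cinf_on_open[OF f] x by (simp add: continuous_on_eq_continuous_at)
  then obtain d2 where d2: "d2 > 0" "\<And>y. dist y x < d2 \<Longrightarrow> dist (dd [b] f y) (dd [b] f x) < e / 2"
    using insert.prems unfolding continuous_at_eps_delta by (auto dest!: spec[of _ "e / 2"])
  obtain d3 where d3: "d3 > 0" "ball x d3 \<subseteq> U"
    using cinf_on_open[OF f] x by (meson open_contains_ball)
  \<comment> \<open>The partial sum contributes at most \<open>card S * norm h\<close> to the
    distance from \<open>x\<close> and the segment at most \<open>norm h\<close>, so
    \<open>norm h * K\<close> bounds the distance.\<close>
  define K where "K = real (card S) + 2"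
  define d where "d = min d1 (min d2 d3 / K)"
  have K: "K > 0" by (simp add: K_def add_nonneg_pos)
  have d: "d > 0" using d1 d2 d3 K by (auto simp: d_def)
  have b: "b \<in> Basis" using insert.prems by auto
  show ?case
  proof (intro exI[of _ d] conjI allI impI)
    show "d > 0" by fact
    fix h :: 'a assume h: "norm h < d"
    define y where "y = x + (\<Sum>b\<in>S. (h \<bullet> b) *\<^sub>R b)"
    have ny: "norm (\<Sum>b\<in>S. (h \<bullet> b) *\<^sub>R b) \<le> card S * norm h"
    proof -
      have "norm (\<Sum>b\<in>S. (h \<bullet> b) *\<^sub>R b) \<le> (\<Sum>b\<in>S. norm h)"
        using insert.prems by (intro sum_norm_le) (auto simp: Basis_le_norm)
      then show ?thesis by simp
    qed
    have hK: "norm h * K < min d2 d3"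
      using h K by (simp add: d_def pos_less_divide_eq)
    have near: "dist (y + t *\<^sub>R b) x < min d2 d3" if "\<bar>t\<bar> \<le> \<bar>h \<bullet> b\<bar>" for t
    proof -
      have "dist (y + t *\<^sub>R b) x \<le> norm (\<Sum>b\<in>S. (h \<bullet> b) *\<^sub>R b) + norm (t *\<^sub>R b)"
        unfolding y_def dist_norm by (metis add.assoc add_diff_cancel_left' norm_triangle_ineq)
      also have "\<dots> \<le> card S * norm h + norm h"
        using ny that b Basis_le_norm[OF b, of h] by (intro add_mono) auto
      also have "\<dots> \<le> norm h * K" by (simp add: K_def algebra_simps)
      finally show ?thesis using hK by simp
    qed
    let ?I = "closed_segment 0 (h \<bullet> b)"
    have seg: "\<bar>t\<bar> \<le> \<bar>h \<bullet> b\<bar>" if "t \<in> ?I" for t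
      using that by (auto simp: closed_segment_eq_real_ivl split: if_splits)
    \<comment> \<open>With the expected linear part subtracted, the derivative is small along the
      segment, and the mean value inequality gives the error term directly.\<close>
    let ?g = "\<lambda>t. f (y + t *\<^sub>R b) - t *\<^sub>R dd [b] f x"
    have der: "(?g has_derivative (\<lambda>s. s *\<^sub>R (dd [b] f (y + t *\<^sub>R b) - dd [b] f x))) (at t within ?I)"
      if t: "t \<in> ?I" for t
    proof -
      have mem: "y + t *\<^sub>R b \<in> U"
        using near[OF seg[OF t]] d3 by (auto simp: dist_commute)
      have "((\<lambda>s. f ((y + t *\<^sub>R b) + s *\<^sub>R b)) has_vector_derivative dd [b] f (y + t *\<^sub>R b)) (at 0)"
        using cinf_on_deriv[OF f mem, of "[]" b] by simp
      then have "((\<lambda>s. f ((y + t *\<^sub>R b) + s *\<^sub>R b)) has_vector_derivative dd [b] f (y + t *\<^sub>R b)) (at (t - t))"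
        by simp
      then have "(((\<lambda>s. f ((y + t *\<^sub>R b) + s *\<^sub>R b)) \<circ> (\<lambda>s. s - t)) has_vector_derivative
         1 *\<^sub>R dd [b] f (y + t *\<^sub>R b)) (at t)"
        by (intro vector_diff_chain_at) (auto intro!: derivative_eq_intros)
      then have "((\<lambda>s. f (y + s *\<^sub>R b)) has_vector_derivative dd [b] f (y + t *\<^sub>R b)) (at t)"
        by (simp add: o_def algebra_simps)
      then have "((\<lambda>s. f (y + s *\<^sub>R b)) has_derivative (\<lambda>s. s *\<^sub>R dd [b] f (y + t *\<^sub>R b))) (at t within ?I)"
        using has_vector_derivative_def has_derivative_at_withinI by blast
      then show ?thesis
        by (auto intro!: derivative_eq_intros simp: algebra_simps)
    qed
    have "norm (?g (h \<bullet> b) - ?g 0) \<le> e / 2 * norm (h \<bullet> b - 0)"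
    proof (rule differentiable_bound[OF convex_closed_segment der])
      fix t assume t: "t \<in> ?I"
      have "norm (dd [b] f (y + t *\<^sub>R b) - dd [b] f x) \<le> e / 2"
        using d2(2)[of "y + t *\<^sub>R b"] near[OF seg[OF t]] by (simp add: dist_norm)
      then have "norm (s *\<^sub>R (dd [b] f (y + t *\<^sub>R b) - dd [b] f x)) \<le> e / 2 * norm s" for s :: real
        using mult_left_mono[of _ "e / 2" "\<bar>s\<bar>"] by (metis abs_ge_zero mult.commute norm_scaleR real_norm_def)
      then show "onorm (\<lambda>s. s *\<^sub>R (dd [b] f (y + t *\<^sub>R b) - dd [b] f x)) \<le> e / 2"
        by (intro onorm_bound) (use insert.prems in auto)
    qed auto
    also have "\<dots> \<le> e / 2 * norm h"
      using insert.prems Basis_le_norm[OF b, of h] by (intro mult_left_mono) auto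
    finally have 1: "norm (f (y + (h \<bullet> b) *\<^sub>R b) - (h \<bullet> b) *\<^sub>R dd [b] f x - f y) \<le> e / 2 * norm h"
      by simp
    have 2: "norm (f y - f x - (\<Sum>b\<in>S. (h \<bullet> b) *\<^sub>R dd [b] f x)) \<le> e / 2 * norm h"
      using d1(2)[of h] h unfolding y_def d_def by auto
    have "f (x + (\<Sum>b\<in>insert b S. (h \<bullet> b) *\<^sub>R b)) - f x - (\<Sum>b\<in>insert b S. (h \<bullet> b) *\<^sub>R dd [b] f x) =
       (f (y + (h \<bullet> b) *\<^sub>R b) - (h \<bullet> b) *\<^sub>R dd [b] f x - f y) + (f y - f x - (\<Sum>b\<in>S. (h \<bullet> b) *\<^sub>R dd [b] f x))"
      using insert.hyps by (simp add: y_def algebra_simps)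
    also have "norm \<dots> \<le> e / 2 * norm h + e / 2 * norm h"
      using norm_triangle_le 1 2 by (meson add_mono order_trans norm_triangle_ineq)
    finally show "norm (f (x + (\<Sum>b\<in>insert b S. (h \<bullet> b) *\<^sub>R b)) - f x -
        (\<Sum>b\<in>insert b S. (h \<bullet> b) *\<^sub>R dd [b] f x)) \<le> e * norm h"
      by simp
  qed
qed

lemma has_derivative_along_line:
  fixes x v :: "'a::real_normed_vector"
  assumes "(f has_derivative f') (at x)"
  shows "((\<lambda>t::real. f (x + t *\<^sub>R v)) has_vector_derivative f' v) (at 0)"
proof -
  have "((\<lambda>t::real. x + t *\<^sub>R v) has_derivative (\<lambda>t. t *\<^sub>R v)) (at 0)"
    by (auto intro!: derivative_eq_intros)
  moreover have "(f has_derivative f') (at (x + 0 *\<^sub>R v))"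
    using assms by simp
  ultimately have "((\<lambda>t::real. f (x + t *\<^sub>R v)) has_derivative (\<lambda>t. f' (t *\<^sub>R v))) (at 0)"
    by (rule has_derivative_compose)
  then show ?thesis
    using has_derivative_bounded_linear[OF assms]
    by (simp add: has_vector_derivative_def linear_simps)
qed

text \<open>\<open>cinf_on\<close> does not ask that derivatives be linear in the direction.
  Linearity is obtained here, and all later multilinearity rests on it.\<close>

lemma cinf_on_has_derivative:
  fixes f :: "'a::euclidean_space \<Rightarrow> 'b::real_normed_vector"
  assumes f: "cinf_on U f" and x: "x \<in> U"
  shows "(f has_derivative (\<lambda>v. dd [v] f x)) (at x)"
proof -
  let ?D = "\<lambda>h. \<Sum>b\<in>Basis. (h \<bullet> b) *\<^sub>R dd [b] f x"
  have D: "(f has_derivative ?D) (at x)"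
    unfolding has_derivative_at_alt
  proof (intro conjI allI impI)
    show "bounded_linear ?D"
      by (intro bounded_linear_sum bounded_linear_scaleR_const bounded_linear_inner_left)
    fix e :: real assume "e > 0"
    obtain d where d: "d > 0" "\<And>h. norm h < d \<Longrightarrow> norm (f (x + (\<Sum>b\<in>Basis. (h \<bullet> b) *\<^sub>R b)) - f x - ?D h) \<le> e * norm h"
      using cinf_on_partial_increment[OF f x finite_Basis order_refl \<open>e > 0\<close>] by blast
    show "\<exists>d>0. \<forall>y. norm (y - x) < d \<longrightarrow> norm (f y - f x - ?D (y - x)) \<le> e * norm (y - x)"
    proof (intro exI[of _ d] conjI allI impI)
      fix y assume "norm (y - x) < d"
      from d(2)[OF this] show "norm (f y - f x - ?D (y - x)) \<le> e * norm (y - x)"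
        by (simp add: euclidean_representation)
    qed (use d in auto)
  qed
  have "dd [v] f x = ?D v" for v
    by (rule has_vector_derivative_imp_dd[OF has_derivative_along_line[OF D]])
  then have "(\<lambda>v. dd [v] f x) = ?D" by (rule ext)
  then show ?thesis using D by simp
qed

lemma has_derivative_imp_dd: "(f has_derivative f') (at x) \<Longrightarrow> dd [v] f x = f' v"
  by (rule has_vector_derivative_imp_dd[OF has_derivative_along_line])

lemma linear_dd:
  fixes f :: "'a::euclidean_space \<Rightarrow> 'b::real_normed_vector"
  shows "cinf_on U f \<Longrightarrow> x \<in> U \<Longrightarrow> linear (\<lambda>v. dd [v] f x)"
  using cinf_on_has_derivative has_derivative_linear by blast

lemma dd_basis_expand:
  fixes f :: "'a::euclidean_space \<Rightarrow> 'b::real_normed_vector"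
  assumes "cinf_on U f" "x \<in> U"
  shows "dd [v] f x = (\<Sum>b\<in>Basis. (v \<bullet> b) *\<^sub>R dd [b] f x)"
proof -
  interpret linear "\<lambda>v. dd [v] f x" using assms by (rule linear_dd)
  show ?thesis
    by (subst euclidean_representation[of v, symmetric]) (simp only: sum scale)
qed

section \<open>Closure properties of smooth functions\<close>

lemma cinf_on_const: "open U \<Longrightarrow> cinf_on U (\<lambda>x. c)"
  by (rule cinf_on_coinduct[where P="\<lambda>f. \<exists>c. f = (\<lambda>x. c)"])
     (auto intro!: derivative_eq_intros exI[of _ "\<lambda>x. 0"])

lemma dd_bounded_linear_apply:
  fixes f :: "'a::real_normed_vector \<Rightarrow> 'b::real_normed_vector"
  assumes f: "cinf_on U f" and l: "bounded_linear l"
  shows "x \<in> U \<Longrightarrow> dd vs (\<lambda>x. l (f x)) x = l (dd vs f x)"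
proof (induction vs arbitrary: x)
  case Nil
  then show ?case by simp
next
  case (Cons v vs)
  have "dd (v # vs) (\<lambda>x. l (f x)) x = dd [v] (dd vs (\<lambda>x. l (f x))) x" by (simp add: dd_Cons[of v vs])
  also have "\<dots> = dd [v] (\<lambda>x. l (dd vs f x)) x"
    by (rule dd_cong[OF cinf_on_open[OF f]]) (use Cons in auto)
  also have "\<dots> = l (dd (v # vs) f x)"
    by (rule has_vector_derivative_imp_dd, rule bounded_linear.has_vector_derivative[OF l cinf_on_deriv[OF f Cons.prems]])
  finally show ?case .
qed

lemma cinf_on_bounded_linear_apply:
  fixes f :: "'a::real_normed_vector \<Rightarrow> 'b::real_normed_vector"
  assumes f: "cinf_on U f" and l: "bounded_linear l"
  shows "cinf_on U (\<lambda>x. l (f x))"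
proof (rule cinf_on_coinduct[where P="\<lambda>h. \<exists>g. cinf_on U g \<and> h = (\<lambda>x. l (g x))"])
  show "open U" using f by (rule cinf_on_open)
  show "\<exists>g. cinf_on U g \<and> (\<lambda>x. l (f x)) = (\<lambda>x. l (g x))" using f by blast
  fix h assume "\<exists>g. cinf_on U g \<and> h = (\<lambda>x. l (g x))"
  then obtain g where g: "cinf_on U g" "h = (\<lambda>x. l (g x))" by blast
  show "continuous_on U h"
    unfolding g(2) by (intro bounded_linear.continuous_on[OF l] cinf_on_continuous g)
  fix v
  show "\<exists>g'. (\<exists>g. cinf_on U g \<and> g' = (\<lambda>x. l (g x))) \<and>
      (\<forall>x\<in>U. ((\<lambda>t. h (x + t *\<^sub>R v)) has_vector_derivative g' x) (at 0))"
    using bounded_linear.has_vector_derivative[OF l cinf_on_deriv[OF g(1), of _ "[]" v]] cinf_on_dd[OF g(1)]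
    unfolding g(2) by (intro exI[of _ "\<lambda>x. l (dd [v] g x)"]) auto
qed

text \<open>A single product is not closed under derivatives; the Leibniz rule leads to sums of
  products, hence this class for \<open>cinf_on_coinduct\<close>.\<close>

inductive bilin_class :: "('b::real_normed_vector \<Rightarrow> 'c::real_normed_vector \<Rightarrow> 'd::real_normed_vector) \<Rightarrow>
    'a::real_normed_vector set \<Rightarrow> ('a \<Rightarrow> 'd) \<Rightarrow> bool"
  for B U where
  prod: "cinf_on U f \<Longrightarrow> cinf_on U g \<Longrightarrow> bilin_class B U (\<lambda>x. B (f x) (g x))"
| add: "bilin_class B U f \<Longrightarrow> bilin_class B U g \<Longrightarrow> bilin_class B U (\<lambda>x. f x + g x)"

lemma cinf_on_bilinear:
  assumes B: "bounded_bilinear B" and f: "cinf_on U f" and g: "cinf_on U g"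
  shows "cinf_on U (\<lambda>x. B (f x) (g x))"
proof (rule cinf_on_coinduct[where P="bilin_class B U"])
  show "open U" using f by (rule cinf_on_open)
  show "bilin_class B U (\<lambda>x. B (f x) (g x))" using f g by (rule bilin_class.prod)
  fix h assume "bilin_class B U h"
  then show "continuous_on U h"
    by induction (auto intro!: bounded_bilinear.continuous_on[OF B] continuous_on_add intro: cinf_on_continuous)
next
  fix h v assume "bilin_class B U h"
  then show "\<exists>h'. bilin_class B U h' \<and> (\<forall>x\<in>U. ((\<lambda>t. h (x + t *\<^sub>R v)) has_vector_derivative h' x) (at 0))"
  proof induction
    case (prod f g)
    have "bilin_class B U (\<lambda>x. B (f x) (dd [v] g x) + B (dd [v] f x) (g x))"
      using prod by (intro bilin_class.intros cinf_on_dd)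
    moreover have "((\<lambda>t. B (f (x + t *\<^sub>R v)) (g (x + t *\<^sub>R v))) has_vector_derivative
        B (f x) (dd [v] g x) + B (dd [v] f x) (g x)) (at 0)" if "x \<in> U" for x
      using bounded_bilinear.has_vector_derivative[OF B
          cinf_on_deriv[OF prod(1) that, of "[]" v] cinf_on_deriv[OF prod(2) that, of "[]" v]]
      by simp
    ultimately show ?case by blast
  next
    case (add f g)
    then obtain f' g' where "bilin_class B U f'" "\<forall>x\<in>U. ((\<lambda>t. f (x + t *\<^sub>R v)) has_vector_derivative f' x) (at 0)"
       "bilin_class B U g'" "\<forall>x\<in>U. ((\<lambda>t. g (x + t *\<^sub>R v)) has_vector_derivative g' x) (at 0)"
      by blast
    then show ?case
      by (intro exI[of _ "\<lambda>x. f' x + g' x"]) (auto intro!: bilin_class.add has_vector_derivative_add)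
  qed
qed

lemma cinf_on_add:
  fixes f g :: "'a::real_normed_vector \<Rightarrow> 'b::real_normed_vector"
  assumes f: "cinf_on U f" and g: "cinf_on U g"
  shows "cinf_on U (\<lambda>x. f x + g x)"
proof (rule cinf_on_coinduct[where P="\<lambda>h. \<exists>f g. cinf_on U f \<and> cinf_on U g \<and> h = (\<lambda>x. f x + g x)"])
  show "open U" using f by (rule cinf_on_open)
  show "\<exists>f' g'. cinf_on U f' \<and> cinf_on U g' \<and> (\<lambda>x. f x + g x) = (\<lambda>x. f' x + g' x)" using f g by blast
  fix h assume "\<exists>f g. cinf_on U f \<and> cinf_on U g \<and> h = (\<lambda>x. f x + g x)"
  then obtain f g where h: "cinf_on U f" "cinf_on U g" "h = (\<lambda>x. f x + g x)" by blast
  show "continuous_on U h" unfolding h(3) by (intro continuous_on_add cinf_on_continuous h)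
  fix v
  show "\<exists>g'. (\<exists>f g. cinf_on U f \<and> cinf_on U g \<and> g' = (\<lambda>x. f x + g x)) \<and>
      (\<forall>x\<in>U. ((\<lambda>t. h (x + t *\<^sub>R v)) has_vector_derivative g' x) (at 0))"
    using has_vector_derivative_add[OF cinf_on_deriv[OF h(1), of _ "[]" v] cinf_on_deriv[OF h(2), of _ "[]" v]]
      cinf_on_dd[OF h(1)] cinf_on_dd[OF h(2)]
    unfolding h(3) by (intro exI[of _ "\<lambda>x. dd [v] f x + dd [v] g x"] conjI exI[of _ "dd [v] f"] exI[of _ "dd [v] g"]) auto
qed

lemma cinf_on_minus: "cinf_on U f \<Longrightarrow> cinf_on U (\<lambda>x. - f x)"
  by (rule cinf_on_bounded_linear_apply[OF _ bounded_linear_minus[OF bounded_linear_ident]])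

lemma cinf_on_diff: "cinf_on U f \<Longrightarrow> cinf_on U g \<Longrightarrow> cinf_on U (\<lambda>x. f x - g x)"
  using cinf_on_add[OF _ cinf_on_minus] by force

lemma cinf_on_sum:
  assumes "open U" "\<And>i. i \<in> I \<Longrightarrow> cinf_on U (f i)"
  shows "cinf_on U (\<lambda>x. \<Sum>i\<in>I. f i x)"
  using assms(2)
  by (induction I rule: infinite_finite_induct) (auto intro!: cinf_on_const cinf_on_add assms(1))

lemma cinf_on_ident: "open U \<Longrightarrow> cinf_on U (\<lambda>x. x)"
proof (rule cinf_on_coinduct[where P="\<lambda>f. f = (\<lambda>x. x) \<or> (\<exists>c. f = (\<lambda>x. c))"])
  fix g :: "'a \<Rightarrow> 'a" and v
  assume "g = (\<lambda>x. x) \<or> (\<exists>c. g = (\<lambda>x. c))"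
  then show "\<exists>g'. (g' = (\<lambda>x. x) \<or> (\<exists>c. g' = (\<lambda>x. c))) \<and>
      (\<forall>x\<in>U. ((\<lambda>t. g (x + t *\<^sub>R v)) has_vector_derivative g' x) (at 0))"
  proof
    assume "g = (\<lambda>x. x)"
    then show ?thesis
      by (intro exI[of _ "\<lambda>x. v"]) (auto intro!: derivative_eq_intros)
  next
    assume "\<exists>c. g = (\<lambda>x. c)"
    then show ?thesis
      by (intro exI[of _ "\<lambda>x. 0"]) (auto intro!: derivative_eq_intros)
  qed
qed auto

lemma cinf_on_linear:
  fixes l :: "'a::euclidean_space \<Rightarrow> 'b::real_normed_vector"
  assumes "open U" "linear l"
  shows "cinf_on U l"
  using cinf_on_bounded_linear_apply[OF cinf_on_ident[OF assms(1)] linear_conv_bounded_linear[THEN iffD1, OF assms(2)]] .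

lemma cinf_on_scaleR: "cinf_on U a \<Longrightarrow> cinf_on U f \<Longrightarrow> cinf_on U (\<lambda>x. a x *\<^sub>R f x)"
  by (rule cinf_on_bilinear[OF bounded_bilinear_scaleR])

lemma cinf_on_mult:
  fixes f g :: "'a::real_normed_vector \<Rightarrow> 'b::real_normed_algebra"
  shows "cinf_on U f \<Longrightarrow> cinf_on U g \<Longrightarrow> cinf_on U (\<lambda>x. f x * g x)"
  by (rule cinf_on_bilinear[OF bounded_bilinear_mult])

lemma cinf_on_inner: "cinf_on U f \<Longrightarrow> cinf_on U g \<Longrightarrow> cinf_on U (\<lambda>x. f x \<bullet> g x)"
  by (rule cinf_on_bilinear[OF bounded_bilinear_inner])

lemma cinf_on_Pair:
  assumes "cinf_on U f" "cinf_on U g"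
  shows "cinf_on U (\<lambda>x. (f x, g x))"
proof -
  have "cinf_on U (\<lambda>x. (f x, 0) + (0, g x))"
    by (intro cinf_on_add cinf_on_bounded_linear_apply[OF assms(1)] cinf_on_bounded_linear_apply[OF assms(2)]
        bounded_linear_Pair bounded_linear_ident bounded_linear_zero)
  then show ?thesis by simp
qed

text \<open>The chain rule writes a derivative of a composition as a sum of derivatives of
  \<open>h\<close> at \<open>f x\<close>, weighted by coordinates of a derivative of
  \<open>f\<close>. The three generators are what is needed to stay in the class.\<close>

inductive comp_class :: "('a::real_normed_vector \<Rightarrow> 'b::real_normed_vector) \<Rightarrow> 'a set \<Rightarrow> 'b set \<Rightarrow>
    ('a \<Rightarrow> 'c::real_normed_vector) \<Rightarrow> bool"
  for f U V where
  comp: "cinf_on V h \<Longrightarrow> comp_class f U V (\<lambda>x. h (f x))"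
| scale: "cinf_on U a \<Longrightarrow> comp_class f U V g \<Longrightarrow> comp_class f U V (\<lambda>x. a x *\<^sub>R g x)"
| add: "comp_class f U V g \<Longrightarrow> comp_class f U V h \<Longrightarrow> comp_class f U V (\<lambda>x. g x + h x)"

lemma cinf_on_compose:
  fixes f :: "'a::real_normed_vector \<Rightarrow> 'b::euclidean_space" and h :: "'b \<Rightarrow> 'c::real_normed_vector"
  assumes h: "cinf_on V h" and f: "cinf_on U f" and sub: "\<And>x. x \<in> U \<Longrightarrow> f x \<in> V"
  shows "cinf_on U (\<lambda>x. h (f x))"
proof (rule cinf_on_coinduct[where P="comp_class f U V"])
  show "open U" using f by (rule cinf_on_open)
  show "comp_class f U V (\<lambda>x. h (f x))" using h by (rule comp_class.comp)
  fix g :: "'a \<Rightarrow> 'c" assume "comp_class f U V g"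
  then show "continuous_on U g"
  proof induction
    case (comp h)
    show ?case
      by (rule continuous_on_compose2[OF cinf_on_continuous[OF comp] cinf_on_continuous[OF f]]) (use sub in auto)
  qed (auto intro!: continuous_on_scaleR continuous_on_add intro: cinf_on_continuous)
next
  have sum: "comp_class f U V (\<lambda>x. \<Sum>i\<in>I. g i x)" if "finite I" "\<And>i. i \<in> I \<Longrightarrow> comp_class f U V (g i)"
    for I and g :: "'b \<Rightarrow> 'a \<Rightarrow> 'c"
    using that
  proof (induction I rule: finite_induct)
    case empty
    show ?case
      using comp_class.comp[OF cinf_on_const[OF cinf_on_open[OF h]], of f U "0::'c"] by simp
  qed (auto intro: comp_class.add)
  fix g :: "'a \<Rightarrow> 'c" and v assume "comp_class f U V g"
  then show "\<exists>g'. comp_class f U V g' \<and> (\<forall>x\<in>U. ((\<lambda>t. g (x + t *\<^sub>R v)) has_vector_derivative g' x) (at 0))"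
  proof induction
    case (comp h)
    let ?g' = "\<lambda>x. \<Sum>b\<in>Basis. (dd [v] f x \<bullet> b) *\<^sub>R dd [b] h (f x)"
    have "comp_class f U V ?g'"
      by (intro sum comp_class.scale comp_class.comp cinf_on_dd[OF comp]
          cinf_on_bounded_linear_apply[OF cinf_on_dd[OF f] bounded_linear_inner_left]) auto
    moreover have "((\<lambda>t. h (f (x + t *\<^sub>R v))) has_vector_derivative ?g' x) (at 0)" if x: "x \<in> U" for x
    proof -
      have 1: "((\<lambda>t. f (x + t *\<^sub>R v)) has_derivative (\<lambda>t. t *\<^sub>R dd [v] f x)) (at 0)"
        using cinf_on_deriv[OF f x, of "[]" v] by (simp add: has_vector_derivative_def)
      have 2: "(h has_derivative (\<lambda>w. dd [w] h (f x))) (at (f (x + 0 *\<^sub>R v)))"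
        using cinf_on_has_derivative[OF comp sub[OF x]] by simp
      interpret linear "\<lambda>w. dd [w] h (f x)" by (rule linear_dd[OF comp sub[OF x]])
      have "((\<lambda>t. h (f (x + t *\<^sub>R v))) has_derivative (\<lambda>t. dd [t *\<^sub>R dd [v] f x] h (f x))) (at 0)"
        by (rule has_derivative_compose[OF 1 2])
      also have "(\<lambda>t. dd [t *\<^sub>R dd [v] f x] h (f x)) = (\<lambda>t. t *\<^sub>R ?g' x)"
        using dd_basis_expand[OF comp sub[OF x], of "dd [v] f x"] by (auto simp: scale)
      finally show ?thesis by (simp add: has_vector_derivative_def)
    qed
    ultimately show ?case by blast
  next
    case (scale a g)
    then obtain g' where g': "comp_class f U V g'" "\<forall>x\<in>U. ((\<lambda>t. g (x + t *\<^sub>R v)) has_vector_derivative g' x) (at 0)"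
      by blast
    have "comp_class f U V (\<lambda>x. a x *\<^sub>R g' x + dd [v] a x *\<^sub>R g x)"
      using scale g' by (intro comp_class.intros cinf_on_dd)
    moreover have "((\<lambda>t. a (x + t *\<^sub>R v) *\<^sub>R g (x + t *\<^sub>R v)) has_vector_derivative
        a x *\<^sub>R g' x + dd [v] a x *\<^sub>R g x) (at 0)" if "x \<in> U" for x
      using bounded_bilinear.has_vector_derivative[OF bounded_bilinear_scaleR
          cinf_on_deriv[OF scale(1) that, of "[]" v], of "\<lambda>t. g (x + t *\<^sub>R v)" "g' x"] g' that
      by simp
    ultimately show ?case by blast
  next
    case (add f1 g1)
    then obtain f' g' where "comp_class f U V f'" "\<forall>x\<in>U. ((\<lambda>t. f1 (x + t *\<^sub>R v)) has_vector_derivative f' x) (at 0)"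
       "comp_class f U V g'" "\<forall>x\<in>U. ((\<lambda>t. g1 (x + t *\<^sub>R v)) has_vector_derivative g' x) (at 0)"
      by blast
    then show ?case
      by (intro exI[of _ "\<lambda>x. f' x + g' x"]) (auto intro!: comp_class.add has_vector_derivative_add)
  qed
qed

text \<open>The class consists of the functions \<open>c * inverse x ^ k\<close>; differentiation
  raises \<open>k\<close> by one.\<close>

lemma cinf_on_real_inverse: "cinf_on (- {0}) (inverse :: real \<Rightarrow> real)"
proof (rule cinf_on_coinduct[where P="\<lambda>f. \<exists>c k. f = (\<lambda>x. c * inverse x ^ k)"])
  show "\<exists>c k. (inverse :: real \<Rightarrow> real) = (\<lambda>x. c * inverse x ^ k)"
    by (intro exI[of _ 1]) auto
  fix g :: "real \<Rightarrow> real" assume "\<exists>c k. g = (\<lambda>x. c * inverse x ^ k)"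
  then obtain c k where g: "g = (\<lambda>x. c * inverse x ^ k)" by blast
  show "continuous_on (- {0}) g" unfolding g by (intro continuous_intros) auto
  fix v :: real
  have "((\<lambda>t. g (x + t *\<^sub>R v)) has_vector_derivative (- c * of_nat k * v) * inverse x ^ Suc k) (at 0)"
    if "x \<in> - {0}" for x
  proof (cases k)
    case 0
    then show ?thesis by (simp add: g)
  next
    case (Suc m)
    have "((\<lambda>y. c * inverse y ^ k) has_real_derivative - c * of_nat k * inverse x ^ Suc k) (at x)"
      using that DERIV_cmult[OF DERIV_power[OF DERIV_inverse, of x k UNIV], of c] Suc
      by (simp add: mult_ac power_inverse)
    then have "((\<lambda>y. c * inverse y ^ k) has_derivative (\<lambda>h. h * (- c * of_nat k * inverse x ^ Suc k))) (at x)"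
      unfolding has_field_derivative_def by (rule has_derivative_eq_rhs) (auto simp: mult.commute)
    from has_derivative_along_line[OF this, of v] show ?thesis
      by (simp add: g mult_ac)
  qed
  then show "\<exists>g'. (\<exists>c k. g' = (\<lambda>x. c * inverse x ^ k)) \<and>
      (\<forall>x\<in>- {0}. ((\<lambda>t. g (x + t *\<^sub>R v)) has_vector_derivative g' x) (at 0))"
    by blast
qed auto

lemma cinf_on_divide:
  fixes f g :: "'a::real_normed_vector \<Rightarrow> real"
  assumes "cinf_on U f" "cinf_on U g" "\<And>x. x \<in> U \<Longrightarrow> g x \<noteq> 0"
  shows "cinf_on U (\<lambda>x. f x / g x)"
  unfolding divide_inverse
  by (intro cinf_on_mult assms(1) cinf_on_compose[OF cinf_on_real_inverse assms(2)]) (use assms(3) in auto)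

lemma cinf_on_dd_field:
  fixes f :: "'a::euclidean_space \<Rightarrow> 'b::real_normed_vector"
  assumes A: "cinf_on U A" and f: "cinf_on U f"
  shows "cinf_on U (\<lambda>x. dd [A x] f x)"
proof -
  have "cinf_on U (\<lambda>x. \<Sum>b\<in>Basis. (A x \<bullet> b) *\<^sub>R dd [b] f x)"
    by (intro cinf_on_sum cinf_on_open[OF f] cinf_on_scaleR cinf_on_dd[OF f]
        cinf_on_bounded_linear_apply[OF A bounded_linear_inner_left])
  then show ?thesis
    by (rule cinf_on_cong) (metis dd_basis_expand[OF f])
qed

lemma dd_add:
  fixes f g :: "'a::real_normed_vector \<Rightarrow> 'b::real_normed_vector"
  assumes f: "cinf_on U f" and g: "cinf_on U g"
  shows "x \<in> U \<Longrightarrow> dd vs (\<lambda>x. f x + g x) x = dd vs f x + dd vs g x"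
proof (induction vs arbitrary: x)
  case Nil
  then show ?case by simp
next
  case (Cons v vs)
  have "dd (v # vs) (\<lambda>x. f x + g x) x = dd [v] (dd vs (\<lambda>x. f x + g x)) x" by (simp add: dd_Cons[of v vs])
  also have "\<dots> = dd [v] (\<lambda>x. dd vs f x + dd vs g x) x"
    by (rule dd_cong[OF cinf_on_open[OF f]]) (use Cons in auto)
  also have "\<dots> = dd (v # vs) f x + dd (v # vs) g x"
    by (rule has_vector_derivative_imp_dd,
        rule has_vector_derivative_add[OF cinf_on_deriv[OF f Cons.prems] cinf_on_deriv[OF g Cons.prems]])
  finally show ?case .
qed

section \<open>Symmetry of second derivatives\<close>

lemma mean_value_two_directions:
  fixes f :: "'a::real_normed_vector \<Rightarrow> real"
  assumes f: "cinf_on U f" and "h > 0"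
    and sub: "\<And>s t. 0 \<le> s \<Longrightarrow> s \<le> h \<Longrightarrow> 0 \<le> t \<Longrightarrow> t \<le> h \<Longrightarrow> x + s *\<^sub>R u + t *\<^sub>R v \<in> U"
  shows "\<exists>s t. 0 < s \<and> s < h \<and> 0 < t \<and> t < h \<and>
    f (x + h *\<^sub>R u + h *\<^sub>R v) - f (x + h *\<^sub>R u) - f (x + h *\<^sub>R v) + f x = h * h * dd [v, u] f (x + s *\<^sub>R u + t *\<^sub>R v)"
proof -
  have line: "((\<lambda>s. dd vs f (y + s *\<^sub>R w)) has_real_derivative dd (w # vs) f (y + s *\<^sub>R w)) (at s)"
    if "y + s *\<^sub>R w \<in> U" for y w s vs
  proof -
    have "((\<lambda>r. dd vs f ((y + s *\<^sub>R w) + r *\<^sub>R w)) has_vector_derivative dd (w # vs) f (y + s *\<^sub>R w)) (at (s - s))"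
      using cinf_on_deriv[OF f that, of vs w] by simp
    then have "(((\<lambda>r. dd vs f ((y + s *\<^sub>R w) + r *\<^sub>R w)) \<circ> (\<lambda>r. r - s)) has_vector_derivative
         1 *\<^sub>R dd (w # vs) f (y + s *\<^sub>R w)) (at s)"
      by (intro vector_diff_chain_at) (auto intro!: derivative_eq_intros)
    then show ?thesis
      by (simp add: o_def algebra_simps has_real_derivative_iff_has_vector_derivative)
  qed
  let ?p = "\<lambda>s. f (x + h *\<^sub>R v + s *\<^sub>R u) - f (x + s *\<^sub>R u)"
  have "\<exists>s>0. s < h \<and> ?p h - ?p 0 = (h - 0) * (dd [u] f (x + h *\<^sub>R v + s *\<^sub>R u) - dd [u] f (x + s *\<^sub>R u))"
  proof (rule MVT2[OF \<open>h > 0\<close>])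
    fix s assume s: "0 \<le> s" "s \<le> h"
    have "x + h *\<^sub>R v + s *\<^sub>R u \<in> U" "x + s *\<^sub>R u \<in> U"
      using sub[OF s, of h] sub[OF s, of 0] \<open>h > 0\<close> by (auto simp: algebra_simps)
    then show "(?p has_real_derivative dd [u] f (x + h *\<^sub>R v + s *\<^sub>R u) - dd [u] f (x + s *\<^sub>R u)) (at s)"
      using line[of _ s u "[]"] by (auto intro: DERIV_diff)
  qed
  then obtain s where s: "0 < s" "s < h" "?p h - ?p 0 = h * (dd [u] f (x + h *\<^sub>R v + s *\<^sub>R u) - dd [u] f (x + s *\<^sub>R u))"
    by auto
  let ?q = "\<lambda>t. dd [u] f (x + s *\<^sub>R u + t *\<^sub>R v)"
  have "\<exists>t>0. t < h \<and> ?q h - ?q 0 = (h - 0) * dd [v, u] f (x + s *\<^sub>R u + t *\<^sub>R v)"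
    by (rule MVT2[OF \<open>h > 0\<close>]) (use s in \<open>auto intro!: line sub\<close>)
  then obtain t where t: "0 < t" "t < h" "?q h - ?q 0 = h * dd [v, u] f (x + s *\<^sub>R u + t *\<^sub>R v)"
    by auto
  have "f (x + h *\<^sub>R u + h *\<^sub>R v) - f (x + h *\<^sub>R u) - f (x + h *\<^sub>R v) + f x = ?p h - ?p 0"
    by (simp add: algebra_simps)
  also have "\<dots> = h * (?q h - ?q 0)"
    using s(3) by (simp add: algebra_simps)
  also have "\<dots> = h * h * dd [v, u] f (x + s *\<^sub>R u + t *\<^sub>R v)"
    unfolding t(3) by simp
  finally show ?thesis using s t by blast
qed

text \<open>The second difference of \<open>f\<close> over a small parallelogram does not depend on
  the order of \<open>u\<close> and \<open>v\<close>, and the mean value theorem turns it into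
  either mixed derivative at a nearby point. If the two derivatives differed at \<open>x\<close>,
  continuity would keep them apart at these points.\<close>

lemma dd_swap_real:
  fixes f :: "'a::real_normed_vector \<Rightarrow> real"
  assumes f: "cinf_on U f" and x: "x \<in> U"
  shows "dd [u, v] f x = dd [v, u] f x"
proof (rule ccontr)
  assume ne: "dd [u, v] f x \<noteq> dd [v, u] f x"
  define e where "e = \<bar>dd [u, v] f x - dd [v, u] f x\<bar> / 2"
  have e: "e > 0" using ne by (simp add: e_def)
  have "isCont (dd vs f) x" for vs
    using cinf_on_continuous_dd[OF f, of vs] cinf_on_open[OF f] x
    by (simp add: continuous_on_eq_continuous_at)
  then obtain d1 d2 where d: "d1 > 0" "d2 > 0"
     "\<And>y. dist y x < d1 \<Longrightarrow> dist (dd [u, v] f y) (dd [u, v] f x) < e"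
     "\<And>y. dist y x < d2 \<Longrightarrow> dist (dd [v, u] f y) (dd [v, u] f x) < e"
    using e unfolding continuous_at_eps_delta by meson
  obtain d3 where d3: "d3 > 0" "ball x d3 \<subseteq> U"
    using cinf_on_open[OF f] x by (meson open_contains_ball)
  define d0 where "d0 = min d1 (min d2 d3)"
  have d0: "d0 > 0" using d d3 by (simp add: d0_def)
  define h where "h = d0 / (2 * (norm u + norm v + 1))"
  have pos: "norm u + norm v + 1 > 0" by (simp add: add_nonneg_pos)
  have h: "h > 0" using d0 pos by (simp add: h_def)
  have hh: "h * (norm u + norm v) < d0"
  proof -
    have "h * (norm u + norm v) \<le> h * (norm u + norm v + 1)" using h by simp
    also have "\<dots> = d0 / 2" using pos by (simp add: h_def field_simps)
    finally show ?thesis using d0 by simp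
  qed
  have near: "dist (x + s *\<^sub>R a + t *\<^sub>R b) x < d0"
    if "0 \<le> s" "s \<le> h" "0 \<le> t" "t \<le> h" "(a = u \<and> b = v) \<or> (a = v \<and> b = u)" for s t a b
  proof -
    have "dist (x + s *\<^sub>R a + t *\<^sub>R b) x \<le> norm (s *\<^sub>R a) + norm (t *\<^sub>R b)"
      by (metis add.assoc add_diff_cancel_left' dist_norm norm_triangle_ineq)
    also have "\<dots> \<le> h * norm a + h * norm b"
      using that by (intro add_mono) (auto intro: mult_right_mono)
    also have "\<dots> < d0" using hh that(5) by (auto simp: algebra_simps)
    finally show ?thesis .
  qed
  have sub: "x + s *\<^sub>R a + t *\<^sub>R b \<in> U"
    if "0 \<le> s" "s \<le> h" "0 \<le> t" "t \<le> h" "(a = u \<and> b = v) \<or> (a = v \<and> b = u)" for s t a b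
    using near[OF that] d3 by (auto simp: d0_def dist_commute)
  obtain s t where st: "0 < s" "s < h" "0 < t" "t < h"
    "f (x + h *\<^sub>R u + h *\<^sub>R v) - f (x + h *\<^sub>R u) - f (x + h *\<^sub>R v) + f x = h * h * dd [v, u] f (x + s *\<^sub>R u + t *\<^sub>R v)"
    using mean_value_two_directions[OF f h, of x u v] sub by blast
  obtain s' t' where st': "0 < s'" "s' < h" "0 < t'" "t' < h"
    "f (x + h *\<^sub>R v + h *\<^sub>R u) - f (x + h *\<^sub>R v) - f (x + h *\<^sub>R u) + f x = h * h * dd [u, v] f (x + s' *\<^sub>R v + t' *\<^sub>R u)"
    using mean_value_two_directions[OF f h, of x v u] sub by blast
  have "h * h * dd [v, u] f (x + s *\<^sub>R u + t *\<^sub>R v) = h * h * dd [u, v] f (x + s' *\<^sub>R v + t' *\<^sub>R u)"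
    using st(5) st'(5) by (simp add: algebra_simps)
  then have eq: "dd [v, u] f (x + s *\<^sub>R u + t *\<^sub>R v) = dd [u, v] f (x + s' *\<^sub>R v + t' *\<^sub>R u)"
    using h by simp
  have "dist (dd [v, u] f (x + s *\<^sub>R u + t *\<^sub>R v)) (dd [v, u] f x) < e"
    using d(4) near[of s t u v] st by (auto simp: d0_def)
  moreover have "dist (dd [u, v] f (x + s' *\<^sub>R v + t' *\<^sub>R u)) (dd [u, v] f x) < e"
    using d(3) near[of s' t' v u] st' by (auto simp: d0_def)
  ultimately show False
    using eq unfolding e_def dist_real_def by argo
qed

lemma dd_swap:
  fixes f :: "'a::real_normed_vector \<Rightarrow> 'b::euclidean_space"
  assumes f: "cinf_on U f" and x: "x \<in> U"
  shows "dd [u, v] f x = dd [v, u] f x"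
proof (rule euclidean_eqI)
  fix b :: 'b
  note l = bounded_linear_inner_left[of b]
  show "dd [u, v] f x \<bullet> b = dd [v, u] f x \<bullet> b"
    using dd_bounded_linear_apply[OF f l x, of "[u,v]"] dd_bounded_linear_apply[OF f l x, of "[v,u]"]
      dd_swap_real[OF cinf_on_bounded_linear_apply[OF f l] x, of u v]
    by simp
qed

section \<open>Multilinearity and symmetry of higher derivatives\<close>

lemma linear_dd_inner:
  fixes g :: "'a::euclidean_space \<Rightarrow> 'b::real_normed_vector"
  assumes g: "cinf_on U g" and x: "x \<in> U"
  shows "linear (\<lambda>v. dd us (dd [v] g) x)"
proof (rule linearI)
  note U = cinf_on_open[OF g]
  fix v w
  have "dd us (dd [v + w] g) x = dd us (\<lambda>y. dd [v] g y + dd [w] g y) x"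
    by (rule dd_cong[OF U _ x]) (rule linear_add[OF linear_dd[OF g]])
  also have "\<dots> = dd us (dd [v] g) x + dd us (dd [w] g) x"
    by (rule dd_add[OF cinf_on_dd[OF g] cinf_on_dd[OF g] x])
  finally show "dd us (dd [v + w] g) x = dd us (dd [v] g) x + dd us (dd [w] g) x" .
next
  note U = cinf_on_open[OF g]
  fix r :: real and v
  have "dd us (dd [r *\<^sub>R v] g) x = dd us (\<lambda>y. r *\<^sub>R dd [v] g y) x"
    by (rule dd_cong[OF U _ x]) (rule linear_scale[OF linear_dd[OF g]])
  also have "\<dots> = r *\<^sub>R dd us (dd [v] g) x"
    by (rule dd_bounded_linear_apply[OF cinf_on_dd[OF g] bounded_linear_scaleR_right x])
  finally show "dd us (dd [r *\<^sub>R v] g) x = r *\<^sub>R dd us (dd [v] g) x" .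
qed

lemma linear_dd2:
  fixes g :: "'a::euclidean_space \<Rightarrow> 'b::real_normed_vector"
  assumes g: "cinf_on U g" and x: "x \<in> U"
  shows "linear (\<lambda>u. dd [u, v] g x)" "linear (\<lambda>v. dd [u, v] g x)"
  using linear_dd[OF cinf_on_dd[OF g, of "[v]"] x] linear_dd_inner[OF g x, of "[u]"]
  by (simp_all add: dd_Cons[of _ "[_]"])

lemma linear_dd3:
  fixes g :: "'a::euclidean_space \<Rightarrow> 'b::real_normed_vector"
  assumes g: "cinf_on U g" and x: "x \<in> U"
  shows "linear (\<lambda>u. dd [u, v, w] g x)" "linear (\<lambda>v. dd [u, v, w] g x)" "linear (\<lambda>w. dd [u, v, w] g x)"
proof -
  have eq: "dd [u, v, w] g = dd [u] (dd [v, w] g)" "dd [u, v, w] g = dd [u] (dd [v] (dd [w] g))"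
     "dd [u, v, w] g = dd [u, v] (dd [w] g)" for u v w
    by (simp_all add: dd.simps(2))
  show "linear (\<lambda>u. dd [u, v, w] g x)"
    unfolding eq(1) by (rule linear_dd[OF cinf_on_dd[OF g] x])
  show "linear (\<lambda>v. dd [u, v, w] g x)"
    unfolding eq(2) by (rule linear_dd_inner[OF cinf_on_dd[OF g] x])
  show "linear (\<lambda>w. dd [u, v, w] g x)"
    unfolding eq(3) by (rule linear_dd_inner[OF g x])
qed

lemma dd3_swap:
  fixes f :: "'a::real_normed_vector \<Rightarrow> 'b::euclidean_space"
  assumes f: "cinf_on U f" and x: "x \<in> U"
  shows "dd [u, v, w] f x = dd [v, u, w] f x" "dd [u, v, w] f x = dd [u, w, v] f x"
proof -
  have eq: "dd [u, v, w] f = dd [u, v] (dd [w] f)" "dd [u, v, w] f = dd [u] (dd [v, w] f)" for u v w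
    by (simp_all add: dd.simps(2))
  show "dd [u, v, w] f x = dd [v, u, w] f x"
    unfolding eq(1) by (rule dd_swap[OF cinf_on_dd[OF f] x])
  show "dd [u, v, w] f x = dd [u, w, v] f x"
    unfolding eq(2) by (rule dd_cong[OF cinf_on_open[OF f] dd_swap[OF f] x])
qed

text \<open>Map \<open>P\<close> and moving direction \<open>A\<close> are kept separate to serve
  two purposes: \<open>P\<close> the identity gives the product rule for vector fields,
  \<open>A = dd [v] P\<close> the chain rule of second order. Expanding \<open>A y\<close> in the
  basis reduces a moving direction to fixed ones.\<close>

lemma dd_field_compose:
  fixes m :: "'b::euclidean_space \<Rightarrow> 'c::euclidean_space" and P A :: "'a::euclidean_space \<Rightarrow> 'b"
  assumes m: "cinf_on W m" and P: "cinf_on U P" and A: "cinf_on U A"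
    and sub: "\<And>x. x \<in> U \<Longrightarrow> P x \<in> W" and x: "x \<in> U"
  shows "dd [v] (\<lambda>y. m (P y)) x = dd [dd [v] P x] m (P x)"
    "dd [v] (\<lambda>y. dd [A y] m (P y)) x = dd [dd [v] P x, A x] m (P x) + dd [dd [v] A x] m (P x)"
proof -
  have chain: "dd [v] (\<lambda>y. h (P y)) x = dd [dd [v] P x] h (P x)" if h: "cinf_on W h" for h :: "'b \<Rightarrow> 'c"
    using has_derivative_imp_dd[OF has_derivative_compose[OF cinf_on_has_derivative[OF P x]
          cinf_on_has_derivative[OF h sub[OF x]]], of v] .
  show "dd [v] (\<lambda>y. m (P y)) x = dd [dd [v] P x] m (P x)" by (rule chain[OF m])
  have hd: "((\<lambda>y. h (P y)) has_derivative (\<lambda>v. dd [v] (\<lambda>y. h (P y)) x)) (at x)" if "cinf_on W h" for h :: "'b \<Rightarrow> 'c"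
    by (rule cinf_on_has_derivative[OF cinf_on_compose[OF that P sub] x])
  have "dd [v] (\<lambda>y. dd [A y] m (P y)) x = dd [v] (\<lambda>y. \<Sum>b\<in>Basis. (A y \<bullet> b) *\<^sub>R dd [b] m (P y)) x"
    by (rule dd_cong[OF cinf_on_open[OF P] _ x]) (rule dd_basis_expand[OF m sub])
  also have "\<dots> = (\<Sum>b\<in>Basis. (A x \<bullet> b) *\<^sub>R dd [v] (\<lambda>y. dd [b] m (P y)) x + (dd [v] A x \<bullet> b) *\<^sub>R dd [b] m (P x))"
    by (rule has_derivative_imp_dd)
      (auto intro!: derivative_eq_intros cinf_on_has_derivative[OF A x] hd cinf_on_dd[OF m])
  also have "\<dots> = (\<Sum>b\<in>Basis. (A x \<bullet> b) *\<^sub>R dd [dd [v] P x, b] m (P x)) + dd [dd [v] A x] m (P x)"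
    by (simp add: chain[OF cinf_on_dd[OF m]] sum.distrib dd_Cons[of _ "[_]"]
        flip: dd_basis_expand[OF m sub[OF x]])
  also have "(\<Sum>b\<in>Basis. (A x \<bullet> b) *\<^sub>R dd [dd [v] P x, b] m (P x)) = dd [dd [v] P x, A x] m (P x)"
  proof -
    interpret linear "\<lambda>w. dd [dd [v] P x, w] m (P x)" by (rule linear_dd2(2)[OF m sub[OF x]])
    have "dd [dd [v] P x, \<Sum>b\<in>Basis. (A x \<bullet> b) *\<^sub>R b] m (P x) = (\<Sum>b\<in>Basis. (A x \<bullet> b) *\<^sub>R dd [dd [v] P x, b] m (P x))"
      by (simp only: sum scale)
    then show ?thesis by (simp add: euclidean_representation)
  qed
  finally show "dd [v] (\<lambda>y. dd [A y] m (P y)) x = dd [dd [v] P x, A x] m (P x) + dd [dd [v] A x] m (P x)" .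
qed

lemma cinf_on_dd_compose:
  fixes m :: "'b::euclidean_space \<Rightarrow> 'c::euclidean_space" and P A :: "'a::euclidean_space \<Rightarrow> 'b"
  assumes m: "cinf_on W m" and P: "cinf_on U P" and A: "cinf_on U A"
    and sub: "\<And>x. x \<in> U \<Longrightarrow> P x \<in> W"
  shows "cinf_on U (\<lambda>y. dd [A y] m (P y))"
proof -
  have "cinf_on U (\<lambda>x. \<Sum>b\<in>Basis. (A x \<bullet> b) *\<^sub>R dd [b] m (P x))"
    by (intro cinf_on_sum cinf_on_open[OF P] cinf_on_scaleR cinf_on_compose[OF cinf_on_dd[OF m] P sub]
        cinf_on_bounded_linear_apply[OF A bounded_linear_inner_left])
  then show ?thesis
    by (rule cinf_on_cong) (metis dd_basis_expand[OF m sub])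
qed

lemma dd2_field_compose:
  fixes m :: "'b::euclidean_space \<Rightarrow> 'c::euclidean_space" and P A B :: "'a::euclidean_space \<Rightarrow> 'b"
  assumes m: "cinf_on W m" and P: "cinf_on U P" and A: "cinf_on U A" and B: "cinf_on U B"
    and sub: "\<And>x. x \<in> U \<Longrightarrow> P x \<in> W" and x: "x \<in> U"
  shows "dd [v] (\<lambda>y. dd [A y, B y] m (P y)) x =
     dd [dd [v] P x, A x, B x] m (P x) + dd [dd [v] A x, B x] m (P x) + dd [A x, dd [v] B x] m (P x)"
proof -
  have expand: "L w = (\<Sum>b\<in>Basis. (w \<bullet> b) *\<^sub>R L b)" if "linear L" for L :: "'b \<Rightarrow> 'c" and w
  proof -
    interpret linear L by fact
    show ?thesis by (subst euclidean_representation[of w, symmetric]) (simp only: sum scale)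
  qed
  have eq: "dd [a, b] m = dd [a] (dd [b] m)" "dd [a, b, c] m = dd [a, b] (dd [c] m)" for a b c
    by (simp_all add: dd.simps(2))
  have hd: "((\<lambda>y. dd [A y] (dd [b] m) (P y)) has_derivative (\<lambda>v. dd [v] (\<lambda>y. dd [A y] (dd [b] m) (P y)) x)) (at x)" for b
    by (rule cinf_on_has_derivative[OF cinf_on_dd_compose[OF cinf_on_dd[OF m] P A sub] x])
  have "dd [v] (\<lambda>y. dd [A y, B y] m (P y)) x = dd [v] (\<lambda>y. \<Sum>b\<in>Basis. (B y \<bullet> b) *\<^sub>R dd [A y] (dd [b] m) (P y)) x"
    by (rule dd_cong[OF cinf_on_open[OF P] _ x])
      (use expand[OF linear_dd2(2)[OF m sub]] in \<open>simp add: eq\<close>)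
  also have "\<dots> = (\<Sum>b\<in>Basis. (B x \<bullet> b) *\<^sub>R dd [v] (\<lambda>y. dd [A y] (dd [b] m) (P y)) x
       + (dd [v] B x \<bullet> b) *\<^sub>R dd [A x] (dd [b] m) (P x))"
    by (rule has_derivative_imp_dd)
      (auto intro!: derivative_eq_intros cinf_on_has_derivative[OF B x] hd)
  also have "\<dots> = (\<Sum>b\<in>Basis. (B x \<bullet> b) *\<^sub>R dd [dd [v] P x, A x, b] m (P x))
       + (\<Sum>b\<in>Basis. (B x \<bullet> b) *\<^sub>R dd [dd [v] A x, b] m (P x))
       + (\<Sum>b\<in>Basis. (dd [v] B x \<bullet> b) *\<^sub>R dd [A x, b] m (P x))"
    by (simp add: dd_field_compose(2)[OF cinf_on_dd[OF m] P A sub x] sum.distrib eq scaleR_add_right)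
  also have "\<dots> = dd [dd [v] P x, A x, B x] m (P x) + dd [dd [v] A x, B x] m (P x) + dd [A x, dd [v] B x] m (P x)"
    using expand[OF linear_dd3(3)[OF m sub[OF x]], of "dd [v] P x" "A x" "B x"]
      expand[OF linear_dd2(2)[OF m sub[OF x]], of "dd [v] A x" "B x"]
      expand[OF linear_dd2(2)[OF m sub[OF x]], of "A x" "dd [v] B x"]
    by simp
  finally show ?thesis .
qed

lemma dd_ident: "dd [v] (\<lambda>x. x) x = v"
  by (rule has_derivative_imp_dd) (rule has_derivative_ident)

section \<open>Taylor expansion to third order\<close>

lemma dd_replicate_bound:
  fixes f :: "'a::euclidean_space \<Rightarrow> real"
  assumes "cinf_on U f" "compact K" "K \<subseteq> U"
  shows "\<exists>C\<ge>0. \<forall>y\<in>K. \<forall>v. \<bar>dd (replicate k v) f y\<bar> \<le> C * norm v ^ k"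
  using assms(1)
proof (induction k arbitrary: f)
  case 0
  have "bounded (f ` K)"
    by (intro compact_imp_bounded compact_continuous_image continuous_on_subset[OF cinf_on_continuous[OF 0]] assms)
  then obtain C where "C > 0" "\<forall>y\<in>K. norm (f y) \<le> C" by (auto simp: bounded_pos)
  then show ?case by (intro exI[of _ C]) auto
next
  case (Suc k)
  have "\<forall>b. \<exists>C\<ge>0. \<forall>y\<in>K. \<forall>v. \<bar>dd (replicate k v) (dd [b] f) y\<bar> \<le> C * norm v ^ k"
    using Suc.IH[OF cinf_on_dd[OF Suc.prems]] by blast
  then obtain C where C: "\<And>b. C b \<ge> 0" "\<And>b y v. y \<in> K \<Longrightarrow> \<bar>dd (replicate k v) (dd [b] f) y\<bar> \<le> C b * norm v ^ k"
    by metis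
  show ?case
  proof (intro exI[of _ "\<Sum>b\<in>Basis. C b"] conjI ballI allI)
    show "(\<Sum>b\<in>Basis. C b) \<ge> 0" using C(1) by (rule sum_nonneg)
    fix y v assume y: "y \<in> K"
    interpret linear "\<lambda>w. dd (replicate k v) (dd [w] f) y"
      by (rule linear_dd_inner[OF Suc.prems]) (use y assms in auto)
    \<comment> \<open>One copy of \<open>v\<close> goes to the innermost place, where it can be
      expanded in the basis; the induction hypothesis then applies to the functions
      \<open>dd [b] f\<close>.\<close>
    have "dd (replicate (Suc k) v) f y = dd (replicate k v) (dd [v] f) y"
      by (simp add: dd_append flip: replicate_append_same)
    also have "\<dots> = dd (replicate k v) (dd [\<Sum>b\<in>Basis. (v \<bullet> b) *\<^sub>R b] f) y"
      by (simp add: euclidean_representation)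
    also have "\<dots> = (\<Sum>b\<in>Basis. (v \<bullet> b) *\<^sub>R dd (replicate k v) (dd [b] f) y)"
      by (simp only: sum scale)
    also have "\<bar>\<dots>\<bar> \<le> (\<Sum>b\<in>Basis. \<bar>(v \<bullet> b) *\<^sub>R dd (replicate k v) (dd [b] f) y\<bar>)"
      by (rule sum_abs)
    also have "\<dots> \<le> (\<Sum>b\<in>Basis. norm v * (C b * norm v ^ k))"
      unfolding real_scaleR_def abs_mult
      by (intro sum_mono mult_mono C y Basis_le_norm) auto
    also have "\<dots> = (\<Sum>b\<in>Basis. C b) * norm v ^ Suc k"
      by (simp add: sum_distrib_left sum_distrib_right mult_ac)
    finally show "\<bar>dd (replicate (Suc k) v) f y\<bar> \<le> (\<Sum>b\<in>Basis. C b) * norm v ^ Suc k" .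
  qed
qed

text \<open>This is the formula in one variable on the segment from \<open>p\<close> to
  \<open>p + v\<close>. The constant is uniform in the direction because the fourth derivative is
  bounded by a multiple of \<open>norm v ^ 4\<close> on a closed ball.\<close>

lemma Taylor_order3:
  fixes f :: "'a::euclidean_space \<Rightarrow> real"
  assumes f: "cinf_on U f" and p: "p \<in> U"
  shows "\<exists>C d. d > 0 \<and> (\<forall>v. norm v < d \<longrightarrow>
    \<bar>f (p + v) - (f p + dd [v] f p + dd [v, v] f p / 2 + dd [v, v, v] f p / 6)\<bar> \<le> C * norm v ^ 4)"
proof -
  obtain d where d: "d > 0" "cball p d \<subseteq> U"
    using cinf_on_open[OF f] p by (meson open_contains_cball)
  obtain C where C: "\<forall>y\<in>cball p d. \<forall>v. \<bar>dd (replicate 4 v) f y\<bar> \<le> C * norm v ^ 4"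
    using dd_replicate_bound[OF f compact_cball d(2)] by blast
  have "\<bar>f (p + v) - (f p + dd [v] f p + dd [v, v] f p / 2 + dd [v, v, v] f p / 6)\<bar> \<le> C / 24 * norm v ^ 4"
    if v: "norm v < d" for v
  proof -
    have mem: "p + t *\<^sub>R v \<in> cball p d" if "0 \<le> t" "t \<le> 1" for t :: real
      using that v mult_left_le_one_le[of "norm v" t] by (auto simp: dist_norm)
    have "\<exists>t>0. t < 1 \<and> f (p + 1 *\<^sub>R v) =
        (\<Sum>m<4. dd (replicate m v) f (p + 0 *\<^sub>R v) / fact m * 1 ^ m) + dd (replicate 4 v) f (p + t *\<^sub>R v) / fact 4 * 1 ^ 4"
    proof (rule Maclaurin)
      show "\<forall>m t. m < 4 \<and> 0 \<le> t \<and> t \<le> 1 \<longrightarrow>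
         ((\<lambda>t. dd (replicate m v) f (p + t *\<^sub>R v)) has_real_derivative dd (replicate (Suc m) v) f (p + t *\<^sub>R v)) (at t)"
      proof (intro allI impI)
        fix m :: nat and t :: real assume t: "m < 4 \<and> 0 \<le> t \<and> t \<le> 1"
        have U: "p + t *\<^sub>R v \<in> U" using mem t d by auto
        have "((\<lambda>r. dd (replicate m v) f ((p + t *\<^sub>R v) + r *\<^sub>R v)) has_vector_derivative dd (v # replicate m v) f (p + t *\<^sub>R v)) (at (t - t))"
          using cinf_on_deriv[OF f U] by simp
        then have "(((\<lambda>r. dd (replicate m v) f ((p + t *\<^sub>R v) + r *\<^sub>R v)) \<circ> (\<lambda>r. r - t)) has_vector_derivative
             1 *\<^sub>R dd (v # replicate m v) f (p + t *\<^sub>R v)) (at t)"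
          by (intro vector_diff_chain_at) (auto intro!: derivative_eq_intros)
        then show "((\<lambda>t. dd (replicate m v) f (p + t *\<^sub>R v)) has_real_derivative dd (replicate (Suc m) v) f (p + t *\<^sub>R v)) (at t)"
          by (simp add: o_def algebra_simps has_real_derivative_iff_has_vector_derivative)
      qed
    qed auto
    then obtain t where t: "0 < t" "t < 1" "f (p + v) =
        (\<Sum>m<4. dd (replicate m v) f p / fact m) + dd (replicate 4 v) f (p + t *\<^sub>R v) / fact 4"
      by auto
    have sum: "(\<Sum>m<4. dd (replicate m v) f p / fact m) = f p + dd [v] f p + dd [v, v] f p / 2 + dd [v, v, v] f p / 6"
      by (simp add: eval_nat_numeral)
    have "\<bar>dd (replicate 4 v) f (p + t *\<^sub>R v)\<bar> \<le> C * norm v ^ 4"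
      using C mem[of t] t by auto
    then show ?thesis
      unfolding t(3) sum by (simp add: fact_numeral)
  qed
  then show ?thesis using d(1) by blast
qed

subsection \<open>Holomorphic maps are smooth\<close>

text \<open>The ambient type carries only a real vector space structure, so complex scalars act
  through this explicit map; \<open>Jc\<close> is the case of the scalar
  \<open>\<i>\<close>.\<close>

definition cs :: "complex \<Rightarrow> 'n::finite amb \<Rightarrow> 'n amb" where
  "cs c v = ((\<chi> j. c * fst v $ j), c * snd v)"

lemma fst_cs_nth [simp]: "fst (cs c v) $ j = c * fst v $ j"
  and snd_cs [simp]: "snd (cs c v) = c * snd v"
  by (simp_all add: cs_def)

lemma fst_Jc_nth [simp]: "fst (Jc v) $ j = \<i> * fst v $ j"
  and snd_Jc [simp]: "snd (Jc v) = \<i> * snd v"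
  by (simp_all add: Jc_def)

lemma amb_eq_iff: "x = y \<longleftrightarrow> (\<forall>j. fst x $ j = fst y $ j) \<and> snd x = snd (y :: 'n::finite amb)"
  by (auto simp: prod_eq_iff vec_eq_iff)

lemma Jc_eq_cs: "Jc v = cs \<i> v"
  by (simp add: amb_eq_iff)

lemma cs_eq_Jc: "cs c v = Re c *\<^sub>R v + Im c *\<^sub>R Jc v"
  by (simp add: amb_eq_iff complex_eq_iff)

lemma cs_simps:
  "cs (a + b) v = cs a v + cs b v" "cs (a - b) v = cs a v - cs b v" "cs (- a) v = - cs a v"
  "cs a (v + w) = cs a v + cs a w" "cs a (v - w) = cs a v - cs a w" "cs a (- v) = - cs a v"
  "cs a (r *\<^sub>R v) = r *\<^sub>R cs a v" "cs 0 v = 0" "cs a 0 = 0" "cs 1 v = v" "cs (of_real r) v = r *\<^sub>R v"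
  "cs a (cs b v) = cs (a * b) v"
  by (simp_all add: amb_eq_iff complex_eq_iff algebra_simps)

lemma linear_cs: "linear (cs a)"
  by (rule linearI) (simp_all add: cs_simps)

lemma linear_cs_left: "linear (\<lambda>a. cs a v)"
  by (rule linearI) (simp_all add: amb_eq_iff complex_eq_iff algebra_simps)

lemma bounded_linear_cs: "bounded_linear (cs a)"
  using linear_cs linear_conv_bounded_linear by blast

lemma bounded_linear_cs_left: "bounded_linear (\<lambda>a. cs a v)"
  using linear_cs_left linear_conv_bounded_linear by blast

lemma bounded_linear_Jc: "bounded_linear Jc"
  using bounded_linear_cs[of \<i>] by (simp add: Jc_eq_cs[abs_def])

lemma Jc_simps:
  "Jc (v + w) = Jc v + Jc w" "Jc (v - w) = Jc v - Jc w" "Jc (- v) = - Jc v"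
  "Jc (r *\<^sub>R v) = r *\<^sub>R Jc v" "Jc 0 = 0" "Jc (Jc v) = - v" "Jc (cs a v) = cs a (Jc v)"
  by (simp_all add: amb_eq_iff algebra_simps)

lemma inner_amb: "x \<bullet> y = Re ((\<Sum>j\<in>UNIV. cnj (fst x $ j) * fst y $ j) + cnj (snd x) * snd y)"
  for x y :: "'n::finite amb"
  by (simp add: inner_prod_def inner_vec_def inner_complex_def)

lemma inner_Jc_Jc: "Jc x \<bullet> Jc y = x \<bullet> y"
  by (simp add: inner_amb)

lemma inner_Jc_left: "Jc x \<bullet> y = - (x \<bullet> Jc y)"
  using inner_Jc_Jc[of x "Jc y"] by (simp add: Jc_simps)

lemma inner_Jc_self: "x \<bullet> Jc x = 0" "Jc x \<bullet> x = 0"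
  using inner_Jc_left[of x x] by (simp_all add: inner_commute)

lemma inner_cs_cs: "cs c x \<bullet> cs c y = (cmod c)\<^sup>2 * (x \<bullet> y)"
  by (simp add: cs_eq_Jc inner_add_left inner_add_right inner_Jc_Jc inner_Jc_left cmod_def
      Jc_simps power2_eq_square algebra_simps)

lemma norm_cs: "norm (cs c v) = cmod c * norm v"
  unfolding norm_eq_sqrt_inner inner_cs_cs by (simp add: real_sqrt_mult)

lemma linear_Jc_commute_cs:
  assumes "linear D" "\<And>v. D (Jc v) = Jc (D v)"
  shows "D (cs c v) = cs c (D v)"
  using assms by (simp add: cs_eq_Jc linear_add linear_scale)

lemma cinf_on_Jc: "cinf_on U A \<Longrightarrow> cinf_on U (\<lambda>x. Jc (A x))"
  by (rule cinf_on_bounded_linear_apply[OF _ bounded_linear_Jc])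

text \<open>The class \<open>line_holo\<close> is closed under directional derivatives, because Cauchy's formula expresses
  a directional derivative as an integral of the function itself.\<close>

definition line_holo :: "'n::finite amb set \<Rightarrow> ('n amb \<Rightarrow> complex) \<Rightarrow> bool" where
  "line_holo U f \<longleftrightarrow> open U \<and> continuous_on U f \<and>
     (\<forall>x\<in>U. \<forall>v. (\<lambda>c. f (x + cs c v)) field_differentiable at 0)"

definition line_deriv :: "'n::finite amb \<Rightarrow> ('n amb \<Rightarrow> complex) \<Rightarrow> 'n amb \<Rightarrow> complex" where
  "line_deriv v f x = deriv (\<lambda>c. f (x + cs c v)) 0"

lemma line_holo_has_field_derivative:
  assumes f: "line_holo U f" and x: "x + cs c v \<in> U"
  shows "((\<lambda>c. f (x + cs c v)) has_field_derivative line_deriv v f (x + cs c v)) (at c)"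
proof -
  have "((\<lambda>b. f ((x + cs c v) + cs b v)) has_field_derivative line_deriv v f (x + cs c v)) (at 0)"
    using f x unfolding line_holo_def line_deriv_def by (blast intro: field_differentiable_derivI)
  then have "((\<lambda>b. f ((x + cs c v) + cs b v)) has_field_derivative line_deriv v f (x + cs c v)) (at (c + - c))"
    by simp
  then have "((\<lambda>b. f ((x + cs c v) + cs (b + - c) v)) has_field_derivative line_deriv v f (x + cs c v)) (at c)"
    unfolding DERIV_shift .
  then show ?thesis by (simp add: cs_simps algebra_simps)
qed

text \<open>On the circle \<open>u = r * exp (2 * pi * \<i> * s)\<close> one has
  \<open>du = 2 * pi * \<i> * u ds\<close>, so the integrand of Cauchy's formula becomes
  \<open>f / u ds\<close>, which explains the kernel. The parameter interval is fixed, so the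
  formula can be differentiated in the base point.\<close>

lemma line_deriv_Cauchy:
  assumes f: "line_holo U f" and r: "r > 0" and sub: "\<And>c. cmod c \<le> r \<Longrightarrow> x + cs c v \<in> U"
  shows "line_deriv v f x = integral (cbox 0 1)
     (\<lambda>s. f (x + cs (of_real r * exp (2 * of_real pi * \<i> * of_real s)) v) *
          (exp (- (2 * of_real pi * \<i> * of_real s)) / of_real r))"
proof -
  let ?g = "\<lambda>c. f (x + cs c v)"
  have hol: "?g holomorphic_on cball 0 r"
    unfolding holomorphic_on_def field_differentiable_def
    using has_field_derivative_at_within[OF line_holo_has_field_derivative[OF f sub]] by fastforce
  have "(?g has_field_derivative (1 / (2 * of_real pi * \<i>) * contour_integral(circlepath 0 r) (\<lambda>u. ?g u / (u-0)^2))) (at 0)"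
    by (rule Cauchy_derivative_integral_circlepath(2)) (use hol r in \<open>auto intro: holomorphic_on_imp_continuous_on holomorphic_on_subset\<close>)
  moreover have "(?g has_field_derivative line_deriv v f x) (at 0)"
    using line_holo_has_field_derivative[OF f, of x 0 v] sub[of 0] r by (simp add: cs_simps)
  ultimately have "line_deriv v f x = 1 / (2 * of_real pi * \<i>) * contour_integral(circlepath 0 r) (\<lambda>u. ?g u / u^2)"
    by (auto dest: DERIV_unique)
  also have "contour_integral(circlepath 0 r) (\<lambda>u. ?g u / u^2) =
      integral {0..1} (\<lambda>s. ?g (circlepath 0 r s) / (circlepath 0 r s)^2 * vector_derivative (circlepath 0 r) (at s))"
    by (simp add: contour_integral_integral)
  also have "1 / (2 * of_real pi * \<i>) * \<dots> = integral {0..1} (\<lambda>s. 1 / (2 * of_real pi * \<i>) *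
       (?g (circlepath 0 r s) / (circlepath 0 r s)^2 * vector_derivative (circlepath 0 r) (at s)))"
    by (rule integral_mult_right[symmetric])
  also have "\<dots> = integral {0..1} (\<lambda>s. ?g (of_real r * exp (2 * of_real pi * \<i> * of_real s)) *
          (exp (- (2 * of_real pi * \<i> * of_real s)) / of_real r))"
    unfolding vector_derivative_circlepath using r
    by (intro integral_cong) (auto simp: circlepath power2_eq_square divide_simps exp_minus)
  finally show ?thesis by simp
qed

text \<open>One radius has to serve all base points near \<open>x0\<close>, because the integral
  formula is used as a function of the base point.\<close>

lemma line_holo_neighbourhood:
  assumes "open U" "x0 \<in> (U :: 'n::finite amb set)"
  obtains d r where "d > 0" "r > 0" "\<And>x c. x \<in> ball x0 d \<Longrightarrow> cmod c \<le> r \<Longrightarrow> x + cs c v \<in> U"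
proof -
  obtain e where e: "e > 0" "ball x0 e \<subseteq> U" using assms by (meson open_contains_ball)
  define r where "r = e / (2 * (norm v + 1))"
  have nv: "norm v + 1 > 0" by (simp add: add_nonneg_pos)
  show ?thesis
  proof
    show "e / 2 > 0" using e by simp
    show "r > 0" using e nv by (simp add: r_def)
    fix x c assume x: "x \<in> ball x0 (e / 2)" and c: "cmod c \<le> r"
    have "norm (cs c v) \<le> r * (norm v + 1)"
      unfolding norm_cs using c nv e by (intro mult_mono) (auto simp: r_def)
    also have "\<dots> = e / 2" using nv by (simp add: r_def field_simps)
    finally have "dist x0 (x + cs c v) < e"
      using x norm_triangle_ineq[of "x - x0" "cs c v"] by (simp add: dist_norm norm_minus_commute algebra_simps)
    then show "x + cs c v \<in> U" using e by auto
  qed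
qed

text \<open>The map \<open>g\<close> covers two situations: the identity, for continuity in the base
  point, and the complex line through \<open>x0\<close> in a second direction, for differentiation
  under the integral.\<close>

lemma continuous_on_circle_integrand:
  fixes f :: "'n::finite amb \<Rightarrow> complex"
  assumes f: "continuous_on U f" and g: "continuous_on V g" and r: "r > 0"
    and sub: "\<And>x c. x \<in> V \<Longrightarrow> cmod c \<le> r \<Longrightarrow> g x + cs c v \<in> U"
  shows "continuous_on (V \<times> cbox 0 (1::real)) (\<lambda>(x, s). f (g x + cs (of_real r * exp (2 * of_real pi * \<i> * of_real s)) v) *
          (exp (- (2 * of_real pi * \<i> * of_real s)) / of_real r))"
proof -
  have "continuous_on (V \<times> cbox 0 1) (\<lambda>y. f (g (fst y) + cs (of_real r * exp (2 * of_real pi * \<i> * of_real (snd y))) v))"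
    by (rule continuous_on_compose2[OF f])
      (use r in \<open>auto intro!: continuous_intros sub continuous_on_compose2[OF g]
         bounded_linear.continuous_on[OF bounded_linear_cs_left] simp: norm_mult\<close>)
  then show ?thesis
    using r by (auto simp: split_beta intro!: continuous_intros)
qed

lemma continuous_on_line_deriv:
  assumes f: "line_holo U f"
  shows "continuous_on U (line_deriv v f)"
proof -
  have U: "open U" and cont: "continuous_on U f" using f by (auto simp: line_holo_def)
  have "isCont (line_deriv v f) x0" if x0: "x0 \<in> U" for x0
  proof -
    obtain d r where dr: "d > 0" "r > 0" "\<And>x c. x \<in> ball x0 d \<Longrightarrow> cmod c \<le> r \<Longrightarrow> x + cs c v \<in> U"
      using line_holo_neighbourhood[OF U x0] by metis
    have "continuous_on (ball x0 d) (\<lambda>x. integral (cbox 0 (1::real))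
     (\<lambda>s. f (x + cs (of_real r * exp (2 * of_real pi * \<i> * of_real s)) v) *
          (exp (- (2 * of_real pi * \<i> * of_real s)) / of_real r)))"
      by (rule integral_continuous_on_param[OF continuous_on_circle_integrand[OF cont continuous_on_id dr(2,3)]])
    then have "continuous_on (ball x0 d) (line_deriv v f)"
      by (rule continuous_on_eq) (rule line_deriv_Cauchy[OF f dr(2) dr(3), symmetric])
    then show ?thesis using dr(1) by (simp add: continuous_on_eq_continuous_at)
  qed
  then show ?thesis by (simp add: continuous_at_imp_continuous_on)
qed

lemma line_holo_line_deriv:
  assumes f: "line_holo U f"
  shows "line_holo U (line_deriv v f)"
  unfolding line_holo_def
proof (intro conjI ballI allI)
  show U: "open U" using f by (simp add: line_holo_def)
  show "continuous_on U (line_deriv v f)" by (rule continuous_on_line_deriv[OF f])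
  have cont: "continuous_on U f" using f by (simp add: line_holo_def)
  fix x0 w assume x0: "x0 \<in> U"
  obtain d r where dr: "d > 0" "r > 0" "\<And>x c. x \<in> ball x0 d \<Longrightarrow> cmod c \<le> r \<Longrightarrow> x + cs c v \<in> U"
    using line_holo_neighbourhood[OF U x0] by metis
  obtain d' r' where dr': "d' > 0" "r' > 0" "\<And>x c. x \<in> ball x0 d' \<Longrightarrow> cmod c \<le> r' \<Longrightarrow> x + cs c w \<in> ball x0 d"
    using line_holo_neighbourhood[OF open_ball, of x0 x0 d] dr by (metis centre_in_ball)
  have mem: "x0 + cs b w \<in> ball x0 d" if "b \<in> ball 0 r'" for b
    using dr'(3)[of x0 b] dr'(1) that by (auto simp: less_imp_le)
  let ?e = "\<lambda>s::real. of_real r * exp (2 * of_real pi * \<i> * of_real s) :: complex"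
  let ?k = "\<lambda>s::real. exp (- (2 * of_real pi * \<i> * of_real s)) / of_real r :: complex"
  have g: "continuous_on (ball 0 r') (\<lambda>b. x0 + cs b w)"
    by (intro continuous_intros bounded_linear.continuous_on[OF bounded_linear_cs_left])
  \<comment> \<open>Leibniz's rule moves the derivative in the direction \<open>w\<close> onto
    \<open>f\<close> itself, where it exists by assumption.\<close>
  have der: "((\<lambda>b. integral (cbox 0 1) (\<lambda>s. f (x0 + cs b w + cs (?e s) v) * ?k s)) has_field_derivative
       integral (cbox 0 1) (\<lambda>s. line_deriv w f (x0 + cs 0 w + cs (?e s) v) * ?k s)) (at 0 within ball 0 r')"
  proof (rule leibniz_rule_field_derivative)
    fix b :: complex and s :: real assume b: "b \<in> ball 0 r'" and s: "s \<in> cbox 0 1"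
    have "(x0 + cs (?e s) v) + cs b w \<in> U"
      using dr(3)[OF mem[OF b], of "?e s"] dr(2) by (simp add: norm_mult algebra_simps)
    from line_holo_has_field_derivative[OF f this]
    have "((\<lambda>b. f (x0 + cs b w + cs (?e s) v)) has_field_derivative line_deriv w f (x0 + cs b w + cs (?e s) v)) (at b)"
      by (simp add: algebra_simps)
    then show "((\<lambda>b. f (x0 + cs b w + cs (?e s) v) * ?k s) has_field_derivative
         line_deriv w f (x0 + cs b w + cs (?e s) v) * ?k s) (at b within ball 0 r')"
      by (rule has_field_derivative_at_within[OF DERIV_cmult_right])
  next
    fix b :: complex assume b: "b \<in> ball 0 r'"
    have "continuous_on (ball 0 r' \<times> cbox 0 1) (\<lambda>(b, s). f (x0 + cs b w + cs (?e s) v) * ?k s)"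
      by (rule continuous_on_circle_integrand[OF cont g dr(2)]) (use dr(3) mem in auto)
    then have "continuous_on (cbox 0 1) (\<lambda>s. (\<lambda>(b, s). f (x0 + cs b w + cs (?e s) v) * ?k s) (b, s))"
      by (rule continuous_on_compose2) (use b in \<open>auto intro!: continuous_intros\<close>)
    then have "continuous_on (cbox 0 1) (\<lambda>s. f (x0 + cs b w + cs (?e s) v) * ?k s)"
      by (simp only: prod.case)
    then show "(\<lambda>s. f (x0 + cs b w + cs (?e s) v) * ?k s) integrable_on cbox 0 1"
      by (rule integrable_continuous)
  next
    show "continuous_on (ball 0 r' \<times> cbox 0 1) (\<lambda>(b, s). line_deriv w f (x0 + cs b w + cs (?e s) v) * ?k s)"
      by (rule continuous_on_circle_integrand[OF continuous_on_line_deriv[OF f] g dr(2)]) (use dr(3) mem in auto)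
  qed (use dr' in auto)
  have eq: "integral (cbox 0 1) (\<lambda>s. f (x0 + cs b w + cs (?e s) v) * ?k s) = line_deriv v f (x0 + cs b w)"
    if "b \<in> ball 0 r'" for b
    by (rule line_deriv_Cauchy[OF f dr(2) dr(3)[OF mem[OF that]], symmetric])
  have "((\<lambda>b. line_deriv v f (x0 + cs b w)) has_field_derivative
       integral (cbox 0 1) (\<lambda>s. line_deriv w f (x0 + cs 0 w + cs (?e s) v) * ?k s)) (at 0 within ball 0 r')"
    by (rule has_field_derivative_transform_within[OF der dr'(2) _ eq]) (use dr' in auto)
  then show "(\<lambda>c. line_deriv v f (x0 + cs c w)) field_differentiable at 0"
    using dr'(2) at_within_open[of "0::complex" "ball 0 r'"] by (auto simp: field_differentiable_def)
qed

lemma cinf_on_line_holo: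
  assumes "line_holo U f"
  shows "cinf_on U f"
proof (rule cinf_on_coinduct[where P="line_holo U"])
  fix g v assume g: "line_holo U g"
  have "((\<lambda>t. g (x + t *\<^sub>R v)) has_vector_derivative line_deriv v g x) (at 0)" if "x \<in> U" for x
  proof -
    have "((\<lambda>c. g (x + cs c v)) has_field_derivative line_deriv v g x) (at (of_real 0))"
      using line_holo_has_field_derivative[OF g, of x 0 v] that by (simp add: cs_simps)
    from has_vector_derivative_real_field[OF this] show ?thesis by (simp add: cs_simps)
  qed
  then show "\<exists>g'. line_holo U g' \<and> (\<forall>x\<in>U. ((\<lambda>t. g (x + t *\<^sub>R v)) has_vector_derivative g' x) (at 0))"
    using line_holo_line_deriv[OF g] by blast
qed (use assms in \<open>auto simp: line_holo_def\<close>)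

lemma cinf_on_vec_lambda:
  fixes f :: "'i::finite \<Rightarrow> 'a::real_normed_vector \<Rightarrow> 'b::euclidean_space"
  assumes "open U" "\<And>j. cinf_on U (f j)"
  shows "cinf_on U (\<lambda>x. \<chi> j. f j x)"
proof -
  have lin: "linear (axis j :: 'b \<Rightarrow> 'b ^ 'i)" for j
    by (rule linearI) (auto simp: axis_def vec_eq_iff)
  have "cinf_on U (\<lambda>x. \<Sum>j\<in>UNIV. axis j (f j x))"
    by (intro cinf_on_sum assms cinf_on_bounded_linear_apply[OF assms(2)]) (use lin linear_conv_bounded_linear in blast)
  then show ?thesis
    by (rule cinf_on_cong) (simp add: vec_eq_iff axis_def if_distrib[of "\<lambda>f. f _"] sum.delta cong: if_cong)
qed

lemma cinf_on_amb:
  fixes f :: "'a::real_normed_vector \<Rightarrow> 'n::finite amb"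
  assumes "\<And>j. cinf_on U (\<lambda>x. fst (f x) $ j)" "cinf_on U (\<lambda>x. snd (f x))"
  shows "cinf_on U f"
  using cinf_on_Pair[OF cinf_on_vec_lambda[where f="\<lambda>j x. fst (f x) $ j", OF cinf_on_open[OF assms(2)] assms(1)] assms(2)]
  by simp

text \<open>The differential commutes with \<open>Jc\<close>, so along each complex line every
  coordinate of \<open>\<Phi>\<close> is complex differentiable; thus the coordinates are
  \<open>line_holo\<close>.\<close>

lemma cinf_on_holo:
  assumes "holo_on U \<Phi>"
  shows "cinf_on U \<Phi>"
proof (rule cinf_on_amb)
  have U: "open U" using assms by (simp add: holo_on_def)
  have lh: "line_holo U (\<lambda>x. \<pi> (\<Phi> x))" if lin: "linear \<pi>" and c: "\<And>c v. \<pi> (cs c v) = c * \<pi> v" for \<pi> :: "'a amb \<Rightarrow> complex"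
    unfolding line_holo_def
  proof (intro conjI ballI allI)
    show "open U" by fact
    have bl: "bounded_linear \<pi>" using lin linear_conv_bounded_linear by blast
    have "continuous_on U \<Phi>"
      using assms unfolding holo_on_def
      by (metis continuous_at_imp_continuous_on has_derivative_continuous)
    then show "continuous_on U (\<lambda>x. \<pi> (\<Phi> x))"
      by (rule bounded_linear.continuous_on[OF bl])
    fix x v assume "x \<in> U"
    then obtain D where D: "(\<Phi> has_derivative D) (at x)" "\<And>v. D (Jc v) = Jc (D v)"
      using assms unfolding holo_on_def by blast
    have 1: "((\<lambda>c. x + cs c v) has_derivative (\<lambda>c. cs c v)) (at 0)"
      using has_derivative_add[OF has_derivative_const bounded_linear_imp_has_derivative[OF bounded_linear_cs_left]]
      by simp
    have 2: "(\<Phi> has_derivative D) (at (x + cs 0 v))" using D by (simp add: cs_simps)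
    have "((\<lambda>c. \<Phi> (x + cs c v)) has_derivative (\<lambda>c. D (cs c v))) (at 0)"
      by (rule has_derivative_compose[OF 1 2])
    then have "((\<lambda>c. \<pi> (\<Phi> (x + cs c v))) has_derivative (\<lambda>c. \<pi> (D (cs c v)))) (at 0)"
      by (rule bounded_linear.has_derivative[OF bl])
    also have "(\<lambda>c. \<pi> (D (cs c v))) = (*) (\<pi> (D v))"
      using linear_Jc_commute_cs[OF has_derivative_linear[OF D(1)] D(2)] by (simp add: c mult.commute fun_eq_iff)
    finally show "(\<lambda>c. \<pi> (\<Phi> (x + cs c v))) field_differentiable at 0"
      unfolding field_differentiable_def has_field_derivative_def by blast
  qed
  show "cinf_on U (\<lambda>x. fst (\<Phi> x) $ j)" for j
    by (rule cinf_on_line_holo, rule lh) (auto intro!: linearI)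
  show "cinf_on U (\<lambda>x. snd (\<Phi> x))"
    by (rule cinf_on_line_holo, rule lh) (auto intro!: linearI)
qed

section \<open>Complex multilinearity of the derivatives of a holomorphic map\<close>

lemma holo_dd_Jc:
  assumes "holo_on U \<Phi>" "x \<in> U"
  shows "dd [Jc v] \<Phi> x = Jc (dd [v] \<Phi> x)"
  using assms unfolding holo_on_def by (metis has_derivative_imp_dd)

lemma holo_dd2_Jc:
  assumes h: "holo_on U \<Phi>" and x: "x \<in> U"
  shows "dd [u, Jc v] \<Phi> x = Jc (dd [u, v] \<Phi> x)" "dd [Jc u, v] \<Phi> x = Jc (dd [u, v] \<Phi> x)"
proof -
  note c = cinf_on_holo[OF h]
  have gen: "dd [u, Jc v] \<Phi> x = Jc (dd [u, v] \<Phi> x)" for u v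
  proof -
    have "dd [u, Jc v] \<Phi> x = dd [u] (dd [Jc v] \<Phi>) x" by (simp add: dd_Cons[of _ "[_]"])
    also have "\<dots> = dd [u] (\<lambda>x. Jc (dd [v] \<Phi> x)) x"
      by (rule dd_cong[OF cinf_on_open[OF c] holo_dd_Jc[OF h] x])
    also have "\<dots> = Jc (dd [u] (dd [v] \<Phi>) x)"
      by (rule dd_bounded_linear_apply[OF cinf_on_dd[OF c] bounded_linear_Jc x])
    finally show ?thesis by (simp add: dd_Cons[of _ "[_]"])
  qed
  show "dd [u, Jc v] \<Phi> x = Jc (dd [u, v] \<Phi> x)" by (rule gen)
  show "dd [Jc u, v] \<Phi> x = Jc (dd [u, v] \<Phi> x)"
    using gen[of v u] dd_swap[OF c x] by metis
qed

lemma holo_dd3_Jc: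
  assumes h: "holo_on U \<Phi>" and x: "x \<in> U"
  shows "dd [u, v, Jc w] \<Phi> x = Jc (dd [u, v, w] \<Phi> x)" "dd [u, Jc v, w] \<Phi> x = Jc (dd [u, v, w] \<Phi> x)"
    "dd [Jc u, v, w] \<Phi> x = Jc (dd [u, v, w] \<Phi> x)"
proof -
  note c = cinf_on_holo[OF h]
  have gen: "dd [u, v, Jc w] \<Phi> x = Jc (dd [u, v, w] \<Phi> x)" for u v w
  proof -
    have eq: "dd [u, v, w] \<Phi> = dd [u] (dd [v, w] \<Phi>)" for u v w by (simp add: dd.simps(2))
    have "dd [u, v, Jc w] \<Phi> x = dd [u] (\<lambda>x. Jc (dd [v, w] \<Phi> x)) x"
      unfolding eq by (rule dd_cong[OF cinf_on_open[OF c] holo_dd2_Jc(1)[OF h] x])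
    also have "\<dots> = Jc (dd [u] (dd [v, w] \<Phi>) x)"
      by (rule dd_bounded_linear_apply[OF cinf_on_dd[OF c] bounded_linear_Jc x])
    finally show ?thesis by (simp add: eq)
  qed
  show "dd [u, v, Jc w] \<Phi> x = Jc (dd [u, v, w] \<Phi> x)" by (rule gen)
  show "dd [u, Jc v, w] \<Phi> x = Jc (dd [u, v, w] \<Phi> x)"
    using gen[of u w v] dd3_swap[OF c x] by metis
  show "dd [Jc u, v, w] \<Phi> x = Jc (dd [u, v, w] \<Phi> x)"
    using gen[of v w u] dd3_swap[OF c x] by metis
qed

subsection \<open>Tangent vectors and characteristic forms\<close>

definition grad :: "('a::euclidean_space \<Rightarrow> real) \<Rightarrow> 'a \<Rightarrow> 'a" where
  "grad f x = (\<Sum>b\<in>Basis. dd [b] f x *\<^sub>R b)"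

lemma grad_inner: "cinf_on U f \<Longrightarrow> x \<in> U \<Longrightarrow> grad f x \<bullet> v = dd [v] f x"
  using dd_basis_expand[of U f x v] by (simp add: grad_def inner_sum_left mult.commute) (simp add: inner_commute)

lemma cinf_on_grad: "cinf_on U f \<Longrightarrow> cinf_on U (grad f)"
  unfolding grad_def by (intro cinf_on_sum cinf_on_scaleR cinf_on_dd cinf_on_const) (auto dest: cinf_on_open)

text \<open>The complexified values of a bilinear form on \<open>A + \<i> J A\<close>, \<open>C - \<i> J C\<close> and of a trilinear form on
  \<open>A + \<i> J A\<close>, \<open>B + \<i> J B\<close>, \<open>C - \<i> J C\<close>.\<close>

definition lev2 :: "('n::finite amb \<Rightarrow> 'n amb \<Rightarrow> real) \<Rightarrow> 'n amb \<Rightarrow> 'n amb \<Rightarrow> complex" where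
  "lev2 T A C = Complex (T A C + T (Jc A) (Jc C)) (T (Jc A) C - T A (Jc C))"

definition lev3 :: "('n::finite amb \<Rightarrow> 'n amb \<Rightarrow> 'n amb \<Rightarrow> real) \<Rightarrow> 'n amb \<Rightarrow> 'n amb \<Rightarrow> 'n amb \<Rightarrow> complex" where
  "lev3 T A B C = Complex
     (T A B C - T (Jc A) (Jc B) C + T (Jc A) B (Jc C) + T A (Jc B) (Jc C))
     (T (Jc A) B C + T A (Jc B) C - T A B (Jc C) + T (Jc A) (Jc B) (Jc C))"

locale hypersurface_nbhd =
  fixes M U :: "'n::finite amb set" and \<rho> :: "'n amb \<Rightarrow> real"
  assumes smooth: "cinf_on U \<rho>"
    and nondeg: "x \<in> U \<Longrightarrow> \<exists>v. dd [v] \<rho> x \<noteq> 0"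
    and zero: "M \<inter> U = {x \<in> U. \<rho> x = 0}"
begin

lemma open_U: "open U"
  by (rule cinf_on_open[OF smooth])

text \<open>A test function \<open>f\<close> that vanishes on \<open>M\<close> must be shown
  stationary along \<open>v\<close>, without a parametrization of \<open>M\<close>. For
  \<open>n\<close> with \<open>dd [n] \<rho> x > 0\<close> and small \<open>t\<close>,
  \<open>\<rho>\<close> has opposite signs at \<open>x + t (v - e n)\<close> and
  \<open>x + t (v + e n)\<close>. The intermediate value theorem gives a point of \<open>M\<close>
  between them, where \<open>f\<close> vanishes, and so the derivative of \<open>f\<close> along
  \<open>v\<close> is of size \<open>e\<close>.\<close>

lemma tangent_if_dd_zero:
  assumes x: "x \<in> M \<inter> U" and v: "dd [v] \<rho> x = 0"
  shows "tangent_vec M x v"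
  unfolding tangent_vec_def
proof (intro allI impI)
  fix W :: "'n amb set" and f :: "'n amb \<Rightarrow> real"
  assume asm: "x \<in> W \<and> cinf_on W f \<and> (\<forall>y\<in>M \<inter> W. f y = 0)"
  have xU: "x \<in> U" and xM: "x \<in> M" and f0: "f x = 0" and \<rho>0: "\<rho> x = 0"
    using x asm zero by auto
  interpret D\<rho>: linear "\<lambda>v. dd [v] \<rho> x" by (rule linear_dd[OF smooth xU])
  interpret Df: linear "\<lambda>v. dd [v] f x" by (rule linear_dd) (use asm in auto)
  obtain n where n: "dd [n] \<rho> x > 0"
  proof -
    obtain n0 where "dd [n0] \<rho> x \<noteq> 0" using nondeg[OF xU] by blast
    then show ?thesis using that[of n0] that[of "- n0"] by (cases "dd [n0] \<rho> x > 0") (auto simp: D\<rho>.neg)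
  qed
  have "\<bar>dd [v] f x\<bar> \<le> e * (1 + \<bar>dd [n] f x\<bar>)" if e: "e > 0" for e
  proof -
    \<comment> \<open>\<open>K\<close> bounds \<open>norm (v + s *\<^sub>R n)\<close> for all
      \<open>s\<close> between \<open>- e\<close> and \<open>e\<close>; the summand \<open>1\<close>
      keeps it positive.\<close>
    define K where "K = norm v + e * norm n + 1"
    have K: "K > 0" using e by (simp add: K_def add_nonneg_pos)
    obtain d1 where d1: "d1 > 0" "\<And>y. norm (y - x) < d1 \<Longrightarrow> \<bar>f y - f x - dd [y - x] f x\<bar> \<le> e / K * norm (y - x)"
    proof -
      have "(f has_derivative (\<lambda>v. dd [v] f x)) (at x)" using asm by (auto intro: cinf_on_has_derivative)
      then show ?thesis
        using that e K unfolding has_derivative_at_alt by (metis divide_pos_pos real_norm_def)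
    qed
    obtain d2 where d2: "d2 > 0" "ball x d2 \<subseteq> U \<inter> W"
      using asm xU open_U cinf_on_open by (metis IntI open_Int open_contains_ball)
    have line: "((\<lambda>t. \<rho> (x + t *\<^sub>R w)) has_real_derivative dd [w] \<rho> x) (at 0)" for w
      using cinf_on_deriv[OF smooth xU, of "[]" w] by (simp add: has_real_derivative_iff_has_vector_derivative)
    have "dd [v + e *\<^sub>R n] \<rho> x > 0" "dd [v - e *\<^sub>R n] \<rho> x < 0"
      using v n e by (auto simp: D\<rho>.add D\<rho>.diff D\<rho>.scale)
    then obtain d3 d4 where d3: "d3 > 0" "\<And>t. 0 < t \<Longrightarrow> t < d3 \<Longrightarrow> \<rho> (x + t *\<^sub>R (v + e *\<^sub>R n)) > 0"
       and d4: "d4 > 0" "\<And>t. 0 < t \<Longrightarrow> t < d4 \<Longrightarrow> \<rho> (x + t *\<^sub>R (v - e *\<^sub>R n)) < 0"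
      using DERIV_pos_inc_right[OF line[of "v + e *\<^sub>R n"]] DERIV_neg_dec_right[OF line[of "v - e *\<^sub>R n"]] \<rho>0
      by auto
    define t where "t = min (min d1 d2 / K) (min d3 d4) / 2"
    have t: "t > 0" "t < d3" "t < d4" "t * K < d1" "t * K < d2"
    proof -
      have "min (min d1 d2 / K) (min d3 d4) > 0" using d1 d2 d3 d4 K by auto
      then show "t > 0" "t < d3" "t < d4" by (auto simp: t_def)
      have "t < min d1 d2 / K" using \<open>t > 0\<close> unfolding t_def by linarith
      then show "t * K < d1" "t * K < d2" using K by (auto simp: pos_less_divide_eq)
    qed
    have nb: "norm (t *\<^sub>R (v + s *\<^sub>R n)) \<le> t * K" if "\<bar>s\<bar> \<le> e" for s
    proof -
      have "norm (v + s *\<^sub>R n) \<le> norm v + norm (s *\<^sub>R n)" by (rule norm_triangle_ineq)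
      also have "\<dots> \<le> K" using that by (auto simp: K_def intro!: add_increasing2 mult_right_mono)
      finally show ?thesis using t by simp
    qed
    have mem: "x + t *\<^sub>R (v + s *\<^sub>R n) \<in> U \<inter> W" if "\<bar>s\<bar> \<le> e" for s
    proof -
      have "x + t *\<^sub>R (v + s *\<^sub>R n) \<in> ball x d2"
        using le_less_trans[OF nb[OF that] t(5)] by (simp add: dist_norm del: norm_scaleR)
      then show ?thesis using d2 by blast
    qed
    have "\<exists>s\<ge>-e. s \<le> e \<and> \<rho> (x + t *\<^sub>R (v + s *\<^sub>R n)) = 0"
    proof (rule IVT')
      show "\<rho> (x + t *\<^sub>R (v + (-e) *\<^sub>R n)) \<le> 0" "0 \<le> \<rho> (x + t *\<^sub>R (v + e *\<^sub>R n))"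
        using d3(2)[of t] d4(2)[of t] t by (auto simp: less_imp_le)
      show "continuous_on {-e..e} (\<lambda>s. \<rho> (x + t *\<^sub>R (v + s *\<^sub>R n)))"
        by (rule continuous_on_compose2[OF cinf_on_continuous[OF smooth]]) (use mem in \<open>auto intro!: continuous_intros\<close>)
    qed (use e in auto)
    then obtain s where s: "\<bar>s\<bar> \<le> e" "\<rho> (x + t *\<^sub>R (v + s *\<^sub>R n)) = 0" by force
    have "f (x + t *\<^sub>R (v + s *\<^sub>R n)) = 0"
      using asm mem[OF s(1)] s(2) zero by blast
    then have "\<bar>dd [t *\<^sub>R (v + s *\<^sub>R n)] f x\<bar> \<le> e / K * norm (t *\<^sub>R (v + s *\<^sub>R n))"
      using d1(2)[of "x + t *\<^sub>R (v + s *\<^sub>R n)"] le_less_trans[OF nb[OF s(1)] t(4)] f0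
      by (simp del: norm_scaleR)
    also have "\<dots> \<le> e / K * (t * K)"
      using nb[OF s(1)] e K by (intro mult_left_mono) auto
    also have "\<dots> = t * e" using K by simp
    finally have "t * \<bar>dd [v] f x + s * dd [n] f x\<bar> \<le> t * e"
      using t by (simp add: Df.scale Df.add abs_mult)
    then have "\<bar>dd [v] f x + s * dd [n] f x\<bar> \<le> e" using t by simp
    moreover have "\<bar>s * dd [n] f x\<bar> \<le> e * \<bar>dd [n] f x\<bar>"
      unfolding abs_mult using s by (intro mult_right_mono) auto
    ultimately show ?thesis by (simp add: algebra_simps)
  qed
  then have le: "\<bar>dd [v] f x\<bar> \<le> e * (1 + \<bar>dd [n] f x\<bar>)" if "e > 0" for e using that .
  show "dd [v] f x = 0"
  proof (rule ccontr)
    assume ne: "dd [v] f x \<noteq> 0"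
    define N where "N = 1 + \<bar>dd [n] f x\<bar>"
    have N: "N > 0" by (simp add: N_def add_pos_nonneg)
    from le[of "\<bar>dd [v] f x\<bar> / (2 * N)"] ne N show False
      unfolding N_def[symmetric] by (simp add: field_simps)
  qed
qed

lemma tangent_iff: "x \<in> M \<inter> U \<Longrightarrow> tangent_vec M x v \<longleftrightarrow> dd [v] \<rho> x = 0"
proof
  assume x: "x \<in> M \<inter> U" and "tangent_vec M x v"
  moreover have "\<forall>y\<in>M \<inter> U. \<rho> y = 0" using zero by blast
  ultimately show "dd [v] \<rho> x = 0" using smooth unfolding tangent_vec_def by blast
qed (rule tangent_if_dd_zero)

text \<open>The licence to differentiate identities that hold on \<open>M\<close> only: the
  difference of both sides, coordinate by coordinate, is a test function for
  \<open>tangent_vec\<close>.\<close>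

lemma dd_tangent_cong:
  fixes F G :: "'n amb \<Rightarrow> 'b::euclidean_space"
  assumes F: "cinf_on U F" and G: "cinf_on U G" and eq: "\<And>y. y \<in> M \<inter> U \<Longrightarrow> F y = G y"
    and x: "x \<in> M \<inter> U" and v: "tangent_vec M x v"
  shows "dd [v] F x = dd [v] G x"
proof (rule euclidean_eqI)
  fix b :: 'b
  have xU: "x \<in> U" using x by blast
  note D = cinf_on_diff[OF F G]
  have FG: "dd [v] F x = dd [v] (\<lambda>y. F y - G y) x + dd [v] G x"
    using dd_add[OF D G xU, of "[v]"] by simp
  have "cinf_on U (\<lambda>y. (F y - G y) \<bullet> b)" "\<forall>y\<in>M \<inter> U. (F y - G y) \<bullet> b = 0"
    using cinf_on_bounded_linear_apply[OF D bounded_linear_inner_left] eq by simp_all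
  then have "dd [v] (\<lambda>y. (F y - G y) \<bullet> b) x = 0"
    using v xU unfolding tangent_vec_def by blast
  then have "dd [v] (\<lambda>y. F y - G y) x \<bullet> b = 0"
    using dd_bounded_linear_apply[OF D bounded_linear_inner_left xU] by metis
  then show "dd [v] F x \<bullet> b = dd [v] G x \<bullet> b"
    by (simp add: FG inner_add_left)
qed

lemma dd_tangent_zero:
  fixes F :: "'n amb \<Rightarrow> 'b::euclidean_space"
  assumes "cinf_on U F" "\<And>y. y \<in> M \<inter> U \<Longrightarrow> F y = 0" "x \<in> M \<inter> U" "tangent_vec M x v"
  shows "dd [v] F x = 0"
proof -
  have "dd [v] (\<lambda>x. 0 :: 'b) x = 0"
    by (rule has_derivative_imp_dd) (rule has_derivative_const)
  then show ?thesis
    using dd_tangent_cong[OF assms(1) cinf_on_const[OF open_U] _ assms(3,4), of 0] assms(2) by simp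
qed

lemma dd_field_product:
  assumes "cinf_on U A" "x \<in> U"
  shows "dd [v] (\<lambda>y. dd [A y] \<rho> y) x = dd [v, A x] \<rho> x + dd [dd [v] A x] \<rho> x"
  using dd_field_compose(2)[OF smooth cinf_on_ident[OF open_U] assms(1) _ assms(2)] by (simp add: dd_ident)

lemma dd_dd_field_product:
  assumes "cinf_on U A" "cinf_on U B" "x \<in> U"
  shows "dd [v] (\<lambda>y. dd [A y, B y] \<rho> y) x =
     dd [v, A x, B x] \<rho> x + dd [dd [v] A x, B x] \<rho> x + dd [A x, dd [v] B x] \<rho> x"
  using dd2_field_compose[OF smooth cinf_on_ident[OF open_U] assms(1,2) _ assms(3)] by (simp add: dd_ident)

lemma cinf_on_dd_dd_field:
  assumes "cinf_on U A" "cinf_on U B"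
  shows "cinf_on U (\<lambda>y. dd [A y, B y] \<rho> y)"
proof -
  have "cinf_on U (\<lambda>x. \<Sum>b\<in>Basis. (B x \<bullet> b) *\<^sub>R dd [A x] (dd [b] \<rho>) x)"
    by (intro cinf_on_sum open_U cinf_on_scaleR cinf_on_dd_field assms cinf_on_dd smooth
        cinf_on_bounded_linear_apply[OF assms(2) bounded_linear_inner_left])
  then show ?thesis
  proof (rule cinf_on_cong)
    fix x assume x: "x \<in> U"
    interpret linear "\<lambda>w. dd [A x, w] \<rho> x" by (rule linear_dd2(2)[OF smooth x])
    have "dd [A x, \<Sum>b\<in>Basis. (B x \<bullet> b) *\<^sub>R b] \<rho> x = (\<Sum>b\<in>Basis. (B x \<bullet> b) *\<^sub>R dd [A x, b] \<rho> x)"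
      by (simp only: sum scale)
    then show "(\<Sum>b\<in>Basis. (B x \<bullet> b) *\<^sub>R dd [A x] (dd [b] \<rho>) x) = dd [A x, B x] \<rho> x"
      by (simp add: euclidean_representation dd_Cons[of _ "[_]"])
  qed
qed

text \<open>Differentiating the tangency of \<open>W\<close> along \<open>V\<close>, and that of
  \<open>V\<close> along \<open>W\<close>, expresses both halves of the bracket by second
  derivatives of \<open>\<rho>\<close>, which agree by symmetry.\<close>

lemma rbr_tangent:
  assumes V: "cinf_on U V" "\<And>y. y \<in> M \<inter> U \<Longrightarrow> tangent_vec M y (V y)"
    and W: "cinf_on U W" "\<And>y. y \<in> M \<inter> U \<Longrightarrow> tangent_vec M y (W y)" and x: "x \<in> M \<inter> U"
  shows "tangent_vec M x (rbr V W x)"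
proof -
  have xU: "x \<in> U" using x by blast
  have "dd [V x] (\<lambda>y. dd [W y] \<rho> y) x = 0" "dd [W x] (\<lambda>y. dd [V y] \<rho> y) x = 0"
    by (rule dd_tangent_zero[OF cinf_on_dd_field[OF _ smooth] _ x]; use V W x tangent_iff in auto)+
  then have "dd [V x, W x] \<rho> x + dd [dd [V x] W x] \<rho> x = 0" "dd [W x, V x] \<rho> x + dd [dd [W x] V x] \<rho> x = 0"
    by (simp_all add: dd_field_product[OF V(1) xU] dd_field_product[OF W(1) xU])
  then show ?thesis
    unfolding rbr_def tangent_iff[OF x] linear_diff[OF linear_dd[OF smooth xU]]
    using dd_swap[OF smooth xU, of "V x" "W x"] by simp
qed

end

text \<open>A characteristic form restricts to \<open>char_coeff \<rho> c\<close> times \<open>d\<rho> \<circ> J\<close> on the tangent spaces.\<close>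

definition char_coeff :: "('n::finite amb \<Rightarrow> real) \<Rightarrow> ('n amb \<Rightarrow> 'n amb) \<Rightarrow> 'n amb \<Rightarrow> real" where
  "char_coeff \<rho> c x = (c x \<bullet> (- Jc (grad \<rho> x))) / (grad \<rho> x \<bullet> grad \<rho> x)"

locale hypersurface_form = hypersurface_nbhd M U \<rho> for M U :: "'n::finite amb set" and \<rho> +
  fixes c :: "'n amb \<Rightarrow> 'n amb"
  assumes char: "char_form M U c"
begin

abbreviation "lam \<equiv> char_coeff \<rho> c"

lemma smooth_c: "cinf_on U c"
  using char by (simp add: char_form_def)

lemma grad_nonzero: "x \<in> U \<Longrightarrow> grad \<rho> x \<noteq> 0"
  using nondeg[of x] grad_inner[OF smooth, of x] by force

lemma smooth_lam: "cinf_on U lam"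
  unfolding char_coeff_def[abs_def]
  by (intro cinf_on_divide cinf_on_inner smooth_c cinf_on_minus cinf_on_Jc cinf_on_grad smooth)
     (use grad_nonzero in auto)

text \<open>With \<open>n\<close> the gradient of \<open>\<rho>\<close>, a suitable multiple of
  \<open>Jc n\<close> moves \<open>v\<close> into the complex tangent space, where the form
  vanishes. Thus only its value on \<open>Jc n\<close> matters.\<close>

lemma char_tangent:
  assumes x: "x \<in> M \<inter> U" and v: "tangent_vec M x v"
  shows "c x \<bullet> v = lam x * dd [Jc v] \<rho> x"
proof -
  have xU: "x \<in> U" using x by blast
  define n where "n = grad \<rho> x"
  have g: "dd [w] \<rho> x = n \<bullet> w" for w using grad_inner[OF smooth xU] by (simp add: n_def)
  have n: "n \<bullet> n \<noteq> 0" using grad_nonzero[OF xU] by (simp add: n_def)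
  define k where "k = (n \<bullet> Jc v) / (n \<bullet> n)"
  have nv: "n \<bullet> v = 0" using v tangent_iff[OF x] g by simp
  have "tangent_vec M x (v + k *\<^sub>R Jc n)" "tangent_vec M x (Jc (v + k *\<^sub>R Jc n))"
    unfolding tangent_iff[OF x] g using nv n
    by (simp_all add: inner_add_right Jc_simps inner_Jc_self k_def inner_diff_right)
  then have "c x \<bullet> (v + k *\<^sub>R Jc n) = 0"
    using char x unfolding char_form_def by blast
  then show ?thesis
    using n by (simp add: char_coeff_def n_def[symmetric] g k_def inner_add_right inner_diff_right mult.commute)
qed

text \<open>This is half of the formula for the exterior derivative, the other half being zero when
  the form vanishes on \<open>V\<close>. After the form is written as \<open>lam\<close> times
  \<open>d\<rho>\<close> composed with \<open>J\<close>, the derivatives of \<open>W\<close> cancel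
  against the bracket, and tangency of \<open>Jc (V y)\<close> trades the derivative of
  \<open>V\<close> for a second derivative of \<open>\<rho>\<close>. Since \<open>Jc (W y)\<close>
  may be transverse, a derivative of \<open>lam\<close> remains.\<close>

lemma tangent_pair_form:
  assumes V: "cinf_on U V" "\<And>y. y \<in> M \<inter> U \<Longrightarrow> tangent_vec M y (V y)"
    "\<And>y. y \<in> M \<inter> U \<Longrightarrow> tangent_vec M y (Jc (V y))"
    and W: "cinf_on U W" "\<And>y. y \<in> M \<inter> U \<Longrightarrow> tangent_vec M y (W y)" and x: "x \<in> M \<inter> U"
  shows "dd [V x] (\<lambda>y. c y \<bullet> W y) x - c x \<bullet> rbr V W x =
     dd [V x] lam x * dd [Jc (W x)] \<rho> x + lam x * (dd [V x, Jc (W x)] \<rho> x - dd [W x, Jc (V x)] \<rho> x)"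
proof -
  have xU: "x \<in> U" using x by blast
  interpret D\<rho>: linear "\<lambda>v. dd [v] \<rho> x" by (rule linear_dd[OF smooth xU])
  note JW = cinf_on_Jc[OF W(1)] and JV = cinf_on_Jc[OF V(1)]
  have sW: "cinf_on U (\<lambda>y. dd [Jc (W y)] \<rho> y)" by (rule cinf_on_dd_field[OF JW smooth])
  have J: "dd [v] (\<lambda>y. Jc (A y)) x = Jc (dd [v] A x)" if "cinf_on U A" for A v
    by (rule dd_bounded_linear_apply[OF that bounded_linear_Jc xU])
  have 1: "dd [V x] (\<lambda>y. c y \<bullet> W y) x = dd [V x] (\<lambda>y. lam y * dd [Jc (W y)] \<rho> y) x"
    by (rule dd_tangent_cong[OF cinf_on_inner[OF smooth_c W(1)] cinf_on_mult[OF smooth_lam sW] _ x])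
       (use char_tangent V W x in auto)
  have 2: "dd [V x] (\<lambda>y. lam y * dd [Jc (W y)] \<rho> y) x =
      lam x * dd [V x] (\<lambda>y. dd [Jc (W y)] \<rho> y) x + dd [V x] lam x * dd [Jc (W x)] \<rho> x"
    by (rule has_derivative_imp_dd)
      (rule has_derivative_mult[OF cinf_on_has_derivative[OF smooth_lam xU] cinf_on_has_derivative[OF sW xU]])
  have 3: "dd [V x] (\<lambda>y. dd [Jc (W y)] \<rho> y) x = dd [V x, Jc (W x)] \<rho> x + dd [Jc (dd [V x] W x)] \<rho> x"
    using dd_field_product[OF JW xU] by (simp add: J[OF W(1)])
  have "dd [W x] (\<lambda>y. dd [Jc (V y)] \<rho> y) x = 0"
    by (rule dd_tangent_zero[OF cinf_on_dd_field[OF JV smooth] _ x]) (use V W x tangent_iff in auto)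
  then have 4: "dd [Jc (dd [W x] V x)] \<rho> x = - dd [W x, Jc (V x)] \<rho> x"
    using dd_field_product[OF JV xU] by (simp add: J[OF V(1)])
  have 5: "c x \<bullet> rbr V W x = lam x * dd [Jc (rbr V W x)] \<rho> x"
    by (rule char_tangent[OF x rbr_tangent]) (use V W x in auto)
  have 6: "dd [Jc (rbr V W x)] \<rho> x = dd [Jc (dd [V x] W x)] \<rho> x + dd [W x, Jc (V x)] \<rho> x"
    by (simp add: rbr_def Jc_simps D\<rho>.diff 4)
  show ?thesis unfolding 1 2 3 5 6 by (simp add: algebra_simps)
qed

section \<open>The operators \<open>Top\<close> applied to a characteristic form\<close>

lemma CR_fieldD:
  assumes "CR_field M U L"
  shows "cinf_on U (fst L)" "cinf_on U (snd L)"
    "\<And>y. y \<in> M \<inter> U \<Longrightarrow> snd L y = Jc (fst L y)"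
    "\<And>y. y \<in> M \<inter> U \<Longrightarrow> tangent_vec M y (fst L y)"
    "\<And>y. y \<in> M \<inter> U \<Longrightarrow> tangent_vec M y (Jc (fst L y))"
    "\<And>y. y \<in> M \<inter> U \<Longrightarrow> tangent_vec M y (snd L y)"
    "\<And>y. y \<in> M \<inter> U \<Longrightarrow> tangent_vec M y (Jc (snd L y))"
proof -
  show a: "cinf_on U (fst L)" "cinf_on U (snd L)"
    and b: "\<And>y. y \<in> M \<inter> U \<Longrightarrow> snd L y = Jc (fst L y)"
    and c: "\<And>y. y \<in> M \<inter> U \<Longrightarrow> tangent_vec M y (fst L y)"
    and d: "\<And>y. y \<in> M \<inter> U \<Longrightarrow> tangent_vec M y (Jc (fst L y))"
    using assms by (auto simp: CR_field_def)
  fix y assume y: "y \<in> M \<inter> U"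
  show "tangent_vec M y (snd L y)" using b c d y by simp
  have "y \<in> U" using y by blast
  then show "tangent_vec M y (Jc (snd L y))"
    using b[OF y] c[OF y] linear_neg[OF linear_dd[OF smooth]] by (simp add: Jc_simps tangent_iff[OF y])
qed

lemma dd_Complex:
  fixes a b :: "'n amb \<Rightarrow> real"
  assumes "cinf_on U a" "cinf_on U b" "x \<in> U"
  shows "dd [v] (\<lambda>y. Complex (a y) (b y)) x = Complex (dd [v] a x) (dd [v] b x)"
  unfolding Complex_eq
  by (rule has_derivative_imp_dd)
    (intro has_derivative_add has_derivative_mult_right has_derivative_of_real
      cinf_on_has_derivative[OF assms(1,3)] cinf_on_has_derivative[OF assms(2,3)])

lemma cinf_on_Complex:
  fixes a b :: "'n amb \<Rightarrow> real"
  assumes "cinf_on U a" "cinf_on U b"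
  shows "cinf_on U (\<lambda>y. Complex (a y) (b y))"
  unfolding Complex_eq
  by (intro cinf_on_add cinf_on_mult cinf_on_const open_U cinf_on_bounded_linear_apply[OF _ bounded_linear_of_real] assms)

lemma thform_eq: "thform c X = (\<lambda>y. Complex (c y \<bullet> fst X y) (c y \<bullet> snd X y))"
  by (rule ext) (simp add: thform_def)

lemma cinf_on_thform: "cinf_on U (fst X) \<Longrightarrow> cinf_on U (snd X) \<Longrightarrow> cinf_on U (thform c X)"
  unfolding thform_eq by (intro cinf_on_Complex cinf_on_inner smooth_c)

lemma cinf_on_act:
  assumes "cinf_on U (fst X)" "cinf_on U (snd X)" "cinf_on U f"
  shows "cinf_on U (act X f)"
  unfolding act_def[abs_def]
  by (intro cinf_on_add cinf_on_mult cinf_on_const open_U cinf_on_dd_field assms)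

lemma cinf_on_rbr: "cinf_on U V \<Longrightarrow> cinf_on U W \<Longrightarrow> cinf_on U (rbr V W)"
  unfolding rbr_def[abs_def] by (intro cinf_on_diff cinf_on_dd_field)

lemma cinf_on_br:
  assumes "cinf_on U (fst X)" "cinf_on U (snd X)" "cinf_on U (fst Y)" "cinf_on U (snd Y)"
  shows "cinf_on U (fst (br X Y))" "cinf_on U (snd (br X Y))"
  unfolding br_def fst_conv snd_conv by (intro cinf_on_add cinf_on_diff cinf_on_rbr assms)+

lemma cinf_on_cnjv:
  "cinf_on U (fst X) \<Longrightarrow> cinf_on U (fst (cnjv X))" "cinf_on U (snd X) \<Longrightarrow> cinf_on U (snd (cnjv X))"
  by (simp_all add: cnjv_def cinf_on_minus)

lemma cinf_on_Top:
  assumes "cinf_on U (fst L)" "cinf_on U (snd L)" "cinf_on U (fst X)" "cinf_on U (snd X)"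
  shows "cinf_on U (Top L (thform c) X)"
proof -
  have "cinf_on U (\<lambda>x. (act L (thform c X) x - act X (thform c L) x - thform c (br L X) x) * inverse (2 * \<i>))"
    by (intro cinf_on_mult cinf_on_diff cinf_on_act cinf_on_thform cinf_on_br cinf_on_const open_U assms)
  then show ?thesis unfolding Top_def[abs_def] divide_inverse .
qed

lemma tangent_diff_add:
  assumes "x \<in> M \<inter> U" "tangent_vec M x v" "tangent_vec M x w"
  shows "tangent_vec M x (v + w)" "tangent_vec M x (v - w)"
  using assms linear_add[OF linear_dd[OF smooth]] linear_diff[OF linear_dd[OF smooth]]
  by (auto simp: tangent_iff)

text \<open>The second field \<open>P + \<i> Q\<close> is tangent but of no particular type, because
  the bracket in the third order tensor has none. The form vanishes on \<open>L\<close> along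
  \<open>M\<close>, so what remains is \<open>tangent_pair_form\<close> for the real and imaginary
  parts, with \<open>Jc (Jc A) = - A\<close>.\<close>

lemma Top_tangent:
  assumes L: "CR_field M U L" and P: "cinf_on U P" "\<And>y. y \<in> M \<inter> U \<Longrightarrow> tangent_vec M y (P y)"
    and Q: "cinf_on U Q" "\<And>y. y \<in> M \<inter> U \<Longrightarrow> tangent_vec M y (Q y)" and x: "x \<in> M \<inter> U"
    and A: "A = fst L x"
  shows "2 * \<i> * Top L (thform c) (P, Q) x = Complex
     (dd [A] lam x * dd [Jc (P x)] \<rho> x - dd [Jc A] lam x * dd [Jc (Q x)] \<rho> x +
        lam x * (dd [A, Jc (P x)] \<rho> x - dd [P x, Jc A] \<rho> x - dd [Jc A, Jc (Q x)] \<rho> x - dd [Q x, A] \<rho> x))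
     (dd [A] lam x * dd [Jc (Q x)] \<rho> x + dd [Jc A] lam x * dd [Jc (P x)] \<rho> x +
        lam x * (dd [A, Jc (Q x)] \<rho> x - dd [Q x, Jc A] \<rho> x + dd [Jc A, Jc (P x)] \<rho> x + dd [P x, A] \<rho> x))"
proof -
  have xU: "x \<in> U" using x by blast
  note CR = CR_fieldD[OF L]
  have B: "snd L x = Jc A" using CR(3)[OF x] A by simp
  have zero: "thform c L y = 0" if "y \<in> M \<inter> U" for y
  proof -
    have "c y \<bullet> fst L y = 0" "c y \<bullet> snd L y = 0"
      using char that CR(4-7)[OF that] unfolding char_form_def by blast+
    then show ?thesis by (simp add: thform_def zero_complex.code)
  qed
  have 1: "dd [P x] (thform c L) x = 0" "dd [Q x] (thform c L) x = 0"
    by (rule dd_tangent_zero[OF cinf_on_thform[OF CR(1,2)] zero x]; use P Q x in auto)+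
  have 2: "dd [v] (thform c (P, Q)) x = Complex (dd [v] (\<lambda>y. c y \<bullet> P y) x) (dd [v] (\<lambda>y. c y \<bullet> Q y) x)" for v
    unfolding thform_eq fst_conv snd_conv by (intro dd_Complex cinf_on_inner smooth_c P Q xU)
  have E: "dd [fst L x] (\<lambda>y. c y \<bullet> W y) x = c x \<bullet> rbr (fst L) W x +
       (dd [A] lam x * dd [Jc (W x)] \<rho> x + lam x * (dd [A, Jc (W x)] \<rho> x - dd [W x, Jc A] \<rho> x))"
    "dd [snd L x] (\<lambda>y. c y \<bullet> W y) x = c x \<bullet> rbr (snd L) W x +
       (dd [Jc A] lam x * dd [Jc (W x)] \<rho> x + lam x * (dd [Jc A, Jc (W x)] \<rho> x + dd [W x, A] \<rho> x))"
    if W: "cinf_on U W" "\<And>y. y \<in> M \<inter> U \<Longrightarrow> tangent_vec M y (W y)" for W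
    using tangent_pair_form[OF CR(1,4,5) W x] tangent_pair_form[OF CR(2,6,7) W x]
      linear_neg[OF linear_dd2(2)[OF smooth xU], of "W x"]
    unfolding B A[symmetric] by (simp_all add: Jc_simps algebra_simps)
  have "2 * \<i> * Top L (thform c) (P, Q) x = act L (thform c (P, Q)) x - thform c (br L (P, Q)) x"
    by (simp add: Top_def act_def[of "(P, Q)"] 1)
  also have "\<dots> = Complex
     ((dd [fst L x] (\<lambda>y. c y \<bullet> P y) x - c x \<bullet> rbr (fst L) P x) - (dd [snd L x] (\<lambda>y. c y \<bullet> Q y) x - c x \<bullet> rbr (snd L) Q x))
     ((dd [fst L x] (\<lambda>y. c y \<bullet> Q y) x - c x \<bullet> rbr (fst L) Q x) + (dd [snd L x] (\<lambda>y. c y \<bullet> P y) x - c x \<bullet> rbr (snd L) P x))"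
    by (simp add: act_def 2 thform_def br_def complex_eq_iff inner_diff_right inner_add_right)
  also have "\<dots> = Complex
     (dd [A] lam x * dd [Jc (P x)] \<rho> x - dd [Jc A] lam x * dd [Jc (Q x)] \<rho> x +
        lam x * (dd [A, Jc (P x)] \<rho> x - dd [P x, Jc A] \<rho> x - dd [Jc A, Jc (Q x)] \<rho> x - dd [Q x, A] \<rho> x))
     (dd [A] lam x * dd [Jc (Q x)] \<rho> x + dd [Jc A] lam x * dd [Jc (P x)] \<rho> x +
        lam x * (dd [A, Jc (Q x)] \<rho> x - dd [Q x, Jc A] \<rho> x + dd [Jc A, Jc (P x)] \<rho> x + dd [P x, A] \<rho> x))"
    by (simp only: E(1)[OF P] E(2)[OF P] E(1)[OF Q] E(2)[OF Q]) (simp add: algebra_simps)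
  finally show ?thesis .
qed

lemma tangent_neg: "x \<in> M \<inter> U \<Longrightarrow> tangent_vec M x v \<Longrightarrow> tangent_vec M x (- v)"
  using linear_neg[OF linear_dd[OF smooth]] by (auto simp: tangent_iff)

text \<open>Both \<open>fst L'\<close> and its image under \<open>Jc\<close> are tangent, so the
  derivatives of \<open>lam\<close> drop out. The formula holds at all points of \<open>M\<close>
  near \<open>p\<close>, not just at \<open>p\<close>, and can therefore be differentiated once
  more.\<close>

lemma Top_cnjv:
  assumes L: "CR_field M U L" and L': "CR_field M U L'" and x: "x \<in> M \<inter> U"
  shows "Top L (thform c) (cnjv L') x = of_real (lam x) * lev2 (\<lambda>u v. dd [u, v] \<rho> x) (fst L x) (fst L' x)"
proof -
  have xU: "x \<in> U" using x by blast
  note CR = CR_fieldD[OF L']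
  have z: "dd [fst L' x] \<rho> x = 0" "dd [Jc (fst L' x)] \<rho> x = 0"
    using CR(4,5)[OF x] tangent_iff[OF x] by auto
  have swap: "dd [fst L' x, w] \<rho> x = dd [w, fst L' x] \<rho> x" "dd [Jc (fst L' x), w] \<rho> x = dd [w, Jc (fst L' x)] \<rho> x"
    if "w = fst L x \<or> w = Jc (fst L x)" for w
    by (rule dd_swap[OF smooth xU])+
  have "2 * \<i> * Top L (thform c) (cnjv L') x = 2 * \<i> * (of_real (lam x) * lev2 (\<lambda>u v. dd [u, v] \<rho> x) (fst L x) (fst L' x))"
    unfolding cnjv_def
    by (subst Top_tangent[OF L CR(1,4) cinf_on_minus[OF CR(2)] _ x refl])
      (use tangent_neg CR(6) in \<open>auto simp: swap CR(3)[OF x] Jc_simps z lev2_def complex_eq_iff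
         linear_neg[OF linear_dd2(1)[OF smooth xU]] linear_neg[OF linear_dd2(2)[OF smooth xU]] algebra_simps\<close>)
  then show ?thesis by simp
qed

text \<open>For two fields of type (0,1) the second derivatives cancel in pairs by symmetry, which
  expresses involutivity. As the identity holds along \<open>M\<close>, it disposes of the term of
  the third order tensor that is differentiated along \<open>cnjv Lg\<close>.\<close>

lemma Top_CR_zero:
  assumes L: "CR_field M U L" and L': "CR_field M U L'" and x: "x \<in> M \<inter> U"
  shows "Top L (thform c) L' x = 0"
proof -
  have xU: "x \<in> U" using x by blast
  note CR = CR_fieldD[OF L']
  have z: "dd [fst L' x] \<rho> x = 0" "dd [Jc (fst L' x)] \<rho> x = 0"
    using CR(4,5)[OF x] tangent_iff[OF x] by auto
  have swap: "dd [fst L' x, w] \<rho> x = dd [w, fst L' x] \<rho> x" "dd [Jc (fst L' x), w] \<rho> x = dd [w, Jc (fst L' x)] \<rho> x"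
    if "w = fst L x \<or> w = Jc (fst L x)" for w
    by (rule dd_swap[OF smooth xU])+
  have "2 * \<i> * Top L (thform c) (fst L', snd L') x = 0"
    by (subst Top_tangent[OF L CR(1,4) CR(2,6) x refl])
      (auto simp: swap CR(3)[OF x] Jc_simps z complex_eq_iff linear_neg[OF linear_dd[OF smooth xU]]
         linear_neg[OF linear_dd2(1)[OF smooth xU]] linear_neg[OF linear_dd2(2)[OF smooth xU]] algebra_simps)
  then show ?thesis by simp
qed

end

subsection \<open>The third order tensor\<close>

lemma lev2_Jc_right:
  assumes "\<And>u. linear (T u)"
  shows "lev2 T A (Jc C) = \<i> * lev2 T A C"
  using linear_neg[OF assms] by (simp add: lev2_def Jc_simps complex_eq_iff)

lemma lev2_add_right:
  assumes "\<And>u. linear (T u)"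
  shows "lev2 T A (C + D) = lev2 T A C + lev2 T A D"
  using linear_add[OF assms] by (simp add: lev2_def Jc_simps complex_eq_iff)

context hypersurface_form
begin

text \<open>At \<open>p\<close> the bracket splits as
  \<open>(e - \<i> J e) + (f + \<i> J f)\<close>, where \<open>e\<close> comes from differentiating
  \<open>Lg\<close> along \<open>La\<close> and \<open>f\<close> from differentiating
  \<open>La\<close> along \<open>cnjv Lg\<close>. The null condition places the bracket in the
  complex tangent space, so no derivative of \<open>lam\<close> occurs. The summand of type (0,1)
  contributes nothing, and \<open>e\<close> gives the value of \<open>lev2\<close>.\<close>

lemma Top_br_null:
  assumes La: "CR_field M U La" and Lb: "CR_field M U Lb" and Lg: "CR_field M U Lg" and p: "p \<in> M \<inter> U"
    and null: "lev2 (\<lambda>u v. dd [u, v] \<rho> p) (fst La p) (fst Lg p) = 0"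
  shows "Top Lb (thform c) (br La (cnjv Lg)) p = of_real (lam p) *
     lev2 (\<lambda>u v. dd [u, v] \<rho> p) (fst Lb p) (dd [fst La p] (fst Lg) p + Jc (dd [Jc (fst La p)] (fst Lg) p))"
proof -
  have pU: "p \<in> U" using p by blast
  note CRa = CR_fieldD[OF La] and CRb = CR_fieldD[OF Lb] and CRg = CR_fieldD[OF Lg]
  define A B C where "A = fst La p" and "B = fst Lb p" and "C = fst Lg p"
  define a1 a2 c1 c2 where "a1 = dd [A] (fst Lg) p" and "a2 = dd [Jc A] (fst Lg) p"
    and "c1 = dd [C] (fst La) p" and "c2 = dd [Jc C] (fst La) p"
  define e f where "e = a1 + Jc a2" and "f = - (c1 + Jc c2)"
  have tan: "tangent_vec M p A" "tangent_vec M p (Jc A)" "tangent_vec M p C" "tangent_vec M p (Jc C)"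
    using CRa(4,5)[OF p] CRg(4,5)[OF p] by (auto simp: A_def C_def)
  have J: "dd [v] (\<lambda>y. Jc (F y)) p = Jc (dd [v] F p)" if "cinf_on U F" for F v
    by (rule dd_bounded_linear_apply[OF that bounded_linear_Jc pU])
  have sa: "dd [v] (snd La) p = Jc (dd [v] (fst La) p)" if "tangent_vec M p v" for v
    using dd_tangent_cong[OF CRa(2) cinf_on_Jc[OF CRa(1)] CRa(3) p that] by (simp add: J[OF CRa(1)])
  have sg: "dd [v] (snd Lg) p = Jc (dd [v] (fst Lg) p)" if "tangent_vec M p v" for v
    using dd_tangent_cong[OF CRg(2) cinf_on_Jc[OF CRg(1)] CRg(3) p that] by (simp add: J[OF CRg(1)])
  have mg: "dd [v] (\<lambda>x. - snd Lg x) p = - dd [v] (snd Lg) p" for v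
    by (rule dd_bounded_linear_apply[OF CRg(2) bounded_linear_minus[OF bounded_linear_ident] pU])
  note lin1 = linear_dd[OF smooth pU]
  note l1 = linear_add[OF lin1] linear_diff[OF lin1] linear_neg[OF lin1]
  have lin2: "linear (\<lambda>u. dd [u, v] \<rho> p)" "linear (\<lambda>v. dd [u, v] \<rho> p)" for u v
    using linear_dd2[OF smooth pU] by auto
  note l2 = linear_add[OF lin2(1)] linear_diff[OF lin2(1)] linear_neg[OF lin2(1)]
    linear_add[OF lin2(2)] linear_diff[OF lin2(2)] linear_neg[OF lin2(2)]
  define P Q where "P = fst (br La (cnjv Lg))" and "Q = snd (br La (cnjv Lg))"
  have br: "br La (cnjv Lg) = (P, Q)" by (simp add: P_def Q_def)
  have smPQ: "cinf_on U P" "cinf_on U Q"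
    unfolding P_def Q_def by (rule cinf_on_br; intro cinf_on_cnjv CRa CRg)+
  have tn: "tangent_vec M y (- snd Lg y)" if "y \<in> M \<inter> U" for y
    using tangent_neg[OF that CRg(6)[OF that]] .
  have tanPQ: "tangent_vec M y (P y)" "tangent_vec M y (Q y)" if "y \<in> M \<inter> U" for y
    unfolding P_def Q_def br_def cnjv_def fst_conv snd_conv
    by (intro tangent_diff_add[OF that] rbr_tangent[OF _ _ _ _ that] CRa CRg tn cinf_on_minus; assumption)+
  have negdd: "dd [- v] (fst La) p = - dd [v] (fst La) p" "dd [- v] (snd La) p = - dd [v] (snd La) p" for v
    using linear_neg[OF linear_dd[OF CRa(1) pU]] linear_neg[OF linear_dd[OF CRa(2) pU]] by auto
  have Pp: "P p = e + f"
    unfolding P_def br_def cnjv_def fst_conv snd_conv rbr_def mg negdd CRa(3)[OF p] CRg(3)[OF p]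
      A_def[symmetric] C_def[symmetric] sa[OF tan(4)] sg[OF tan(2)]
    by (simp add: e_def f_def a1_def a2_def c1_def c2_def)
  have Qp: "Q p = - Jc e + Jc f"
    unfolding Q_def br_def cnjv_def fst_conv snd_conv rbr_def mg negdd CRa(3)[OF p] CRg(3)[OF p]
      A_def[symmetric] C_def[symmetric] sa[OF tan(3)] sg[OF tan(1)]
    by (simp add: e_def f_def a1_def a2_def c1_def c2_def Jc_simps)
  have fld: "dd [dd [v] F p] \<rho> p = - dd [v, F p] \<rho> p" "dd [Jc (dd [v] F p)] \<rho> p = - dd [v, Jc (F p)] \<rho> p"
    if F: "cinf_on U F" "\<And>y. y \<in> M \<inter> U \<Longrightarrow> tangent_vec M y (F y)"
      "\<And>y. y \<in> M \<inter> U \<Longrightarrow> tangent_vec M y (Jc (F y))" and v: "tangent_vec M p v" for F v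
  proof -
    have "dd [v] (\<lambda>y. dd [F y] \<rho> y) p = 0" "dd [v] (\<lambda>y. dd [Jc (F y)] \<rho> y) p = 0"
      by (rule dd_tangent_zero[OF cinf_on_dd_field[OF _ smooth] _ p v];
          use F tangent_iff in \<open>auto intro!: cinf_on_Jc\<close>)+
    then show "dd [dd [v] F p] \<rho> p = - dd [v, F p] \<rho> p" "dd [Jc (dd [v] F p)] \<rho> p = - dd [v, Jc (F p)] \<rho> p"
      using dd_field_product[OF F(1) pU, of v] dd_field_product[OF cinf_on_Jc[OF F(1)] pU, of v]
      by (simp_all add: J[OF F(1)])
  qed
  \<comment> \<open>Tangency of the fields and of their images under \<open>Jc\<close> converts the
    first derivatives of the fields into entries of the Hessian, on which the null condition
    acts.\<close>
  have d: "dd [a1] \<rho> p = - dd [A, C] \<rho> p" "dd [Jc a1] \<rho> p = - dd [A, Jc C] \<rho> p"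
    "dd [a2] \<rho> p = - dd [Jc A, C] \<rho> p" "dd [Jc a2] \<rho> p = - dd [Jc A, Jc C] \<rho> p"
    "dd [c1] \<rho> p = - dd [A, C] \<rho> p" "dd [Jc c1] \<rho> p = - dd [Jc A, C] \<rho> p"
    "dd [c2] \<rho> p = - dd [A, Jc C] \<rho> p" "dd [Jc c2] \<rho> p = - dd [Jc A, Jc C] \<rho> p"
    using fld[OF CRg(1,4,5) tan(1)] fld[OF CRg(1,4,5) tan(2)] fld[OF CRa(1,4,5) tan(3)] fld[OF CRa(1,4,5) tan(4)]
      dd_swap[OF smooth pU, of C] dd_swap[OF smooth pU, of "Jc C"]
    by (simp_all add: a1_def a2_def c1_def c2_def A_def[symmetric] C_def[symmetric])
  have n: "dd [Jc A, Jc C] \<rho> p = - dd [A, C] \<rho> p" "dd [Jc A, C] \<rho> p = dd [A, Jc C] \<rho> p"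
    using null by (simp_all add: lev2_def complex_eq_iff A_def[symmetric] C_def[symmetric])
  have s: "dd [Jc (P p)] \<rho> p = 0" "dd [Jc (Q p)] \<rho> p = 0"
    unfolding Pp Qp e_def f_def by (simp_all add: Jc_simps l1 d n)
  have sw: "dd [e, w] \<rho> p = dd [w, e] \<rho> p" "dd [f, w] \<rho> p = dd [w, f] \<rho> p"
    "dd [Jc e, w] \<rho> p = dd [w, Jc e] \<rho> p" "dd [Jc f, w] \<rho> p = dd [w, Jc f] \<rho> p" if "w = B \<or> w = Jc B" for w
    by (rule dd_swap[OF smooth pU])+
  have "2 * \<i> * Top Lb (thform c) (P, Q) p = 2 * \<i> * (of_real (lam p) * lev2 (\<lambda>u v. dd [u, v] \<rho> p) B e)"
    by (subst Top_tangent[OF Lb smPQ(1) tanPQ(1) smPQ(2) tanPQ(2) p refl])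
      (assumption | simp only: s B_def[symmetric], simp only: Pp Qp,
        simp add: Jc_simps l2 sw lev2_def complex_eq_iff algebra_simps)+
  then show ?thesis
    unfolding br by (simp add: B_def e_def a1_def a2_def A_def)
qed

text \<open>The product rule for \<open>lam * lev2\<close> along \<open>La\<close> has four parts.
  The derivative of \<open>lam\<close> multiplies a null value. The derivative of \<open>Lb\<close>,
  possibly transverse, is paired with \<open>fst Lg p\<close>; this is why \<open>null\<close> is
  demanded for every \<open>v\<close>. The derivative of \<open>Lg\<close> is cancelled by the
  bracket term. The third derivative of \<open>\<rho>\<close> survives, divided by the factor
  \<open>2 * \<i>\<close> of the outer \<open>Top\<close>.\<close>

lemma Top_Top_cnjv:
  assumes La: "CR_field M U La" and Lb: "CR_field M U Lb" and Lg: "CR_field M U Lg" and p: "p \<in> M \<inter> U"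
    and null: "\<And>v. lev2 (\<lambda>u v. dd [u, v] \<rho> p) v (fst Lg p) = 0"
  shows "Top La (Top Lb (thform c)) (cnjv Lg) p = of_real (lam p) *
     lev3 (\<lambda>u v w. dd [u, v, w] \<rho> p) (fst La p) (fst Lb p) (fst Lg p) / (2 * \<i>)"
proof -
  have pU: "p \<in> U" using p by blast
  note CRa = CR_fieldD[OF La] and CRb = CR_fieldD[OF Lb] and CRg = CR_fieldD[OF Lg]
  define A B C where "A = fst La p" and "B = fst Lb p" and "C = fst Lg p"
  let ?T2 = "\<lambda>u v. dd [u, v] \<rho> p" and ?T3 = "\<lambda>u v w. dd [u, v, w] \<rho> p"
  let ?re = "\<lambda>y. dd [fst Lb y, fst Lg y] \<rho> y + dd [Jc (fst Lb y), Jc (fst Lg y)] \<rho> y"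
  let ?im = "\<lambda>y. dd [Jc (fst Lb y), fst Lg y] \<rho> y - dd [fst Lb y, Jc (fst Lg y)] \<rho> y"
  note JB = cinf_on_Jc[OF CRb(1)] and JC = cinf_on_Jc[OF CRg(1)]
  note s2 = cinf_on_dd_dd_field[OF CRb(1) CRg(1)] cinf_on_dd_dd_field[OF JB JC]
    cinf_on_dd_dd_field[OF JB CRg(1)] cinf_on_dd_dd_field[OF CRb(1) JC]
  have sre: "cinf_on U ?re" and sim: "cinf_on U ?im"
    by (intro cinf_on_add cinf_on_diff s2)+
  have tan: "tangent_vec M p A" "tangent_vec M p (Jc A)" "tangent_vec M p C" "tangent_vec M p (Jc C)"
    using CRa(4,5)[OF p] CRg(4,5)[OF p] by (auto simp: A_def C_def)
  have J: "dd [v] (\<lambda>y. Jc (F y)) p = Jc (dd [v] F p)" if "cinf_on U F" for F v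
    by (rule dd_bounded_linear_apply[OF that bounded_linear_Jc pU])
  have lin2: "linear (\<lambda>v. dd [u, v] \<rho> p)" for u
    using linear_dd2[OF smooth pU] by auto
  have n0: "?re p = 0" "?im p = 0"
    using null[of "fst Lb p"] by (simp_all add: lev2_def complex_eq_iff)
  have first: "dd [v] (Top Lb (thform c) (cnjv Lg)) p = of_real (lam p) *
       (Complex (?T3 v B C + ?T3 v (Jc B) (Jc C)) (?T3 v (Jc B) C - ?T3 v B (Jc C)) + lev2 ?T2 B (dd [v] (fst Lg) p))"
    if v: "tangent_vec M p v" for v
  proof -
    have "dd [v] (Top Lb (thform c) (cnjv Lg)) p = dd [v] (\<lambda>y. Complex (lam y * ?re y) (lam y * ?im y)) p"
    proof (rule dd_tangent_cong[OF _ _ _ p v])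
      show "cinf_on U (Top Lb (thform c) (cnjv Lg))"
        by (intro cinf_on_Top cinf_on_cnjv CRb CRg)
      show "cinf_on U (\<lambda>y. Complex (lam y * ?re y) (lam y * ?im y))"
        by (intro cinf_on_Complex cinf_on_mult smooth_lam sre sim)
      show "Top Lb (thform c) (cnjv Lg) y = Complex (lam y * ?re y) (lam y * ?im y)" if "y \<in> M \<inter> U" for y
        unfolding Top_cnjv[OF Lb Lg that] lev2_def by (simp add: complex_eq_iff)
    qed
    also have "\<dots> = Complex (dd [v] (\<lambda>y. lam y * ?re y) p) (dd [v] (\<lambda>y. lam y * ?im y) p)"
      by (intro dd_Complex cinf_on_mult smooth_lam sre sim pU)
    also have "dd [v] (\<lambda>y. lam y * ?re y) p = lam p * dd [v] ?re p + dd [v] lam p * ?re p"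
      by (rule has_derivative_imp_dd)
        (rule has_derivative_mult[OF cinf_on_has_derivative[OF smooth_lam pU] cinf_on_has_derivative[OF sre pU]])
    also have "dd [v] (\<lambda>y. lam y * ?im y) p = lam p * dd [v] ?im p + dd [v] lam p * ?im p"
      by (rule has_derivative_imp_dd)
        (rule has_derivative_mult[OF cinf_on_has_derivative[OF smooth_lam pU] cinf_on_has_derivative[OF sim pU]])
    also have "dd [v] ?re p = dd [v] (\<lambda>y. dd [fst Lb y, fst Lg y] \<rho> y) p + dd [v] (\<lambda>y. dd [Jc (fst Lb y), Jc (fst Lg y)] \<rho> y) p"
      by (rule dd_add[OF s2(1,2) pU])
    also have "dd [v] ?im p = dd [v] (\<lambda>y. dd [Jc (fst Lb y), fst Lg y] \<rho> y) p - dd [v] (\<lambda>y. dd [fst Lb y, Jc (fst Lg y)] \<rho> y) p"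
      by (rule has_derivative_imp_dd)
        (rule has_derivative_diff[OF cinf_on_has_derivative[OF s2(3) pU] cinf_on_has_derivative[OF s2(4) pU]])
    also have "Complex (lam p * (dd [v] (\<lambda>y. dd [fst Lb y, fst Lg y] \<rho> y) p + dd [v] (\<lambda>y. dd [Jc (fst Lb y), Jc (fst Lg y)] \<rho> y) p) + dd [v] lam p * ?re p)
        (lam p * (dd [v] (\<lambda>y. dd [Jc (fst Lb y), fst Lg y] \<rho> y) p - dd [v] (\<lambda>y. dd [fst Lb y, Jc (fst Lg y)] \<rho> y) p) + dd [v] lam p * ?im p) =
       of_real (lam p) *
       (Complex (?T3 v B C + ?T3 v (Jc B) (Jc C)) (?T3 v (Jc B) C - ?T3 v B (Jc C)) + lev2 ?T2 B (dd [v] (fst Lg) p)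
         + lev2 ?T2 (dd [v] (fst Lb) p) C)"
      unfolding n0
      by (simp add: dd_dd_field_product[OF CRb(1) CRg(1) pU] dd_dd_field_product[OF JB JC pU]
        dd_dd_field_product[OF JB CRg(1) pU] dd_dd_field_product[OF CRb(1) JC pU] J[OF CRb(1)] J[OF CRg(1)]
        B_def[symmetric] C_def[symmetric] lev2_def complex_eq_iff algebra_simps)
    finally show ?thesis by (simp add: null[folded C_def])
  qed
  have second: "dd [v] (Top Lb (thform c) La) p = 0" if "tangent_vec M p v" for v
    by (rule dd_tangent_zero[OF cinf_on_Top[OF CRb(1,2) CRa(1,2)] Top_CR_zero[OF Lb La] p that])
  have "act La (Top Lb (thform c) (cnjv Lg)) p = of_real (lam p) *
     (lev3 ?T3 A B C + lev2 ?T2 B (dd [A] (fst Lg) p + Jc (dd [Jc A] (fst Lg) p)))"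
    unfolding act_def CRa(3)[OF p] A_def[symmetric] first[OF tan(1)] first[OF tan(2)]
      lev2_add_right[OF lin2] lev2_Jc_right[OF lin2]
    by (simp add: lev3_def complex_eq_iff algebra_simps)
  moreover have "act (cnjv Lg) (Top Lb (thform c) La) p = 0"
    unfolding act_def cnjv_def fst_conv snd_conv
    using second[OF CRg(4)[OF p]] second[OF tangent_neg[OF p CRg(6)[OF p]]] by simp
  moreover have "Top Lb (thform c) (br La (cnjv Lg)) p = of_real (lam p) *
      lev2 ?T2 B (dd [A] (fst Lg) p + Jc (dd [Jc A] (fst Lg) p))"
    using Top_br_null[OF La Lb Lg p null] by (simp add: A_def B_def)
  ultimately have "act La (Top Lb (thform c) (cnjv Lg)) p - act (cnjv Lg) (Top Lb (thform c) La) p -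
      Top Lb (thform c) (br La (cnjv Lg)) p = of_real (lam p) * lev3 ?T3 A B C"
    by (simp add: algebra_simps)
  then show ?thesis unfolding Top_def[of La] A_def B_def C_def by simp
qed

end

subsection \<open>Jets of compositions\<close>

lemma dd_compose_linear:
  assumes "linear l"
  shows "dd vs (\<lambda>x. f (l x)) x = dd (map l vs) f (l x)"
  by (induction vs arbitrary: x) (simp_all add: dd.simps(2) linear_add[OF assms] linear_scale[OF assms])

text \<open>Derivatives of linear, quadratic and cubic forms are read off as the coefficient of
  \<open>t\<close> in a polynomial, with no product rule.\<close>

lemma dd_polynomial_line:
  fixes f :: "'a::real_normed_vector \<Rightarrow> real"
  assumes "\<And>t. f (x + t *\<^sub>R v) = a0 + t * a1 + t\<^sup>2 * a2 + t ^ 3 * a3"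
  shows "dd [v] f x = a1"
proof (rule has_vector_derivative_imp_dd)
  show "((\<lambda>t. f (x + t *\<^sub>R v)) has_vector_derivative a1) (at 0)"
    unfolding assms has_real_derivative_iff_has_vector_derivative[symmetric]
    by (auto intro!: derivative_eq_intros)
qed

lemma dd_linear_form:
  fixes l :: "'a::real_normed_vector \<Rightarrow> real"
  assumes "linear l"
  shows "dd [v] l = (\<lambda>x. l v)" "dd [u, v] l = (\<lambda>x. 0)" "dd [t, u, v] l = (\<lambda>x. 0)"
proof -
  show 1: "dd [v] l = (\<lambda>x. l v)" for v
    by (rule ext, rule dd_polynomial_line[where ?a0.0="l _" and ?a2.0=0 and ?a3.0=0])
      (simp add: linear_add[OF assms] linear_scale[OF assms])
  have c: "dd [w] (\<lambda>x::'a. k::real) = (\<lambda>x. 0)" for w k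
    by (rule ext, rule dd_polynomial_line[where ?a0.0=k and ?a2.0=0 and ?a3.0=0]) simp
  show 2: "dd [u, v] l = (\<lambda>x. 0)" for u v
    by (simp add: dd_Cons[of u "[v]"] 1 c)
  show "dd [t, u, v] l = (\<lambda>x. 0)"
    by (simp add: dd_Cons[of t "[u, v]"] 2 c)
qed

lemma dd_quadratic_form:
  fixes B :: "'a::real_normed_vector \<Rightarrow> 'a \<Rightarrow> real"
  assumes l: "\<And>v. linear (\<lambda>u. B u v)" "\<And>u. linear (\<lambda>v. B u v)"
  shows "dd [v] (\<lambda>x. B x x) = (\<lambda>x. B v x + B x v)" "dd [u, v] (\<lambda>x. B x x) = (\<lambda>x. B v u + B u v)"
    "dd [t, u, v] (\<lambda>x. B x x) = (\<lambda>x. 0)"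
proof -
  note r = linear_add[OF l(1)] linear_add[OF l(2)] linear_scale[OF l(1)] linear_scale[OF l(2)]
  show 1: "dd [v] (\<lambda>x. B x x) = (\<lambda>x. B v x + B x v)" for v
    by (rule ext, rule dd_polynomial_line[where ?a0.0="B _ _" and ?a2.0="B v v" and ?a3.0=0])
      (simp add: r algebra_simps power2_eq_square)
  have lin: "linear (\<lambda>x. B v x + B x v)" for v
    by (intro linear_compose_add l)
  show "dd [u, v] (\<lambda>x. B x x) = (\<lambda>x. B v u + B u v)"
    unfolding dd_Cons[of u "[v]"] 1 by (rule dd_linear_form(1)[OF lin])
  have "dd [t, u, v] (\<lambda>x. B x x) = dd [t, u] (dd [v] (\<lambda>x. B x x))"
    by (simp add: dd.simps(2))
  then show "dd [t, u, v] (\<lambda>x. B x x) = (\<lambda>x. 0)"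
    unfolding 1 by (simp add: dd_linear_form(2)[OF lin])
qed

lemma dd_cubic_form:
  fixes T :: "'a::real_normed_vector \<Rightarrow> 'a \<Rightarrow> 'a \<Rightarrow> real"
  assumes l: "\<And>v w. linear (\<lambda>u. T u v w)" "\<And>u w. linear (\<lambda>v. T u v w)" "\<And>u v. linear (\<lambda>w. T u v w)"
  shows "dd [v] (\<lambda>x. T x x x) = (\<lambda>x. T v x x + T x v x + T x x v)"
    "dd [u, v] (\<lambda>x. T x x x) = (\<lambda>x. T v u x + T v x u + T u v x + T x v u + T u x v + T x u v)"
    "dd [t, u, v] (\<lambda>x. T x x x) = (\<lambda>x. T v u t + T v t u + T u v t + T t v u + T u t v + T t u v)"
proof -
  note r = linear_add[OF l(1)] linear_add[OF l(2)] linear_add[OF l(3)]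
    linear_scale[OF l(1)] linear_scale[OF l(2)] linear_scale[OF l(3)]
  show 1: "dd [v] (\<lambda>x. T x x x) = (\<lambda>x. T v x x + T x v x + T x x v)" for v
  proof
    fix x
    show "dd [v] (\<lambda>x. T x x x) x = T v x x + T x v x + T x x v"
      by (rule dd_polynomial_line[where ?a0.0="T x x x" and ?a2.0="T x v v + T v x v + T v v x" and ?a3.0="T v v v"])
        (simp add: r algebra_simps power2_eq_square power3_eq_cube)
  qed
  show 2: "dd [u, v] (\<lambda>x. T x x x) = (\<lambda>x. T v u x + T v x u + T u v x + T x v u + T u x v + T x u v)" for u v
    unfolding dd_Cons[of u "[v]"] 1
  proof
    fix x
    show "dd [u] (\<lambda>x. T v x x + T x v x + T x x v) x = T v u x + T v x u + T u v x + T x v u + T u x v + T x u v"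
      by (rule dd_polynomial_line[where ?a0.0="T v x x + T x v x + T x x v"
            and ?a2.0="T v u u + T u v u + T u u v" and ?a3.0=0])
        (simp add: r algebra_simps power2_eq_square)
  qed
  have lin: "linear (\<lambda>x. T v u x + T v x u + T u v x + T x v u + T u x v + T x u v)" for u v
    by (intro linear_compose_add l)
  show "dd [t, u, v] (\<lambda>x. T x x x) = (\<lambda>x. T v u t + T v t u + T u v t + T t v u + T u t v + T t u v)"
    unfolding dd_Cons[of t "[u, v]"] 2 by (rule dd_linear_form(1)[OF lin])
qed

lemma cinf_on_bilinear_diag:
  fixes B :: "'a::euclidean_space \<Rightarrow> 'a \<Rightarrow> real"
  assumes "open U" "\<And>v. linear (\<lambda>u. B u v)" "\<And>u. linear (\<lambda>v. B u v)"
  shows "cinf_on U (\<lambda>x. B x x)"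
proof -
  have "bilinear B" using assms(2,3) by (simp add: bilinear_def)
  then have "bounded_bilinear B" by (simp add: bilinear_conv_bounded_bilinear)
  from cinf_on_bilinear[OF this cinf_on_ident[OF assms(1)] cinf_on_ident[OF assms(1)]] show ?thesis .
qed

lemma linear_basis_expand:
  fixes L :: "'a::euclidean_space \<Rightarrow> 'b::real_vector"
  assumes "linear L"
  shows "L w = (\<Sum>b\<in>Basis. (w \<bullet> b) *\<^sub>R L b)"
proof -
  interpret linear L by fact
  show ?thesis by (subst euclidean_representation[of w, symmetric]) (simp only: sum scale)
qed

lemma cinf_on_trilinear_diag:
  fixes T :: "'a::euclidean_space \<Rightarrow> 'a \<Rightarrow> 'a \<Rightarrow> real"
  assumes U: "open U" and l: "\<And>v w. linear (\<lambda>u. T u v w)" "\<And>u w. linear (\<lambda>v. T u v w)" "\<And>u v. linear (\<lambda>w. T u v w)"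
  shows "cinf_on U (\<lambda>x. T x x x)"
proof -
  have "cinf_on U (\<lambda>x. \<Sum>b\<in>Basis. (x \<bullet> b) *\<^sub>R T b x x)"
    by (intro cinf_on_sum U cinf_on_scaleR cinf_on_bilinear_diag l
        cinf_on_bounded_linear_apply[OF cinf_on_ident[OF U] bounded_linear_inner_left])
  then show ?thesis
    by (rule cinf_on_cong) (rule linear_basis_expand[OF l(1), symmetric])
qed

text \<open>The second order comes from the first and the third from the second, with the
  derivatives of \<open>P\<close> treated as moving directions.\<close>

lemma dd_compose_jets:
  fixes m :: "'b::euclidean_space \<Rightarrow> 'c::euclidean_space" and P :: "'a::euclidean_space \<Rightarrow> 'b"
  assumes m: "cinf_on W m" and P: "cinf_on U P" and sub: "\<And>x. x \<in> U \<Longrightarrow> P x \<in> W" and x: "x \<in> U"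
  shows "dd [v] (\<lambda>y. m (P y)) x = dd [dd [v] P x] m (P x)"
    "dd [u, v] (\<lambda>y. m (P y)) x = dd [dd [u] P x, dd [v] P x] m (P x) + dd [dd [u, v] P x] m (P x)"
    "dd [t, u, v] (\<lambda>y. m (P y)) x = dd [dd [t] P x, dd [u] P x, dd [v] P x] m (P x)
       + dd [dd [t, u] P x, dd [v] P x] m (P x) + dd [dd [u] P x, dd [t, v] P x] m (P x)
       + dd [dd [t] P x, dd [u, v] P x] m (P x) + dd [dd [t, u, v] P x] m (P x)"
proof -
  note U = cinf_on_open[OF P]
  have 1: "dd [v] (\<lambda>y. m (P y)) x = dd [dd [v] P x] m (P x)" if "x \<in> U" for x v
    by (rule dd_field_compose(1)[OF m P P sub that])
  have 2: "dd [u, v] (\<lambda>y. m (P y)) x = dd [dd [u] P x, dd [v] P x] m (P x) + dd [dd [u, v] P x] m (P x)"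
    if x: "x \<in> U" for x u v
  proof -
    have "dd [u, v] (\<lambda>y. m (P y)) x = dd [u] (\<lambda>y. dd [dd [v] P y] m (P y)) x"
      unfolding dd_Cons[of u "[v]"] by (rule dd_cong[OF U 1 x])
    also have "\<dots> = dd [dd [u] P x, dd [v] P x] m (P x) + dd [dd [u] (dd [v] P) x] m (P x)"
      by (rule dd_field_compose(2)[OF m P cinf_on_dd[OF P] sub x])
    finally show ?thesis by (simp add: dd_Cons[of u "[v]"])
  qed
  have "dd [t, u, v] (\<lambda>y. m (P y)) x =
     dd [t] (\<lambda>y. dd [dd [u] P y, dd [v] P y] m (P y) + dd [dd [u, v] P y] m (P y)) x"
    unfolding dd_Cons[of t "[u, v]"] by (rule dd_cong[OF U 2 x])
  also have "\<dots> = dd [t] (\<lambda>y. dd [dd [u] P y, dd [v] P y] m (P y)) x + dd [t] (\<lambda>y. dd [dd [u, v] P y] m (P y)) x"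
  proof (rule dd_add[OF _ cinf_on_dd_compose[OF m P cinf_on_dd[OF P] sub] x])
    \<comment> \<open>The whole second derivative is smooth and so is its second summand; the first
      summand is smooth as the difference.\<close>
    have "cinf_on U (\<lambda>y. dd [dd [u] P y, dd [v] P y] m (P y) + dd [dd [u, v] P y] m (P y))"
      by (rule cinf_on_cong[OF cinf_on_dd[OF cinf_on_compose[OF m P sub], of "[u, v]"] 2])
    from cinf_on_diff[OF this cinf_on_dd_compose[OF m P cinf_on_dd[OF P, of "[u, v]"] sub]]
    show "cinf_on U (\<lambda>y. dd [dd [u] P y, dd [v] P y] m (P y))" by simp
  qed
  also have "dd [t] (\<lambda>y. dd [dd [u] P y, dd [v] P y] m (P y)) x = dd [dd [t] P x, dd [u] P x, dd [v] P x] m (P x)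
       + dd [dd [t] (dd [u] P) x, dd [v] P x] m (P x) + dd [dd [u] P x, dd [t] (dd [v] P) x] m (P x)"
    by (rule dd2_field_compose[OF m P cinf_on_dd[OF P] cinf_on_dd[OF P] sub x])
  also have "dd [t] (\<lambda>y. dd [dd [u, v] P y] m (P y)) x = dd [dd [t] P x, dd [u, v] P x] m (P x) + dd [dd [t] (dd [u, v] P) x] m (P x)"
    by (rule dd_field_compose(2)[OF m P cinf_on_dd[OF P] sub x])
  finally show "dd [t, u, v] (\<lambda>y. m (P y)) x = dd [dd [t] P x, dd [u] P x, dd [v] P x] m (P x)
       + dd [dd [t, u] P x, dd [v] P x] m (P x) + dd [dd [u] P x, dd [t, v] P x] m (P x)
       + dd [dd [t] P x, dd [u, v] P x] m (P x) + dd [dd [t, u, v] P x] m (P x)"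
    by (simp add: dd_Cons[of t "[_]"] dd_Cons[of t "[_, _]"])
  show "dd [v] (\<lambda>y. m (P y)) x = dd [dd [v] P x] m (P x)" by (rule 1[OF x])
  show "dd [u, v] (\<lambda>y. m (P y)) x = dd [dd [u] P x, dd [v] P x] m (P x) + dd [dd [u, v] P x] m (P x)"
    by (rule 2[OF x])
qed

text \<open>The second derivative of a holomorphic map vanishes on pairs of vectors of opposite type; the one
  remaining second order contribution to \<open>lev3\<close> is a value of \<open>lev2\<close> at the null direction.\<close>

lemma lev_compose_holo:
  fixes m :: "'n::finite amb \<Rightarrow> real"
  assumes h: "holo_on U \<Phi>" and x: "x \<in> U" and m: "cinf_on W m" and sub: "\<And>x. x \<in> U \<Longrightarrow> \<Phi> x \<in> W"
  shows "lev2 (\<lambda>u v. dd [u, v] (\<lambda>y. m (\<Phi> y)) x) A C =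
      lev2 (\<lambda>u v. dd [u, v] m (\<Phi> x)) (dd [A] \<Phi> x) (dd [C] \<Phi> x)"
    "(\<And>v. lev2 (\<lambda>u v. dd [u, v] m (\<Phi> x)) v (dd [C] \<Phi> x) = 0) \<Longrightarrow>
      lev3 (\<lambda>t u v. dd [t, u, v] (\<lambda>y. m (\<Phi> y)) x) A B C =
      lev3 (\<lambda>t u v. dd [t, u, v] m (\<Phi> x)) (dd [A] \<Phi> x) (dd [B] \<Phi> x) (dd [C] \<Phi> x)"
proof -
  note P = cinf_on_holo[OF h]
  note jets = dd_compose_jets[OF m P sub x]
  note J = holo_dd_Jc[OF h x] holo_dd2_Jc[OF h x] holo_dd3_Jc[OF h x]
  note l1 = linear_neg[OF linear_dd[OF m sub[OF x]]]
  note l2 = linear_neg[OF linear_dd2(1)[OF m sub[OF x]]] linear_neg[OF linear_dd2(2)[OF m sub[OF x]]]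
  show "lev2 (\<lambda>u v. dd [u, v] (\<lambda>y. m (\<Phi> y)) x) A C =
      lev2 (\<lambda>u v. dd [u, v] m (\<Phi> x)) (dd [A] \<Phi> x) (dd [C] \<Phi> x)"
    by (simp add: lev2_def jets J Jc_simps l1)
  assume null: "\<And>v. lev2 (\<lambda>u v. dd [u, v] m (\<Phi> x)) v (dd [C] \<Phi> x) = 0"
  define E where "E = dd [A, B] \<Phi> x"
  have n: "dd [Jc E, Jc (dd [C] \<Phi> x)] m (\<Phi> x) = - dd [E, dd [C] \<Phi> x] m (\<Phi> x)"
    "dd [Jc E, dd [C] \<Phi> x] m (\<Phi> x) = dd [E, Jc (dd [C] \<Phi> x)] m (\<Phi> x)"
    using null[of E] by (simp_all add: lev2_def complex_eq_iff)
  show "lev3 (\<lambda>t u v. dd [t, u, v] (\<lambda>y. m (\<Phi> y)) x) A B C =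
      lev3 (\<lambda>t u v. dd [t, u, v] m (\<Phi> x)) (dd [A] \<Phi> x) (dd [B] \<Phi> x) (dd [C] \<Phi> x)"
    by (simp add: lev3_def jets J Jc_simps l1 l2 n E_def[symmetric])
qed

subsection \<open>The model equation\<close>

definition model2 :: "nat \<Rightarrow> nat \<Rightarrow> complex ^ ('n::{finite,linorder}) \<Rightarrow> complex ^ ('n::{finite,linorder}) \<Rightarrow> complex" where
  "model2 r s u v = (\<Sum>\<alpha>\<in>UNIV. \<Sum>\<beta>\<in>UNIV. gmat r s \<alpha> \<beta> * cnj (u $ \<alpha>) * v $ \<beta>)"

definition model3 :: "nat \<Rightarrow> nat \<Rightarrow> ('n \<Rightarrow> 'n \<Rightarrow> 'n \<Rightarrow> complex) \<Rightarrow>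
    complex ^ ('n::{finite,linorder}) \<Rightarrow> complex ^ ('n::{finite,linorder}) \<Rightarrow> complex ^ ('n::{finite,linorder}) \<Rightarrow> complex" where
  "model3 r s h u v w = (\<Sum>\<alpha>\<in>UNIV. \<Sum>\<beta>\<in>UNIV. \<Sum>\<gamma>\<in>{\<gamma>. r + s < pos \<gamma>}.
     h \<alpha> \<beta> \<gamma> * cnj (u $ \<alpha>) * cnj (v $ \<beta>) * w $ \<gamma>)"

lemma rho_model_eq:
  "rho_model r s h R Z = - Im (snd Z) + Re (model2 r s (fst Z) (fst Z)) +
     2 * Re (model3 r s h (fst Z) (fst Z) (fst Z)) + R (fst Z, Re (snd Z))"
  by (simp add: rho_model_def model2_def model3_def Let_def)

lemma model2_simps:
  "model2 r s (u + u') v = model2 r s u v + model2 r s u' v"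
  "model2 r s u (v + v') = model2 r s u v + model2 r s u v'"
  "model2 r s (k *\<^sub>R u) v = of_real k * model2 r s u v"
  "model2 r s u (k *\<^sub>R v) = of_real k * model2 r s u v"
  "model2 r s (fst (Jc U)) v = - (\<i> * model2 r s (fst U) v)"
  "model2 r s u (fst (Jc V)) = \<i> * model2 r s u (fst V)"
  by (simp_all add: model2_def algebra_simps sum.distrib sum_distrib_left scaleR_conv_of_real[where 'a=complex] sum_negf)

lemma model3_simps:
  "model3 r s h (u + u') v w = model3 r s h u v w + model3 r s h u' v w"
  "model3 r s h u (v + v') w = model3 r s h u v w + model3 r s h u v' w"
  "model3 r s h u v (w + w') = model3 r s h u v w + model3 r s h u v w'"
  "model3 r s h (k *\<^sub>R u) v w = of_real k * model3 r s h u v w"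
  "model3 r s h u (k *\<^sub>R v) w = of_real k * model3 r s h u v w"
  "model3 r s h u v (k *\<^sub>R w) = of_real k * model3 r s h u v w"
  "model3 r s h (fst (Jc U)) v w = - (\<i> * model3 r s h (fst U) v w)"
  "model3 r s h u (fst (Jc V)) w = - (\<i> * model3 r s h u (fst V) w)"
  "model3 r s h u v (fst (Jc W)) = \<i> * model3 r s h u v (fst W)"
  by (simp_all add: model3_def algebra_simps sum.distrib sum_distrib_left scaleR_conv_of_real[where 'a=complex] sum_negf)

lemma cnj_gmat: "cnj (gmat r s \<alpha> \<beta>) = gmat r s \<beta> \<alpha>"
  by (auto simp: gmat_def eps_def)

lemma model2_hermitian: "model2 r s v u = cnj (model2 r s u v)"
proof -
  have "cnj (model2 r s u v) = (\<Sum>\<alpha>\<in>UNIV. \<Sum>\<beta>\<in>UNIV. gmat r s \<beta> \<alpha> * u $ \<alpha> * cnj (v $ \<beta>))"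
    by (simp add: model2_def cnj_gmat)
  also have "\<dots> = (\<Sum>\<beta>\<in>UNIV. \<Sum>\<alpha>\<in>UNIV. gmat r s \<beta> \<alpha> * u $ \<alpha> * cnj (v $ \<beta>))"
    by (rule sum.swap)
  finally show ?thesis by (simp add: model2_def mult_ac)
qed

lemma model3_symmetric:
  assumes "\<forall>\<alpha> \<beta> \<gamma>. r + s < pos \<gamma> \<longrightarrow> h \<alpha> \<beta> \<gamma> = h \<beta> \<alpha> \<gamma>"
  shows "model3 r s h v u w = model3 r s h u v w"
proof -
  have "model3 r s h v u w = (\<Sum>\<beta>\<in>UNIV. \<Sum>\<alpha>\<in>UNIV. \<Sum>\<gamma>\<in>{\<gamma>. r + s < pos \<gamma>}. h \<alpha> \<beta> \<gamma> * cnj (v $ \<alpha>) * cnj (u $ \<beta>) * w $ \<gamma>)"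
    unfolding model3_def by (rule sum.swap)
  also have "\<dots> = model3 r s h u v w"
    unfolding model3_def using assms by (intro sum.cong) (auto simp: mult_ac)
  finally show ?thesis .
qed

lemma sum_axis_delta:
  fixes f :: "'n::finite \<Rightarrow> complex"
  shows "(\<Sum>j\<in>S. f j * axis k a $ j) = (if k \<in> S then f k * a else 0)"
    "(\<Sum>j\<in>S. f j * cnj (axis k a $ j)) = (if k \<in> S then f k * cnj a else 0)"
  by (simp_all add: axis_def if_distrib[of cnj] if_distrib[of "(*) _"] sum.delta' cong: if_cong)

lemma model2_axis: "model2 r s (axis \<alpha> a) (axis \<beta> b) = gmat r s \<alpha> \<beta> * cnj a * b"
  by (simp add: model2_def sum_axis_delta flip: sum_distrib_right)

text \<open>The coordinate vectors beyond \<open>r + s\<close> span the kernel of the model form,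
  which is the source of the null condition.\<close>

lemma model2_axis_null:
  "r + s < pos \<gamma> \<Longrightarrow> model2 r s u (axis \<gamma> b) = 0"
  by (auto simp: model2_def sum_axis_delta gmat_def eps_def intro!: sum.neutral)

lemma model3_axis:
  assumes "r + s < pos \<gamma>"
  shows "model3 r s h (axis \<alpha> a) (axis \<beta> b) (axis \<gamma> d) = h \<alpha> \<beta> \<gamma> * cnj a * cnj b * d"
  using assms by (simp add: model3_def sum_axis_delta flip: sum_distrib_right)

section \<open>Jets of the remainder and of the model at the origin\<close>

lemma linear_zero_on_z_directions:
  fixes L :: "(complex ^ 'n::finite) \<times> real \<Rightarrow> real"
  assumes L: "linear L" and z: "\<And>b. b \<in> Basis \<Longrightarrow> snd b = 0 \<Longrightarrow> L b = 0"
  shows "L (z, 0) = 0"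
proof -
  have "L (z, 0) = (\<Sum>b\<in>Basis. ((z, 0) \<bullet> b) *\<^sub>R L b)" by (rule linear_basis_expand[OF L])
  also have "\<dots> = 0"
  proof (intro sum.neutral ballI)
    fix b :: "(complex ^ 'n) \<times> real" assume b: "b \<in> Basis"
    show "((z, 0) \<bullet> b) *\<^sub>R L b = 0"
    proof (cases "snd b = 0")
      case True
      then show ?thesis using z[OF b] by simp
    next
      case False
      then have "fst b = 0" using b by (auto simp: Basis_prod_def)
      then show ?thesis by (simp add: inner_prod_def)
    qed
  qed
  finally show ?thesis .
qed

context
  fixes R :: "(complex ^ 'n::{finite,linorder}) \<times> real \<Rightarrow> real" and W
  assumes R: "cinf_on W R" and W0: "0 \<in> W"
    and vanish: "\<And>vs. set vs \<subseteq> Basis \<Longrightarrow> sum_list (map wt vs) < 4 \<Longrightarrow> dd vs R 0 = 0"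
begin

text \<open>Weights below four include all first derivatives, all second derivatives with at least
  one direction in \<open>z\<close>, and third derivatives in directions of \<open>z\<close> only.
  Multilinearity passes from basis vectors to arbitrary ones.\<close>

lemma remainder_jets:
  "dd [v] R 0 = 0" "dd [(z, 0), v] R 0 = 0" "dd [v, (z, 0)] R 0 = 0" "dd [(z, 0), (z', 0), (z'', 0)] R 0 = 0"
proof -
  have v1: "dd [b] R 0 = 0" if "b \<in> Basis" for b
    using vanish[of "[b]"] that by (simp add: wt_def)
  have v2: "dd [b, b'] R 0 = 0" if "b \<in> Basis" "b' \<in> Basis" "snd b = 0" for b b'
    using vanish[of "[b, b']"] that by (simp add: wt_def)
  have v3: "dd [b, b', b''] R 0 = 0" if "b \<in> Basis" "b' \<in> Basis" "b'' \<in> Basis" "snd b = 0" "snd b' = 0" "snd b'' = 0" for b b' b''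
    using vanish[of "[b, b', b'']"] that by (simp add: wt_def)
  show "dd [v] R 0 = 0"
    using linear_basis_expand[OF linear_dd[OF R W0], of v] v1 by simp
  show 2: "dd [(z, 0), v] R 0 = 0" for v
  proof (rule linear_zero_on_z_directions[OF linear_dd2(1)[OF R W0]])
    show "dd [b, v] R 0 = 0" if b: "b \<in> Basis" "snd b = 0" for b
      using linear_basis_expand[OF linear_dd2(2)[OF R W0], of b v] v2[OF b(1) _ b(2)] by simp
  qed
  show "dd [v, (z, 0)] R 0 = 0"
    using 2[of v] dd_swap[OF R W0] by metis
  show "dd [(z, 0), (z', 0), (z'', 0)] R 0 = 0"
    by (intro linear_zero_on_z_directions[OF linear_dd3(1)[OF R W0]]
        linear_zero_on_z_directions[OF linear_dd3(2)[OF R W0]]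
        linear_zero_on_z_directions[OF linear_dd3(3)[OF R W0]] v3)
qed

abbreviation (input) "proj Z \<equiv> (fst Z, Re (snd Z))"

lemma linear_proj: "linear (\<lambda>Z :: 'n amb. proj Z)"
  by (rule linearI) auto

lemma open_proj: "open {Z :: 'n amb. proj Z \<in> W}"
proof -
  have "continuous_on UNIV (\<lambda>Z :: 'n amb. proj Z)" by (intro continuous_intros)
  from open_vimage[OF cinf_on_open[OF R] this] show ?thesis by (simp add: vimage_def)
qed

lemma rho_model_pieces:
  fixes h :: "'n \<Rightarrow> 'n \<Rightarrow> 'n \<Rightarrow> complex"
  shows "linear (\<lambda>Z :: 'n amb. - Im (snd Z))"
    "linear (\<lambda>u :: 'n amb. Re (model2 r s (fst u) (fst v)))" "linear (\<lambda>v :: 'n amb. Re (model2 r s (fst u) (fst v)))"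
    "linear (\<lambda>t :: 'n amb. 2 * Re (model3 r s h (fst t) (fst u) (fst v)))"
    "linear (\<lambda>u :: 'n amb. 2 * Re (model3 r s h (fst t) (fst u) (fst v)))"
    "linear (\<lambda>v :: 'n amb. 2 * Re (model3 r s h (fst t) (fst u) (fst v)))"
  by (rule linearI; simp add: model2_simps model3_simps algebra_simps)+

lemma rho_model_smooth_jets:
  fixes h :: "'n \<Rightarrow> 'n \<Rightarrow> 'n \<Rightarrow> complex"
  defines "V \<equiv> {Z :: 'n amb. proj Z \<in> W}"
  shows "cinf_on V (rho_model r s h R)" "0 \<in> V"
    "dd [v] (rho_model r s h R) 0 = - Im (snd v)"
    "dd [u, v] (rho_model r s h R) 0 = Re (model2 r s (fst v) (fst u)) + Re (model2 r s (fst u) (fst v))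
       + dd [proj u, proj v] R 0"
    "dd [t, u, v] (rho_model r s h R) 0 =
       2 * Re (model3 r s h (fst v) (fst u) (fst t)) + 2 * Re (model3 r s h (fst v) (fst t) (fst u)) +
       2 * Re (model3 r s h (fst u) (fst v) (fst t)) + 2 * Re (model3 r s h (fst t) (fst v) (fst u)) +
       2 * Re (model3 r s h (fst u) (fst t) (fst v)) + 2 * Re (model3 r s h (fst t) (fst u) (fst v)) +
       dd [proj t, proj u, proj v] R 0"
proof -
  let ?l = "\<lambda>Z :: 'n amb. - Im (snd Z)"
  let ?B = "\<lambda>u v :: 'n amb. Re (model2 r s (fst u) (fst v))"
  let ?T = "\<lambda>t u v :: 'n amb. 2 * Re (model3 r s h (fst t) (fst u) (fst v))"
  note pc = rho_model_pieces
  have V: "open V" unfolding V_def by (rule open_proj)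
  show 0: "0 \<in> V" using W0 by (simp add: V_def flip: zero_prod_def)
  have s1: "cinf_on V ?l" by (rule cinf_on_linear[OF V pc(1)])
  have s2: "cinf_on V (\<lambda>x. ?B x x)" by (rule cinf_on_bilinear_diag[OF V pc(2,3)])
  have s3: "cinf_on V (\<lambda>x. ?T x x x)" by (rule cinf_on_trilinear_diag[OF V pc(4,5,6)])
  have s4: "cinf_on V (\<lambda>Z. R (proj Z))"
    by (rule cinf_on_compose[OF R cinf_on_linear[OF V linear_proj]]) (simp add: V_def)
  have eq: "rho_model r s h R = (\<lambda>Z. ((?l Z + ?B Z Z) + ?T Z Z Z) + R (proj Z))"
    by (rule ext) (simp add: rho_model_eq)
  show "cinf_on V (rho_model r s h R)" unfolding eq by (intro cinf_on_add s1 s2 s3 s4)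
  have D: "dd vs (rho_model r s h R) 0 = dd vs ?l 0 + dd vs (\<lambda>x. ?B x x) 0 + dd vs (\<lambda>x. ?T x x x) 0 + dd (map (\<lambda>Z. proj Z) vs) R 0" for vs
  proof -
    have "dd vs (rho_model r s h R) 0 = dd vs (\<lambda>Z. (?l Z + ?B Z Z) + ?T Z Z Z) 0 + dd vs (\<lambda>Z. R (proj Z)) 0"
      unfolding eq by (rule dd_add[OF _ s4 0]) (intro cinf_on_add s1 s2 s3)
    also have "dd vs (\<lambda>Z. (?l Z + ?B Z Z) + ?T Z Z Z) 0 = dd vs (\<lambda>Z. ?l Z + ?B Z Z) 0 + dd vs (\<lambda>x. ?T x x x) 0"
      by (rule dd_add[OF _ s3 0]) (intro cinf_on_add s1 s2)
    also have "dd vs (\<lambda>Z. ?l Z + ?B Z Z) 0 = dd vs ?l 0 + dd vs (\<lambda>x. ?B x x) 0"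
      by (rule dd_add[OF s1 s2 0])
    also have "dd vs (\<lambda>Z. R (proj Z)) 0 = dd (map (\<lambda>Z. proj Z) vs) R 0"
      using dd_compose_linear[OF linear_proj, of vs R 0] by (simp flip: zero_prod_def)
    finally show ?thesis .
  qed
  have z: "model2 r s 0 u = 0" "model2 r s u 0 = 0" "model3 r s h 0 u v = 0" "model3 r s h u 0 v = 0" "model3 r s h u v 0 = 0" for u v
    by (simp_all add: model2_def model3_def)
  show "dd [v] (rho_model r s h R) 0 = - Im (snd v)"
    unfolding D by (simp add: dd_linear_form[OF pc(1)] dd_quadratic_form[OF pc(2,3)] dd_cubic_form[OF pc(4,5,6)] z remainder_jets)
  show "dd [u, v] (rho_model r s h R) 0 = Re (model2 r s (fst v) (fst u)) + Re (model2 r s (fst u) (fst v))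
       + dd [proj u, proj v] R 0"
    unfolding D by (simp add: dd_linear_form[OF pc(1)] dd_quadratic_form[OF pc(2,3)] dd_cubic_form[OF pc(4,5,6)] z)
  show "dd [t, u, v] (rho_model r s h R) 0 =
       2 * Re (model3 r s h (fst v) (fst u) (fst t)) + 2 * Re (model3 r s h (fst v) (fst t) (fst u)) +
       2 * Re (model3 r s h (fst u) (fst v) (fst t)) + 2 * Re (model3 r s h (fst t) (fst v) (fst u)) +
       2 * Re (model3 r s h (fst u) (fst t) (fst v)) + 2 * Re (model3 r s h (fst t) (fst u) (fst v)) +
       dd [proj t, proj u, proj v] R 0"
    unfolding D by (simp add: dd_linear_form[OF pc(1)] dd_quadratic_form[OF pc(2,3)] dd_cubic_form[OF pc(4,5,6)])
qed

text \<open>The Hessian contributes two equal real parts, by hermitian symmetry, and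
  \<open>lev2\<close> doubles the result. A direction of \<open>z\<close> in one slot already kills
  the remainder, so \<open>A\<close> stays arbitrary, as the null condition requires.\<close>

lemma lev2_rho_model:
  assumes "snd C = 0"
  shows "lev2 (\<lambda>u v. dd [u, v] (rho_model r s h R) 0) A C = 4 * model2 r s (fst A) (fst C)"
  using assms model2_hermitian[of r s "fst C" "fst A"]
  by (simp add: lev2_def rho_model_smooth_jets model2_simps remainder_jets complex_eq_iff)

text \<open>Of the six terms of the third derivative, \<open>lev3\<close> keeps the two that are
  conjugated in \<open>A\<close> and \<open>B\<close> and linear in \<open>C\<close>; symmetry of
  \<open>h\<close> makes them equal. Each carries the \<open>2\<close> of \<open>2 * Re\<close> and
  gains a factor \<open>4\<close> from \<open>lev3\<close>.\<close>

lemma lev3_rho_model: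
  assumes "snd A = 0" "snd B = 0" "snd C = 0"
    and "\<forall>\<alpha> \<beta> \<gamma>. r + s < pos \<gamma> \<longrightarrow> h \<alpha> \<beta> \<gamma> = h \<beta> \<alpha> \<gamma>"
  shows "lev3 (\<lambda>t u v. dd [t, u, v] (rho_model r s h R) 0) A B C = 16 * model3 r s h (fst A) (fst B) (fst C)"
  using assms(1-3) model3_symmetric[OF assms(4), of "fst B" "fst A" "fst C"]
  by (simp add: lev3_def rho_model_smooth_jets model3_simps remainder_jets complex_eq_iff)

end

subsection \<open>From coordinates to frames\<close>

text \<open>Differentiating \<open>\<Psi> (\<Phi> x) = x\<close> gives a left inverse of the
  differential; equality of dimensions does the rest.\<close>

lemma hol_coords_bij:
  assumes hc: "hol_coords U \<Phi>" and p: "p \<in> U"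
  shows "bij (\<lambda>v. dd [v] \<Phi> p)"
proof -
  obtain \<Psi> where \<Psi>: "holo_on (\<Phi> ` U) \<Psi>" "\<And>x. x \<in> U \<Longrightarrow> \<Psi> (\<Phi> x) = x"
    and h: "holo_on U \<Phi>" using hc by (auto simp: hol_coords_def)
  note P = cinf_on_holo[OF h]
  obtain E where E: "(\<Psi> has_derivative E) (at (\<Phi> p))"
    using \<Psi>(1) p unfolding holo_on_def by blast
  have "((\<lambda>x. \<Psi> (\<Phi> x)) has_derivative (\<lambda>v. E (dd [v] \<Phi> p))) (at p)"
    by (rule has_derivative_compose[OF cinf_on_has_derivative[OF P p] E])
  then have "((\<lambda>x. x) has_derivative (\<lambda>v. E (dd [v] \<Phi> p))) (at p)"
    by (rule has_derivative_transform_within_open[OF _ cinf_on_open[OF P] p \<Psi>(2)])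
  then have "(\<lambda>v. E (dd [v] \<Phi> p)) = (\<lambda>v. v)"
    by (rule has_derivative_unique) (rule has_derivative_ident)
  then have "inj (\<lambda>v. dd [v] \<Phi> p)"
    by (intro inj_on_inverseI[of _ E]) (metis (no_types))
  then show ?thesis
    using linear_injective_imp_surjective[OF linear_dd[OF P p]] by (simp add: bij_def)
qed

lemma holo_on_subset: "holo_on U \<Phi> \<Longrightarrow> open V \<Longrightarrow> V \<subseteq> U \<Longrightarrow> holo_on V \<Phi>"
  unfolding holo_on_def by blast

lemma CR_field_subset: "CR_field M U L \<Longrightarrow> open V \<Longrightarrow> V \<subseteq> U \<Longrightarrow> CR_field M V L"
  unfolding CR_field_def by (blast intro: cinf_on_subset)

lemma char_form_subset: "char_form M U c \<Longrightarrow> open V \<Longrightarrow> V \<subseteq> U \<Longrightarrow> char_form M V c"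
  unfolding char_form_def by (blast intro: cinf_on_subset)

lemma hol_coords_dd_surj:
  assumes "hol_coords U \<Phi>" "p \<in> U"
  obtains v where "dd [v] \<Phi> p = w"
proof -
  have "w \<in> range (\<lambda>v. dd [v] \<Phi> p)" using bij_is_surj[OF hol_coords_bij[OF assms]] by simp
  then show ?thesis using that by blast
qed

lemma rho_model_compose_domain:
  fixes p :: "('n::{finite,linorder}) amb"
  assumes h: "holo_on U \<Phi>" and p: "p \<in> U" and \<Phi>p: "\<Phi> p = 0" and WR: "cinf_on WR R" "0 \<in> WR"
  obtains U1 where "open U1" "p \<in> U1" "U1 \<subseteq> U" "\<forall>x\<in>U1. \<Phi> x \<in> {Z :: 'n amb. (fst Z, Re (snd Z)) \<in> WR}"
proof -
  define X where "X = {Z :: 'n amb. (fst Z, Re (snd Z)) \<in> WR}"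
  have P: "cinf_on U \<Phi>" by (rule cinf_on_holo[OF h])
  have "continuous_on UNIV (\<lambda>Z :: 'n amb. (fst Z, Re (snd Z)))" by (intro continuous_intros)
  from open_vimage[OF cinf_on_open[OF WR(1)] this] have oX: "open X"
    by (simp add: X_def vimage_def)
  show ?thesis
  proof
    show "open (\<Phi> -` X \<inter> U)"
      using continuous_on_open_vimage[OF cinf_on_open[OF P]] cinf_on_continuous[OF P] oX by blast
    show "p \<in> \<Phi> -` X \<inter> U" using p \<Phi>p WR(2) by (simp add: X_def flip: zero_prod_def)
  qed (auto simp: X_def)
qed

lemma rho_model_compose_jets:
  fixes p :: "('n::{finite,linorder}) amb"
  assumes h: "holo_on U \<Phi>" and p: "p \<in> U" and \<Phi>p: "\<Phi> p = 0" and wv: "weighted_vanish4 R"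
    and \<rho>_def: "\<rho> = (\<lambda>x. rho_model r s h R (\<Phi> x))"
  shows "dd [v] \<rho> p = - Im (snd (dd [v] \<Phi> p))"
    "snd (dd [C] \<Phi> p) = 0 \<Longrightarrow> lev2 (\<lambda>u v. dd [u, v] \<rho> p) A C = 4 * model2 r s (fst (dd [A] \<Phi> p)) (fst (dd [C] \<Phi> p))"
    "\<forall>\<alpha> \<beta> \<gamma>. r + s < pos \<gamma> \<longrightarrow> h \<alpha> \<beta> \<gamma> = h \<beta> \<alpha> \<gamma> \<Longrightarrow>
       snd (dd [A] \<Phi> p) = 0 \<Longrightarrow> snd (dd [B] \<Phi> p) = 0 \<Longrightarrow> snd (dd [C] \<Phi> p) = 0 \<Longrightarrow>
       (\<And>u. model2 r s u (fst (dd [C] \<Phi> p)) = 0) \<Longrightarrow>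
       lev3 (\<lambda>t u v. dd [t, u, v] \<rho> p) A B C = 16 * model3 r s h (fst (dd [A] \<Phi> p)) (fst (dd [B] \<Phi> p)) (fst (dd [C] \<Phi> p))"
proof -
  obtain WR where WR: "cinf_on WR R" "0 \<in> WR"
    "\<And>vs. set vs \<subseteq> Basis \<Longrightarrow> sum_list (map wt vs) < 4 \<Longrightarrow> dd vs R 0 = 0"
    using wv unfolding weighted_vanish4_def by blast
  note jets = rho_model_smooth_jets[OF WR]
  obtain U1 where U1: "open U1" "p \<in> U1" "U1 \<subseteq> U" and sub': "\<forall>x\<in>U1. \<Phi> x \<in> {Z :: 'n amb. (fst Z, Re (snd Z)) \<in> WR}"
    by (rule rho_model_compose_domain[OF h p \<Phi>p WR(1,2)])
  note sub = bspec[OF sub']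
  have h1: "holo_on U1 \<Phi>" by (rule holo_on_subset[OF h U1(1,3)])
  show "dd [v] \<rho> p = - Im (snd (dd [v] \<Phi> p))"
    unfolding \<rho>_def using dd_compose_jets(1)[OF jets(1) cinf_on_holo[OF h1] sub U1(2)] by (simp add: \<Phi>p jets(3))
  show "lev2 (\<lambda>u v. dd [u, v] \<rho> p) A C = 4 * model2 r s (fst (dd [A] \<Phi> p)) (fst (dd [C] \<Phi> p))"
    if "snd (dd [C] \<Phi> p) = 0"
    using lev_compose_holo(1)[OF h1 U1(2) jets(1) sub] lev2_rho_model[OF WR that] by (simp add: \<rho>_def \<Phi>p)
  show "lev3 (\<lambda>t u v. dd [t, u, v] \<rho> p) A B C = 16 * model3 r s h (fst (dd [A] \<Phi> p)) (fst (dd [B] \<Phi> p)) (fst (dd [C] \<Phi> p))"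
    if sym: "\<forall>\<alpha> \<beta> \<gamma>. r + s < pos \<gamma> \<longrightarrow> h \<alpha> \<beta> \<gamma> = h \<beta> \<alpha> \<gamma>"
      and z: "snd (dd [A] \<Phi> p) = 0" "snd (dd [B] \<Phi> p) = 0" "snd (dd [C] \<Phi> p) = 0"
      and null: "\<And>u. model2 r s u (fst (dd [C] \<Phi> p)) = 0"
  proof -
    have "lev3 (\<lambda>t u v. dd [t, u, v] \<rho> p) A B C =
      lev3 (\<lambda>t u v. dd [t, u, v] (rho_model r s h R) (\<Phi> p)) (dd [A] \<Phi> p) (dd [B] \<Phi> p) (dd [C] \<Phi> p)"
      unfolding \<rho>_def
      by (rule lev_compose_holo(2)[OF h1 U1(2) jets(1) sub]) (simp_all add: \<Phi>p lev2_rho_model[OF WR z(3)] null)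
    then show ?thesis unfolding \<Phi>p by (simp add: lev3_rho_model[OF WR z sym])
  qed
qed

text \<open>The pulled back model is a local defining function: along the vector that
  \<open>\<Phi>\<close> sends to \<open>(0, \<i>)\<close> its derivative at \<open>p\<close> is
  \<open>-1\<close>, and \<open>W\<close> is where this derivative does not vanish.\<close>

lemma rho_model_nbhd:
  fixes p :: "('n::{finite,linorder}) amb"
  assumes hc: "hol_coords U \<Phi>" and p: "p \<in> U" and \<Phi>p: "\<Phi> p = 0" and wv: "weighted_vanish4 R"
    and U': "open U'" "p \<in> U'" "U' \<subseteq> U" and M: "M \<inter> U' = {x \<in> U'. rho_model r s h R (\<Phi> x) = 0}"
    and \<rho>_def: "\<rho> = (\<lambda>x. rho_model r s h R (\<Phi> x))"
  obtains W where "p \<in> W" "W \<subseteq> U'" "hypersurface_nbhd M W \<rho>"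
proof -
  have hol: "holo_on U' \<Phi>" by (rule holo_on_subset[OF _ U'(1,3)]) (use hc in \<open>simp add: hol_coords_def\<close>)
  obtain WR where WR: "cinf_on WR R" "0 \<in> WR"
    "\<And>vs. set vs \<subseteq> Basis \<Longrightarrow> sum_list (map wt vs) < 4 \<Longrightarrow> dd vs R 0 = 0"
    using wv unfolding weighted_vanish4_def by blast
  obtain U1 where U1: "open U1" "p \<in> U1" "U1 \<subseteq> U'" and sub': "\<forall>x\<in>U1. \<Phi> x \<in> {Z :: 'n amb. (fst Z, Re (snd Z)) \<in> WR}"
    by (rule rho_model_compose_domain[OF hol U'(2) \<Phi>p WR(1,2)])
  note sub = bspec[OF sub']
  have s\<rho>: "cinf_on U1 \<rho>"
    unfolding \<rho>_def by (rule cinf_on_compose[OF rho_model_smooth_jets(1)[OF WR] cinf_on_holo[OF holo_on_subset[OF hol U1(1,3)]] sub])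
  obtain n where n: "dd [n] \<Phi> p = (0, \<i>)" by (rule hol_coords_dd_surj[OF hc p])
  define W where "W = dd [n] \<rho> -` (- {0}) \<inter> U1"
  have oW: "open W"
    unfolding W_def using continuous_on_open_vimage[OF U1(1)] cinf_on_continuous_dd[OF s\<rho>] open_Compl[OF closed_singleton] by blast
  show ?thesis
  proof
    show "p \<in> W" using U1 rho_model_compose_jets(1)[OF hol U'(2) \<Phi>p wv \<rho>_def, of n] n by (simp add: W_def)
    show "W \<subseteq> U'" using U1 by (auto simp: W_def)
    show "hypersurface_nbhd M W \<rho>"
    proof
      show "cinf_on W \<rho>" by (rule cinf_on_subset[OF s\<rho> oW]) (auto simp: W_def)
      show "\<exists>v. dd [v] \<rho> x \<noteq> 0" if "x \<in> W" for x using that unfolding W_def by blast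
      show "M \<inter> W = {x \<in> W. \<rho> x = 0}" using M U1 unfolding W_def \<rho>_def by blast
    qed
  qed
qed

lemma hypersurface_nbhd_subset:
  assumes "hypersurface_nbhd M U \<rho>" "open V" "V \<subseteq> U"
  shows "hypersurface_nbhd M V \<rho>"
  using assms unfolding hypersurface_nbhd_def by (blast intro: cinf_on_subset)

text \<open>Since the operators \<open>Top\<close> carry the factor \<open>1 / (2 * \<i>)\<close>, the coordinate fields of type (0,1) would give
  \<open>- \<i> * h\<close> as third order tensor. Multiplying them by \<open>\<i>\<close> changes this to \<open>h\<close> and keeps the Levi form; the
  real part of the resulting field is \<open>- \<i> / 2\<close> times a basis vector.\<close>

lemma normal_form_tensors:
  fixes p :: "('n::{finite,linorder}) amb"
  assumes hc: "hol_coords U \<Phi>" and p: "p \<in> U" and \<Phi>p: "\<Phi> p = 0" and wv: "weighted_vanish4 R"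
    and U': "open U'" "p \<in> U'" "U' \<subseteq> U" and M: "M \<inter> U' = {x \<in> U'. rho_model r s h R (\<Phi> x) = 0}"
    and V: "open V" "p \<in> V" and pM: "p \<in> M"
    and CR: "\<And>\<alpha>. CR_field M V (Lb \<alpha>)" and c: "char_form M V c"
    and val: "\<And>\<alpha>. dd [fst (Lb \<alpha>) p] \<Phi> p = (axis \<alpha> (- \<i> / 2), 0)"
    and cval: "\<And>v. tangent_vec M p v \<Longrightarrow> c p \<bullet> v = - Re (snd (dd [v] \<Phi> p))"
    and sym: "\<forall>\<alpha> \<beta> \<gamma>. r + s < pos \<gamma> \<longrightarrow> h \<alpha> \<beta> \<gamma> = h \<beta> \<alpha> \<gamma>"
  shows "Top (Lb \<alpha>) (thform c) (cnjv (Lb \<beta>)) p = gmat r s \<alpha> \<beta>"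
    "r + s < pos \<gamma> \<Longrightarrow> Top (Lb \<alpha>) (Top (Lb \<beta>) (thform c)) (cnjv (Lb \<gamma>)) p = h \<alpha> \<beta> \<gamma>"
proof -
  define \<rho> where "\<rho> = (\<lambda>x. rho_model r s h R (\<Phi> x))"
  have hol: "holo_on U \<Phi>" using hc by (simp add: hol_coords_def)
  note jets = rho_model_compose_jets[OF hol p \<Phi>p wv \<rho>_def]
  obtain W0 where W0: "p \<in> W0" "W0 \<subseteq> U'" "hypersurface_nbhd M W0 \<rho>"
    by (rule rho_model_nbhd[OF hc p \<Phi>p wv U' M \<rho>_def])
  define W where "W = W0 \<inter> V"
  have oW: "open W" unfolding W_def using hypersurface_nbhd.open_U[OF W0(3)] V by blast
  have W: "p \<in> W" "W \<subseteq> V" "W \<subseteq> W0" using W0 V by (auto simp: W_def)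
  interpret hypersurface_nbhd M W \<rho> by (rule hypersurface_nbhd_subset[OF W0(3) oW W(3)])
  interpret hypersurface_form M W \<rho> c
    by unfold_locales (rule char_form_subset[OF c open_U W(2)])
  have CRW: "CR_field M W (Lb \<alpha>)" for \<alpha> by (rule CR_field_subset[OF CR open_U W(2)])
  have pMW: "p \<in> M \<inter> W" using pM W(1) by blast
  have lam: "lam p = 1"
  proof -
    \<comment> \<open>This direction is tangent, and \<open>Jc v\<close> corresponds to
      \<open>(0, \<i>)\<close>, where the differential of \<open>\<rho>\<close> is
      \<open>-1\<close>. The form takes the value \<open>-1\<close> on \<open>v\<close> too, so the
      coefficient is \<open>1\<close>.\<close>
    obtain v where v: "dd [v] \<Phi> p = (0, 1)" by (rule hol_coords_dd_surj[OF hc p])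
    have "tangent_vec M p v" using tangent_iff[OF pMW] by (simp add: jets(1) v)
    from char_tangent[OF pMW this] cval[OF this] show ?thesis
      by (simp add: jets(1) v holo_dd_Jc[OF hol p])
  qed
  \<comment> \<open>The constants combine to
    \<open>4 * cnj (- \<i> / 2) * (- \<i> / 2) = 1\<close>.\<close>
  show "Top (Lb \<alpha>) (thform c) (cnjv (Lb \<beta>)) p = gmat r s \<alpha> \<beta>"
    unfolding Top_cnjv[OF CRW CRW pMW] lam by (simp add: jets(2) val model2_axis mult.assoc)
  assume g: "r + s < pos \<gamma>"
  have null: "model2 r s u (fst (dd [fst (Lb \<gamma>) p] \<Phi> p)) = 0" for u
    by (simp add: val model2_axis_null[OF g])
  have "Top (Lb \<alpha>) (Top (Lb \<beta>) (thform c)) (cnjv (Lb \<gamma>)) p =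
     lev3 (\<lambda>u v w. dd [u, v, w] \<rho> p) (fst (Lb \<alpha>) p) (fst (Lb \<beta>) p) (fst (Lb \<gamma>) p) / (2 * \<i>)"
    by (subst Top_Top_cnjv[OF CRW CRW CRW pMW]) (simp_all add: lam jets(2) val model2_axis_null[OF g])
  \<comment> \<open>Here the constants are
    \<open>16 * (cnj (- \<i> / 2))\<^sup>2 * (- \<i> / 2) = 2 * \<i>\<close>, cancelled by the
    denominator.\<close>
  also have "\<dots> = h \<alpha> \<beta> \<gamma>"
    by (subst jets(3)[OF sym]) (simp_all add: val model2_axis_null[OF g] model3_axis[OF g] field_simps)
  finally show "Top (Lb \<alpha>) (Top (Lb \<beta>) (thform c)) (cnjv (Lb \<gamma>)) p = h \<alpha> \<beta> \<gamma>" .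
qed

text \<open>A vector \<open>v + \<i> J v\<close> of type (0,1) depends antilinearly on
  \<open>v\<close>; hence the conjugate coefficients on the real parts.\<close>

lemma sum_cscal:
  "(\<Sum>\<alpha>\<in>UNIV. cscal (c \<alpha>) (v \<alpha>, Jc (v \<alpha>))) =
     (\<Sum>\<alpha>\<in>UNIV. cs (cnj (c \<alpha>)) (v \<alpha>), Jc (\<Sum>\<alpha>\<in>UNIV. cs (cnj (c \<alpha>)) (v \<alpha>)))"
  for v :: "'i::finite \<Rightarrow> 'n::finite amb"
proof -
  have "cscal d (v, Jc v) = (cs (cnj d) v, Jc (cs (cnj d) v))" for d and v :: "'n amb"
    by (simp add: cscal_def cs_eq_Jc Jc_simps)
  then have "(\<Sum>\<alpha>\<in>UNIV. cscal (c \<alpha>) (v \<alpha>, Jc (v \<alpha>))) =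
      (\<Sum>\<alpha>\<in>UNIV. cs (cnj (c \<alpha>)) (v \<alpha>), \<Sum>\<alpha>\<in>UNIV. Jc (cs (cnj (c \<alpha>)) (v \<alpha>)))"
    by (simp add: sum_prod)
  also have "(\<Sum>\<alpha>\<in>UNIV. Jc (cs (cnj (c \<alpha>)) (v \<alpha>))) = Jc (\<Sum>\<alpha>\<in>UNIV. cs (cnj (c \<alpha>)) (v \<alpha>))"
    by (rule linear_sum[symmetric]) (rule bounded_linear.linear[OF bounded_linear_Jc])
  finally show ?thesis .
qed

text \<open>The constant vectors \<open>a \<alpha>\<close> are projected to the complex tangent
  spaces by removing their components along \<open>n\<close> and \<open>Jc n\<close>, which are
  orthogonal and of equal length. With \<open>n\<close> as a further column they form the linear map
  \<open>S x\<close>. It is invertible at \<open>p\<close>, hence nearby, and its bijectivity gives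
  independence and spanning of the frame at once.\<close>

lemma CR_frame_exists:
  fixes a :: "'n::finite \<Rightarrow> 'n amb"
  assumes hyp: "hypersurface_nbhd M W \<rho>" and p: "p \<in> M \<inter> W"
    and tan: "\<And>\<alpha>. dd [a \<alpha>] \<rho> p = 0" "\<And>\<alpha>. dd [Jc (a \<alpha>)] \<rho> p = 0"
    and indep: "\<And>c. (\<Sum>\<alpha>\<in>UNIV. cs (c \<alpha>) (a \<alpha>)) = 0 \<Longrightarrow> \<forall>\<alpha>. c \<alpha> = 0"
  obtains V Lb where "open V" "p \<in> V" "V \<subseteq> W" "CR_basis M V Lb" "\<And>\<alpha>. fst (Lb \<alpha>) p = a \<alpha>"
    "char_form M V (\<lambda>x. - Jc (grad \<rho> x))"
proof -
  interpret hypersurface_nbhd M W \<rho> by fact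
  have pW: "p \<in> W" using p by blast
  define n where "n = grad \<rho>"
  have g: "dd [v] \<rho> x = n x \<bullet> v" if "x \<in> W" for x v
    using grad_inner[OF smooth that] by (simp add: n_def)
  have nz: "n x \<noteq> 0" if "x \<in> W" for x
    using nondeg[OF that] g[OF that] by force
  have sn: "cinf_on W n" unfolding n_def by (rule cinf_on_grad[OF smooth])
  define A where "A \<alpha> x = a \<alpha> - ((a \<alpha> \<bullet> n x) / (n x \<bullet> n x)) *\<^sub>R n x - ((a \<alpha> \<bullet> Jc (n x)) / (n x \<bullet> n x)) *\<^sub>R Jc (n x)" for \<alpha> x
  have sA: "cinf_on W (A \<alpha>)" for \<alpha>
    unfolding A_def[abs_def]
    by (intro cinf_on_diff cinf_on_scaleR cinf_on_divide cinf_on_inner cinf_on_const open_U sn cinf_on_Jc) (use nz in auto)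
  have tA: "n x \<bullet> A \<alpha> x = 0" "n x \<bullet> Jc (A \<alpha> x) = 0" if "x \<in> W" for \<alpha> x
    using nz[OF that]
    by (simp_all add: A_def inner_diff_right Jc_simps inner_Jc_self inner_commute[of "a \<alpha>"] inner_Jc_left inner_add_right)
  have Ap: "A \<alpha> p = a \<alpha>" for \<alpha>
    using tan[of \<alpha>] g[OF pW] inner_Jc_left[of "n p" "a \<alpha>"] by (simp add: A_def inner_commute)
  define S where "S x Z = (\<Sum>\<alpha>\<in>UNIV. cs (fst Z $ \<alpha>) (A \<alpha> x)) + cs (snd Z) (n x)" for x Z
  have linS: "linear (S x)" for x
    by (rule linearI) (simp_all add: S_def cs_simps sum.distrib scaleR_add_right scaleR_sum_right cs_eq_Jc algebra_simps)
  \<comment> \<open>A value of \<open>S x\<close> in the complex tangent space has no component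
    along \<open>n\<close>; so it is a combination of the frame alone.\<close>
  have Sn: "snd Z = 0" if x: "x \<in> W" and z: "n x \<bullet> S x Z = 0" "n x \<bullet> Jc (S x Z) = 0" for x Z
  proof -
    have 1: "n x \<bullet> cs c (A \<alpha> x) = 0" "n x \<bullet> Jc (cs c (A \<alpha> x)) = 0" for c \<alpha>
      using tA[OF x, of \<alpha>] by (simp_all add: cs_eq_Jc inner_add_right inner_diff_right Jc_simps)
    have J: "Jc (\<Sum>\<alpha>\<in>UNIV. cs (fst Z $ \<alpha>) (A \<alpha> x)) = (\<Sum>\<alpha>\<in>UNIV. Jc (cs (fst Z $ \<alpha>) (A \<alpha> x)))"
      by (rule linear_sum) (rule bounded_linear.linear[OF bounded_linear_Jc])
    have "n x \<bullet> cs (snd Z) (n x) = 0" "n x \<bullet> Jc (cs (snd Z) (n x)) = 0"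
      using z by (simp_all add: S_def inner_add_right inner_sum_right 1 Jc_simps(1) J)
    then show ?thesis
      using nz[OF x] by (simp add: cs_eq_Jc inner_add_right Jc_simps inner_Jc_self complex_eq_iff)
  qed
  have injp: "inj (S p)"
    unfolding linear_injective_0[OF linS]
  proof (intro allI impI)
    fix Z assume Z: "S p Z = 0"
    then have s: "snd Z = 0" using Sn[OF pW, of Z] by (simp add: Jc_simps)
    then have "\<forall>\<alpha>. fst Z $ \<alpha> = 0" using indep[of "\<lambda>\<alpha>. fst Z $ \<alpha>"] Z by (simp add: S_def Ap cs_simps)
    then show "Z = 0" using s by (simp add: amb_eq_iff)
  qed
  obtain B where B: "B > 0" "\<And>Z. B * norm Z \<le> norm (S p Z)"
    using linear_inj_bounded_below_pos[OF linS injp] by blast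
  \<comment> \<open>The difference of \<open>S x Z\<close> and \<open>S p Z\<close> is at most
    \<open>\<epsilon> x * norm Z\<close>, so \<open>\<epsilon> x < B\<close> keeps
    \<open>S x\<close> injective.\<close>
  define \<epsilon> where "\<epsilon> x = (\<Sum>\<alpha>\<in>UNIV. norm (A \<alpha> x - A \<alpha> p)) + norm (n x - n p)" for x
  have ce: "continuous_on W \<epsilon>"
    unfolding \<epsilon>_def[abs_def] by (intro continuous_intros cinf_on_continuous[OF sA] cinf_on_continuous[OF sn])
  define V where "V = \<epsilon> -` {..<B} \<inter> W"
  have oV: "open V" unfolding V_def using continuous_on_open_vimage[OF open_U] ce open_lessThan by blast
  have pV: "p \<in> V" using pW B(1) by (simp add: V_def \<epsilon>_def)
  have VW: "V \<subseteq> W" by (auto simp: V_def)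
  have injV: "inj (S x)" if x: "x \<in> V" for x
    unfolding linear_injective_0[OF linS]
  proof (intro allI impI)
    fix Z assume Z: "S x Z = 0"
    have "S p Z = - (S x Z - S p Z)" using Z by simp
    also have "S x Z - S p Z = (\<Sum>\<alpha>\<in>UNIV. cs (fst Z $ \<alpha>) (A \<alpha> x - A \<alpha> p)) + cs (snd Z) (n x - n p)"
      by (simp add: S_def cs_simps sum_subtractf)
    finally have eq: "S p Z = - ((\<Sum>\<alpha>\<in>UNIV. cs (fst Z $ \<alpha>) (A \<alpha> x - A \<alpha> p)) + cs (snd Z) (n x - n p))" .
    have "norm (S p Z) \<le> (\<Sum>\<alpha>\<in>UNIV. norm (cs (fst Z $ \<alpha>) (A \<alpha> x - A \<alpha> p))) + norm (cs (snd Z) (n x - n p))"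
      unfolding eq norm_minus_cancel by (intro order_trans[OF norm_triangle_ineq] add_mono norm_sum order_refl)
    also have "\<dots> \<le> (\<Sum>\<alpha>\<in>UNIV. norm Z * norm (A \<alpha> x - A \<alpha> p)) + norm Z * norm (n x - n p)"
    proof -
      have nZ: "norm (fst Z) \<le> norm Z" "norm (snd Z) \<le> norm Z"
      using norm_fst_le[of "fst Z" "snd Z"] norm_snd_le[of "snd Z" "fst Z"] by simp_all
      show ?thesis
        unfolding norm_cs
        by (intro add_mono sum_mono mult_right_mono norm_ge_zero order_trans[OF Finite_Cartesian_Product.norm_nth_le] nZ)
    qed
    also have "\<dots> = norm Z * \<epsilon> x" by (simp add: \<epsilon>_def sum_distrib_left distrib_left)
    finally have "norm Z * B \<le> norm Z * \<epsilon> x" using B(2)[of Z] by (simp add: mult.commute)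
    moreover have "\<epsilon> x < B" using x by (simp add: V_def)
    ultimately have "\<not> norm Z > 0" by (metis mult_le_cancel_left_pos not_le)
    then show "Z = 0" by simp
  qed
  define Lb where "Lb \<alpha> = (A \<alpha>, \<lambda>x. Jc (A \<alpha> x))" for \<alpha>
  have tg: "tangent_vec M x v \<longleftrightarrow> n x \<bullet> v = 0" if "x \<in> M \<inter> V" for x v
  proof -
    have "x \<in> M \<inter> W" "x \<in> W" using that VW by auto
    then show ?thesis using tangent_iff[of x v] g[of x v] by simp
  qed
  have sumc: "(\<Sum>\<alpha>\<in>UNIV. cscal (c \<alpha>) (fst (Lb \<alpha>) x, snd (Lb \<alpha>) x)) = (S x (\<chi> \<alpha>. cnj (c \<alpha>), 0), Jc (S x (\<chi> \<alpha>. cnj (c \<alpha>), 0)))"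
    for c :: "'n \<Rightarrow> complex" and x
    using sum_cscal[of c "\<lambda>\<alpha>. A \<alpha> x"] by (simp add: Lb_def S_def cs_simps)
  show ?thesis
  proof
    show "open V" "p \<in> V" "V \<subseteq> W" by fact+
    show "fst (Lb \<alpha>) p = a \<alpha>" for \<alpha> by (simp add: Lb_def Ap)
    have sub: "cinf_on W f \<Longrightarrow> cinf_on V f" for f :: "'n amb \<Rightarrow> 'n amb" by (rule cinf_on_subset[OF _ oV VW])
    show "CR_basis M V Lb"
      unfolding CR_basis_def
    proof (intro conjI allI ballI impI)
      fix \<alpha>
      show "CR_field M V (Lb \<alpha>)"
        unfolding CR_field_def Lb_def using tA VW by (auto simp: tg intro!: sub sA cinf_on_Jc)
    next
      fix x c \<alpha> assume x: "x \<in> M \<inter> V" and "(\<Sum>\<alpha>\<in>UNIV. cscal (c \<alpha>) (fst (Lb \<alpha>) x, snd (Lb \<alpha>) x)) = (0, 0)"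
      then have "S x (\<chi> \<alpha>. cnj (c \<alpha>), 0) = S x 0"
        unfolding sumc linear_0[OF linS] by simp
      moreover have "x \<in> V" using x by blast
      ultimately have "((\<chi> \<alpha>. cnj (c \<alpha>)), 0 :: complex) = 0"
        using injD[OF injV] by metis
      then show "c \<alpha> = 0" by (simp add: amb_eq_iff)
    next
      fix x b assume x: "x \<in> M \<inter> V" and b: "tangent_vec M x b \<and> tangent_vec M x (Jc b)"
      have xV: "x \<in> V" "x \<in> W" using x VW by auto
      have "surj (S x)" using linear_injective_imp_surjective[OF linS injV[OF xV(1)]] by simp
      then obtain Z where Z: "b = S x Z" by blast
      have "snd Z = 0" using Sn[OF xV(2), of Z] b by (simp add: tg[OF x] Z)
      then have "((\<chi> \<alpha>. cnj (cnj (fst Z $ \<alpha>))), 0) = Z" by (simp add: amb_eq_iff)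
      then have "(\<Sum>\<alpha>\<in>UNIV. cscal (cnj (fst Z $ \<alpha>)) (fst (Lb \<alpha>) x, snd (Lb \<alpha>) x)) = (b, Jc b)"
        unfolding sumc Z by (simp only:)
      then show "\<exists>c. (\<Sum>\<alpha>\<in>UNIV. cscal (c \<alpha>) (fst (Lb \<alpha>) x, snd (Lb \<alpha>) x)) = (b, Jc b)"
        by (rule exI[of _ "\<lambda>\<alpha>. cnj (fst Z $ \<alpha>)"])
    qed
    show "char_form M V (\<lambda>x. - Jc (grad \<rho> x))"
      unfolding char_form_def n_def[symmetric]
    proof (intro conjI ballI)
      show "cinf_on V (\<lambda>x. - Jc (n x))" by (intro sub cinf_on_minus cinf_on_Jc sn)
      fix x assume x: "x \<in> M \<inter> V"
      show "\<forall>v. tangent_vec M x v \<and> tangent_vec M x (Jc v) \<longrightarrow> - Jc (n x) \<bullet> v = 0"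
        by (simp add: tg[OF x] inner_Jc_left)
      show "\<exists>v. tangent_vec M x v \<and> - Jc (n x) \<bullet> v \<noteq> 0"
      proof -
        have "x \<in> W" using x VW by auto
        then show ?thesis
          using nz[of x] by (intro exI[of _ "Jc (n x)"]) (simp add: tg[OF x] inner_Jc_self inner_Jc_Jc)
      qed
    qed
  qed
qed

text \<open>The tensors depend on the frame through its values at \<open>p\<close>, so it is enough
  to prescribe these: the preimages of \<open>- \<i> / 2\<close> times the coordinate vectors. The
  form is \<open>d\<rho>\<close> composed with \<open>J\<close>, whose value at \<open>p\<close> is
  \<open>- Re (snd (dd [v] \<Phi> p))\<close>.\<close>

lemma normal_form_imp_frame:
  fixes p :: "('n::{finite,linorder}) amb"
  assumes hc: "hol_coords U \<Phi>" and p: "p \<in> U" and \<Phi>p: "\<Phi> p = 0" and wv: "weighted_vanish4 R"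
    and U': "open U'" "p \<in> U'" "U' \<subseteq> U" and M: "M \<inter> U' = {x \<in> U'. rho_model r s h R (\<Phi> x) = 0}"
    and pM: "p \<in> M" and sym: "\<forall>\<alpha> \<beta> \<gamma>. r + s < pos \<gamma> \<longrightarrow> h \<alpha> \<beta> \<gamma> = h \<beta> \<alpha> \<gamma>"
  shows "\<exists>U Lb c. open U \<and> p \<in> U \<and> CR_basis M U Lb \<and> char_form M U c \<and>
            (\<forall>\<alpha> \<beta>. Top (Lb \<alpha>) (thform c) (cnjv (Lb \<beta>)) p = gmat r s \<alpha> \<beta>) \<and>
            (\<forall>\<alpha> \<beta> \<gamma>. r + s < pos \<gamma> \<longrightarrow>
               Top (Lb \<alpha>) (Top (Lb \<beta>) (thform c)) (cnjv (Lb \<gamma>)) p = h \<alpha> \<beta> \<gamma>)"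
proof -
  define \<rho> where "\<rho> = (\<lambda>x. rho_model r s h R (\<Phi> x))"
  have hol: "holo_on U \<Phi>" using hc by (simp add: hol_coords_def)
  note jets = rho_model_compose_jets[OF hol p \<Phi>p wv \<rho>_def]
  obtain W where W: "p \<in> W" "W \<subseteq> U'" "hypersurface_nbhd M W \<rho>"
    by (rule rho_model_nbhd[OF hc p \<Phi>p wv U' M \<rho>_def])
  interpret hypersurface_nbhd M W \<rho> by (rule W(3))
  note lin = linear_dd[OF cinf_on_holo[OF hol] p]
  have "\<forall>\<alpha>. \<exists>v. dd [v] \<Phi> p = (axis \<alpha> (- \<i> / 2), 0)"
    using hol_coords_dd_surj[OF hc p] by metis
  then obtain a where a: "\<And>\<alpha>. dd [a \<alpha>] \<Phi> p = (axis \<alpha> (- \<i> / 2), 0)" by metis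
  have tan: "dd [a \<alpha>] \<rho> p = 0" "dd [Jc (a \<alpha>)] \<rho> p = 0" for \<alpha>
    by (simp_all add: jets(1) holo_dd_Jc[OF hol p] a)
  have indep: "\<forall>\<alpha>. c \<alpha> = 0" if "(\<Sum>\<alpha>\<in>UNIV. cs (c \<alpha>) (a \<alpha>)) = 0" for c
  proof
    fix \<beta>
    have "0 = dd [\<Sum>\<alpha>\<in>UNIV. cs (c \<alpha>) (a \<alpha>)] \<Phi> p" using that linear_0[OF lin] by simp
    also have "\<dots> = (\<Sum>\<alpha>\<in>UNIV. cs (c \<alpha>) (axis \<alpha> (- \<i> / 2), 0))"
      unfolding linear_sum[OF lin] linear_Jc_commute_cs[OF lin holo_dd_Jc[OF hol p]] a ..
    finally have "fst (\<Sum>\<alpha>\<in>UNIV. cs (c \<alpha>) (axis \<alpha> (- \<i> / 2), 0 :: complex)) $ \<beta> = 0" by (metis fst_zero zero_index)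
    then show "c \<beta> = 0"
      by (simp add: fst_sum axis_def if_distrib[of "(*) _"] cong: if_cong)
  qed
  obtain V Lb where V: "open V" "p \<in> V" "V \<subseteq> W" "CR_basis M V Lb" "\<And>\<alpha>. fst (Lb \<alpha>) p = a \<alpha>"
    "char_form M V (\<lambda>x. - Jc (grad \<rho> x))"
    using CR_frame_exists[OF W(3), of p a] pM W(1) tan indep by blast
  have CR: "CR_field M V (Lb \<alpha>)" for \<alpha> using V(4) by (simp add: CR_basis_def)
  have cval: "- Jc (grad \<rho> p) \<bullet> v = - Re (snd (dd [v] \<Phi> p))" for v
    using grad_inner[OF smooth W(1), of "Jc v"] by (simp add: inner_Jc_left jets(1) holo_dd_Jc[OF hol p])
  note T = normal_form_tensors[OF hc p \<Phi>p wv U' M V(1,2) pM CR V(6) _ cval sym]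
  have val: "dd [fst (Lb \<alpha>) p] \<Phi> p = (axis \<alpha> (- \<i> / 2), 0)" for \<alpha> by (simp add: V(5) a)
  show ?thesis
    using V(1,2,4,6) T(1)[OF val] T(2)[OF val] by blast
qed

subsection \<open>Weighted orders\<close>

text \<open>This is \<open>f t = O (t ^ k)\<close> for \<open>t\<close> decreasing to zero. Weighted
  order is tested along curves \<open>(t z, t^2 u)\<close>, which reduces all estimates to one real
  variable.\<close>

definition order_ge :: "nat \<Rightarrow> (real \<Rightarrow> 'a::real_normed_vector) \<Rightarrow> bool" where
  "order_ge k f \<longleftrightarrow> (\<exists>C d. d > 0 \<and> (\<forall>t. 0 < t \<and> t < d \<longrightarrow> norm (f t) \<le> C * t ^ k))"

lemma order_geE:
  assumes "order_ge k f"
  obtains C d where "C \<ge> 0" "d > 0" "d \<le> 1" "\<And>t. 0 < t \<Longrightarrow> t < d \<Longrightarrow> norm (f t) \<le> C * t ^ k"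
proof -
  obtain C d where Cd: "d > 0" "\<And>t. 0 < t \<Longrightarrow> t < d \<Longrightarrow> norm (f t) \<le> C * t ^ k"
    using assms unfolding order_ge_def by blast
  show ?thesis
  proof (rule that[of "\<bar>C\<bar>" "min d 1"])
    fix t :: real assume t: "0 < t" "t < min d 1"
    have "norm (f t) \<le> C * t ^ k" using Cd t by simp
    also have "\<dots> \<le> \<bar>C\<bar> * t ^ k" using t by (intro mult_right_mono) auto
    finally show "norm (f t) \<le> \<bar>C\<bar> * t ^ k" .
  qed (use Cd in auto)
qed

lemma order_ge_bound:
  assumes "order_ge k f" "d > 0" "\<And>t. 0 < t \<Longrightarrow> t < d \<Longrightarrow> norm (g t) \<le> K * norm (f t)"
  shows "order_ge k g"
proof -
  obtain C e where C: "C \<ge> 0" "e > 0" "e \<le> 1" "\<And>t. 0 < t \<Longrightarrow> t < e \<Longrightarrow> norm (f t) \<le> C * t ^ k"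
    using order_geE[OF assms(1)] by metis
  have "norm (g t) \<le> (\<bar>K\<bar> * C) * t ^ k" if t: "0 < t" "t < min d e" for t
  proof -
    have "norm (g t) \<le> K * norm (f t)" using assms(3) t by simp
    also have "\<dots> \<le> \<bar>K\<bar> * norm (f t)" by (intro mult_right_mono) auto
    also have "\<dots> \<le> \<bar>K\<bar> * (C * t ^ k)" using C t by (intro mult_left_mono) auto
    finally show ?thesis by (simp add: mult.assoc)
  qed
  then show ?thesis unfolding order_ge_def using assms(2) C(2) by (intro exI[of _ "\<bar>K\<bar> * C"] exI[of _ "min d e"]) auto
qed

lemma order_ge_bilinear:
  assumes B: "bounded_bilinear B" and f: "order_ge j f" and g: "order_ge k g"
  shows "order_ge (j + k) (\<lambda>t. B (f t) (g t))"
proof -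
  obtain K where K: "K > 0" "\<And>a b. norm (B a b) \<le> norm a * norm b * K"
    using bounded_bilinear.pos_bounded[OF B] by blast
  obtain C d where C: "C \<ge> 0" "d > 0" "d \<le> 1" "\<And>t. 0 < t \<Longrightarrow> t < d \<Longrightarrow> norm (f t) \<le> C * t ^ j"
    using order_geE[OF f] by metis
  obtain D e where D: "D \<ge> 0" "e > 0" "e \<le> 1" "\<And>t. 0 < t \<Longrightarrow> t < e \<Longrightarrow> norm (g t) \<le> D * t ^ k"
    using order_geE[OF g] by metis
  have "norm (B (f t) (g t)) \<le> (C * D * K) * t ^ (j + k)" if t: "0 < t" "t < min d e" for t
  proof -
    have "norm (B (f t) (g t)) \<le> norm (f t) * norm (g t) * K" by (rule K)
    also have "\<dots> \<le> (C * t ^ j) * (D * t ^ k) * K"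
      using C D K t by (intro mult_right_mono mult_mono) auto
    finally show ?thesis by (simp add: power_add mult_ac)
  qed
  then show ?thesis unfolding order_ge_def using C(2) D(2) by (intro exI[of _ "C * D * K"] exI[of _ "min d e"]) auto
qed

lemma order_ge_add:
  assumes f: "order_ge k f" and g: "order_ge k g"
  shows "order_ge k (\<lambda>t. f t + g t)"
proof -
  obtain C d where C: "C \<ge> 0" "d > 0" "d \<le> 1" "\<And>t. 0 < t \<Longrightarrow> t < d \<Longrightarrow> norm (f t) \<le> C * t ^ k"
    using order_geE[OF f] by metis
  obtain D e where D: "D \<ge> 0" "e > 0" "e \<le> 1" "\<And>t. 0 < t \<Longrightarrow> t < e \<Longrightarrow> norm (g t) \<le> D * t ^ k"
    using order_geE[OF g] by metis
  have "norm (f t + g t) \<le> (C + D) * t ^ k" if t: "0 < t" "t < min d e" for t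
    using norm_triangle_ineq[of "f t" "g t"] C(4)[of t] D(4)[of t] t by (simp add: distrib_right)
  then show ?thesis unfolding order_ge_def using C(2) D(2) by (intro exI[of _ "C + D"] exI[of _ "min d e"]) auto
qed

lemma order_ge_linear:
  assumes l: "bounded_linear l" and f: "order_ge k f"
  shows "order_ge k (\<lambda>t. l (f t))"
proof -
  obtain K where K: "\<And>x. norm (l x) \<le> norm x * K"
    using bounded_linear.bounded[OF l] by blast
  show ?thesis by (rule order_ge_bound[OF f, of 1 _ K]) (use K in \<open>auto simp: mult.commute\<close>)
qed

lemma order_ge_minus: "order_ge k f \<Longrightarrow> order_ge k (\<lambda>t. - f t)"
  by (rule order_ge_linear[OF bounded_linear_minus[OF bounded_linear_ident]])

lemma order_ge_diff: "order_ge k f \<Longrightarrow> order_ge k g \<Longrightarrow> order_ge k (\<lambda>t. f t - g t)"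
  using order_ge_add[OF _ order_ge_minus] by force

lemma order_ge_mono:
  assumes "order_ge k f" "j \<le> k"
  shows "order_ge j f"
proof -
  obtain C d where C: "C \<ge> 0" "d > 0" "d \<le> 1" "\<And>t. 0 < t \<Longrightarrow> t < d \<Longrightarrow> norm (f t) \<le> C * t ^ k"
    using order_geE[OF assms(1)] by metis
  have "norm (f t) \<le> C * t ^ j" if t: "0 < t" "t < d" for t
  proof -
    have "t ^ k \<le> t ^ j" using assms(2) t C by (intro power_decreasing) auto
    then show ?thesis using C(4)[OF t] C(1) by (meson mult_left_mono order_trans)
  qed
  then show ?thesis unfolding order_ge_def using C(2) by blast
qed

lemma order_ge_cong:
  assumes "order_ge k f" "d > 0" "\<And>t. 0 < t \<Longrightarrow> t < d \<Longrightarrow> f t = g t"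
  shows "order_ge k g"
  by (rule order_ge_bound[OF assms(1,2), of _ 1]) (use assms(3) in auto)

lemma order_ge_power: "order_ge k (\<lambda>t. t ^ k *\<^sub>R v)"
  unfolding order_ge_def by (intro exI[of _ "norm v"] exI[of _ 1]) (auto simp: mult.commute)

lemma order_ge_Pair: "order_ge k f \<Longrightarrow> order_ge k g \<Longrightarrow> order_ge k (\<lambda>t. (f t, g t))"
proof -
  assume f: "order_ge k f" and g: "order_ge k g"
  have "order_ge k (\<lambda>t. (f t, 0) + (0, g t))"
    by (intro order_ge_add order_ge_linear[OF _ f] order_ge_linear[OF _ g]
        bounded_linear_Pair bounded_linear_ident bounded_linear_zero)
  then show ?thesis by simp
qed

text \<open>It carries order one through the graph function and the inverse coordinates, neither of
  which is known explicitly.\<close>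

lemma order_ge_differentiable:
  assumes f: "(f has_derivative f') (at 0)" and f0: "f 0 = 0" and v: "order_ge 1 v"
  shows "order_ge 1 (\<lambda>t. f (v t))"
proof -
  obtain K where K: "\<And>x. norm (f' x) \<le> norm x * K"
    using bounded_linear.bounded[OF has_derivative_bounded_linear[OF f]] by blast
  obtain d where d: "d > 0" "\<And>y. norm y < d \<Longrightarrow> norm (f y - f' y) \<le> norm y"
    using f f0 unfolding has_derivative_at_alt by (metis diff_zero mult_1 zero_less_one)
  obtain C e where C: "C \<ge> 0" "e > 0" "e \<le> 1" "\<And>t. 0 < t \<Longrightarrow> t < e \<Longrightarrow> norm (v t) \<le> C * t ^ 1"
    using order_geE[OF v] by metis
  show ?thesis
  proof (rule order_ge_bound[OF v])
    show "min e (d / (C + 1)) > 0" using C d by simp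
    fix t assume t: "0 < t" "t < min e (d / (C + 1))"
    have "norm (v t) \<le> C * t" using C(4)[of t] t by simp
    also have "\<dots> \<le> (C + 1) * t" using t by simp
    also have "\<dots> < d" using t C by (simp add: pos_less_divide_eq mult.commute)
    finally have "norm (f (v t) - f' (v t)) \<le> norm (v t)" by (rule d(2))
    moreover have "norm (f (v t)) \<le> norm (f (v t) - f' (v t)) + norm (f' (v t))"
      using norm_triangle_ineq[of "f (v t) - f' (v t)" "f' (v t)"] by simp
    ultimately show "norm (f (v t)) \<le> (1 + K) * norm (v t)"
      using K[of "v t"] by (simp add: distrib_right mult.commute)
  qed
qed

lemma order_ge_Taylor3:
  fixes f :: "'a::euclidean_space \<Rightarrow> real"
  assumes f: "cinf_on U f" "0 \<in> U" and v: "order_ge 1 v"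
  shows "order_ge 4 (\<lambda>t. f (v t) - (f 0 + dd [v t] f 0 + dd [v t, v t] f 0 / 2 + dd [v t, v t, v t] f 0 / 6))"
proof -
  obtain K d where K: "d > 0" "\<And>w. norm w < d \<Longrightarrow>
    \<bar>f (0 + w) - (f 0 + dd [w] f 0 + dd [w, w] f 0 / 2 + dd [w, w, w] f 0 / 6)\<bar> \<le> K * norm w ^ 4"
    using Taylor_order3[OF f] by blast
  obtain C e where C: "C \<ge> 0" "e > 0" "e \<le> 1" "\<And>t. 0 < t \<Longrightarrow> t < e \<Longrightarrow> norm (v t) \<le> C * t ^ 1"
    using order_geE[OF v] by metis
  have "norm (f (v t) - (f 0 + dd [v t] f 0 + dd [v t, v t] f 0 / 2 + dd [v t, v t, v t] f 0 / 6)) \<le> (\<bar>K\<bar> * C ^ 4) * t ^ 4"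
    if t: "0 < t" "t < min e (d / (C + 1))" for t
  proof -
    have le: "norm (v t) \<le> C * t" using C(4)[of t] t by simp
    also have "\<dots> \<le> (C + 1) * t" using t by simp
    also have "\<dots> < d" using t C by (simp add: pos_less_divide_eq mult.commute)
    finally have "norm (f (v t) - (f 0 + dd [v t] f 0 + dd [v t, v t] f 0 / 2 + dd [v t, v t, v t] f 0 / 6)) \<le> K * norm (v t) ^ 4"
      using K(2)[of "v t"] by simp
    also have "\<dots> \<le> \<bar>K\<bar> * (C * t) ^ 4"
      using le by (intro mult_mono power_mono) auto
    finally show ?thesis by (simp add: power_mult_distrib mult_ac)
  qed
  moreover have "min e (d / (C + 1)) > 0" using C K by simp
  ultimately show ?thesis unfolding order_ge_def by blast
qed

lemma le_zero_if_le_small: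
  fixes x K :: real
  assumes "d > 0" "\<And>t. 0 < t \<Longrightarrow> t < d \<Longrightarrow> x \<le> K * t"
  shows "x \<le> 0"
proof (rule ccontr)
  assume "\<not> x \<le> 0"
  then have x: "x > 0" by simp
  define t where "t = min (d / 2) (x / (2 * (\<bar>K\<bar> + 1)))"
  have t: "0 < t" "t < d" using assms(1) x by (auto simp: t_def)
  have "x \<le> K * t" by (rule assms(2)[OF t])
  also have "\<dots> \<le> (\<bar>K\<bar> + 1) * t" using t by (intro mult_right_mono) auto
  also have "\<dots> \<le> (\<bar>K\<bar> + 1) * (x / (2 * (\<bar>K\<bar> + 1)))" by (intro mult_left_mono) (auto simp: t_def)
  also have "\<dots> = x / 2" by (simp add: field_simps)
  finally show False using x by simp
qed

lemma order_ge_leading_coeff: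
  fixes c :: real
  assumes "order_ge (Suc k) (\<lambda>t. t ^ k * c)"
  shows "c = 0"
proof -
  obtain C d where C: "d > 0" "\<And>t. 0 < t \<Longrightarrow> t < d \<Longrightarrow> norm (t ^ k * c) \<le> C * t ^ Suc k"
    using assms unfolding order_ge_def by blast
  have "\<bar>c\<bar> \<le> 0"
  proof (rule le_zero_if_le_small[OF C(1)])
    fix t assume t: "0 < t" "t < d"
    have "t ^ k * \<bar>c\<bar> \<le> t ^ k * (C * t)" using C(2)[OF t] t by (simp add: abs_mult mult_ac)
    then show "\<bar>c\<bar> \<le> C * t" using t by simp
  qed
  then show ?thesis by simp
qed

lemma cubic_order_ge_4:
  fixes c0 c1 c2 c3 :: real
  assumes "order_ge 4 (\<lambda>t. c0 + t * c1 + t\<^sup>2 * c2 + t ^ 3 * c3)"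
  shows "c0 = 0" "c1 = 0" "c2 = 0" "c3 = 0"
proof -
  have p: "order_ge k (\<lambda>t. t ^ k * c)" for k and c :: real
    using order_ge_power[of k c] by simp
  note m = order_ge_mono[OF p]
  have "order_ge 1 (\<lambda>t. (c0 + t * c1 + t\<^sup>2 * c2 + t ^ 3 * c3) - (t ^ 1 * c1 + (t\<^sup>2 * c2 + t ^ 3 * c3)))"
    by (intro order_ge_diff order_ge_add order_ge_mono[OF assms] m) auto
  then show c0: "c0 = 0" using order_ge_leading_coeff[of 0 c0] by (simp add: algebra_simps)
  have "order_ge 2 (\<lambda>t. (c0 + t * c1 + t\<^sup>2 * c2 + t ^ 3 * c3) - (t\<^sup>2 * c2 + t ^ 3 * c3))"
    by (intro order_ge_diff order_ge_add order_ge_mono[OF assms] m) auto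
  then show c1: "c1 = 0" using order_ge_leading_coeff[of 1 c1] c0 by (simp add: algebra_simps numeral_2_eq_2)
  have "order_ge 3 (\<lambda>t. (c0 + t * c1 + t\<^sup>2 * c2 + t ^ 3 * c3) - t ^ 3 * c3)"
    by (intro order_ge_diff order_ge_mono[OF assms] m) auto
  then show c2: "c2 = 0" using order_ge_leading_coeff[of 2 c2] c0 c1 by (simp add: algebra_simps numeral_3_eq_3)
  show "c3 = 0" using order_ge_leading_coeff[of 3 c3] assms c0 c1 c2 by simp
qed

text \<open>Along \<open>(t z, t^2 u)\<close> the coefficient of \<open>t ^ j\<close> with
  \<open>j < 4\<close> collects the derivatives of weight \<open>j\<close>, so these coefficients
  vanish for all \<open>z\<close> and \<open>u\<close>. Setting \<open>z\<close> or \<open>u\<close>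
  to zero separates the summands, and polarization passes from equal directions to arbitrary ones. A
  list of four or more directions has weight at least four.\<close>

lemma weighted_vanish4I:
  fixes R :: "(complex ^ 'n::finite) \<times> real \<Rightarrow> real"
  assumes R: "cinf_on W R" and W0: "0 \<in> W"
    and order: "\<And>z u. order_ge 4 (\<lambda>t. R (t *\<^sub>R z, t\<^sup>2 * u))"
  shows "weighted_vanish4 R"
proof -
  note l1 = linear_add[OF linear_dd[OF R W0]] linear_scale[OF linear_dd[OF R W0]]
  note l2 = linear_add[OF linear_dd2(1)[OF R W0]] linear_scale[OF linear_dd2(1)[OF R W0]]
    linear_add[OF linear_dd2(2)[OF R W0]] linear_scale[OF linear_dd2(2)[OF R W0]]
  note l3 = linear_add[OF linear_dd3(1)[OF R W0]] linear_scale[OF linear_dd3(1)[OF R W0]]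
    linear_add[OF linear_dd3(2)[OF R W0]] linear_scale[OF linear_dd3(2)[OF R W0]]
    linear_add[OF linear_dd3(3)[OF R W0]] linear_scale[OF linear_dd3(3)[OF R W0]]
  have jets: "R 0 = 0" "dd [(z, 0)] R 0 = 0" "dd [(0, u)] R 0 + dd [(z, 0), (z, 0)] R 0 / 2 = 0"
      "dd [(z, 0), (0, u)] R 0 + dd [(z, 0), (z, 0), (z, 0)] R 0 / 6 = 0" for z u
  proof -
    define a b where "a = (z, 0 :: real)" and "b = (0 :: complex ^ 'n, u)"
    define v where "v t = t ^ 1 *\<^sub>R a + t\<^sup>2 *\<^sub>R b" for t
    have v1: "order_ge 1 v"
      unfolding v_def[abs_def] by (intro order_ge_add order_ge_power order_ge_mono[OF order_ge_power]) auto
    have vt: "v t = (t *\<^sub>R z, t\<^sup>2 * u)" for t by (simp add: v_def a_def b_def)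
    have sw: "dd [b, a] R 0 = dd [a, b] R 0" by (rule dd_swap[OF R W0])
    have p: "order_ge 4 (\<lambda>t. t ^ 4 * c)" for c :: real using order_ge_power[of 4 c] by simp
    have p5: "order_ge 4 (\<lambda>t. t ^ 5 * c)" for c :: real using order_ge_mono[OF order_ge_power[of 5 c], of 4] by simp
    have p6: "order_ge 4 (\<lambda>t. t ^ 6 * c)" for c :: real using order_ge_mono[OF order_ge_power[of 6 c], of 4] by simp
    \<comment> \<open>The terms of the cubic Taylor polynomial that carry \<open>t ^ 4\<close> or a
      higher power because a direction \<open>b\<close> counts twice.\<close>
    define r4 r5 r6 where "r4 = dd [b, b] R 0 / 2 + (dd [a, a, b] R 0 + dd [a, b, a] R 0 + dd [b, a, a] R 0) / 6"
      and "r5 = (dd [a, b, b] R 0 + dd [b, a, b] R 0 + dd [b, b, a] R 0) / 6" and "r6 = dd [b, b, b] R 0 / 6"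
    have expand: "R 0 + t * dd [a] R 0 + t\<^sup>2 * (dd [b] R 0 + dd [a, a] R 0 / 2) + t ^ 3 * (dd [a, b] R 0 + dd [a, a, a] R 0 / 6) =
      R (t *\<^sub>R z, t\<^sup>2 * u) - (R (v t) - (R 0 + dd [v t] R 0 + dd [v t, v t] R 0 / 2 + dd [v t, v t, v t] R 0 / 6))
        - (t ^ 4 * r4 + (t ^ 5 * r5 + t ^ 6 * r6))" for t
    proof -
      have e1: "dd [v t] R 0 = t * dd [a] R 0 + t\<^sup>2 * dd [b] R 0"
        unfolding v_def by (simp add: l1)
      have e2: "dd [v t, v t] R 0 = t\<^sup>2 * dd [a, a] R 0 + 2 * t ^ 3 * dd [a, b] R 0 + t ^ 4 * dd [b, b] R 0"
        unfolding v_def by (simp add: l2 sw) (simp add: algebra_simps power2_eq_square power3_eq_cube power4_eq_xxxx)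
      have e3: "dd [v t, v t, v t] R 0 = t ^ 3 * dd [a, a, a] R 0 + t ^ 4 * (dd [a, a, b] R 0 + dd [a, b, a] R 0 + dd [b, a, a] R 0)
         + t ^ 5 * (dd [a, b, b] R 0 + dd [b, a, b] R 0 + dd [b, b, a] R 0) + t ^ 6 * dd [b, b, b] R 0"
        unfolding v_def by (simp add: l3) (simp add: algebra_simps eval_nat_numeral)
      show ?thesis unfolding e1 e2 e3 vt[symmetric] r4_def r5_def r6_def
        by (simp add: field_simps)
    qed
    have "order_ge 4 (\<lambda>t. R 0 + t * dd [a] R 0 + t\<^sup>2 * (dd [b] R 0 + dd [a, a] R 0 / 2) + t ^ 3 * (dd [a, b] R 0 + dd [a, a, a] R 0 / 6))"
      unfolding expand by (intro order_ge_diff order_ge_add order order_ge_Taylor3[OF R W0 v1] p p5 p6)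
    from cubic_order_ge_4[OF this]
    show "R 0 = 0" "dd [(z, 0)] R 0 = 0" "dd [(0, u)] R 0 + dd [(z, 0), (z, 0)] R 0 / 2 = 0"
      "dd [(z, 0), (0, u)] R 0 + dd [(z, 0), (z, 0), (z, 0)] R 0 / 6 = 0"
      by (simp_all add: a_def b_def)
  qed
  have z2: "dd [(0, 0)] R 0 = 0" "dd [v, (0, 0)] R 0 = 0" for v
    using linear_0[OF linear_dd[OF R W0]] linear_0[OF linear_dd2(2)[OF R W0]] by (simp_all add: zero_prod_def)
  have zz: "dd [(z, 0), (z, 0)] R 0 = 0" for z using jets(3)[of 0 z] z2 by simp
  have zzz: "dd [(z, 0), (z, 0), (z, 0)] R 0 = 0" for z using jets(4)[of z 0] z2 by simp
  have u1: "dd [(0, u)] R 0 = 0" for u using jets(3)[of u 0] zz[of 0] by simp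
  have zu: "dd [(z, 0), (0, u)] R 0 = 0" for z u using jets(4)[of z u] zzz[of z] by simp
  have pol2: "dd [(z, 0), (z', 0)] R 0 = 0" for z z'
  proof -
    have "(z + z', 0) = (z, 0) + (z', 0 :: real)" by simp
    then show ?thesis using zz[of "z + z'"] zz[of z] zz[of z'] dd_swap[OF R W0, of "(z', 0)" "(z, 0)"]
      by (simp add: l2 del: plus_prod_def add_Pair)
  qed
  have pol3: "dd [(x, 0), (y, 0), (z, 0)] R 0 = 0" for x y z
  proof -
    let ?T = "\<lambda>x y z. dd [(x, 0), (y, 0), (z, 0)] R 0"
    have add: "(x + y, 0) = (x, 0) + (y, 0 :: real)" for x y :: "complex ^ 'n" by simp
    have Tadd: "?T (x + x') y z = ?T x y z + ?T x' y z" "?T x (y + y') z = ?T x y z + ?T x y' z" "?T x y (z + z') = ?T x y z + ?T x y z'" for x x' y y' z z'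
      unfolding add l3 by simp_all
    have s1: "?T x y z = ?T y x z" and s2: "?T x y z = ?T x z y" for x y z
      using dd3_swap[OF R W0] by metis+
    have xxy: "?T x x y + ?T x y y = 0" for x y
      using zzz[of "x + y"] zzz[of x] zzz[of y] s1[of y x x] s2[of x y x] s1[of y x y] s2[of y y x]
      unfolding Tadd by simp
    have neg: "?T x x (- y) = - ?T x x y" "?T x (- y) (- y) = ?T x y y" for x y
    proof -
      have m: "(- y, 0) = - (y, 0 :: real)" for y :: "complex ^ 'n" by simp
      show "?T x x (- y) = - ?T x x y" "?T x (- y) (- y) = ?T x y y"
        unfolding m by (simp_all add: linear_neg[OF linear_dd3(2)[OF R W0]] linear_neg[OF linear_dd3(3)[OF R W0]] del: uminus_Pair)
    qed
    \<comment> \<open>Passing from \<open>y\<close> to \<open>- y\<close> changes the sign of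
      \<open>?T x x y\<close> but not that of \<open>?T x y y\<close>, so the relation
      \<open>xxy\<close> splits.\<close>
    have xxy0: "?T x x y = 0" for x y
      using xxy[of x y] xxy[of x "- y"] unfolding neg by simp
    have "?T (x + y) (x + y) z = 0" by (rule xxy0)
    then show ?thesis using xxy0[of x z] xxy0[of y z] s1[of y x z] unfolding Tadd by simp
  qed
  show ?thesis
    unfolding weighted_vanish4_def
  proof (intro exI conjI allI impI)
    show "0 \<in> W" "cinf_on W R" by fact+
    fix vs :: "((complex ^ 'n) \<times> real) list"
    assume vs: "set vs \<subseteq> Basis \<and> sum_list (map wt vs) < 4"
    have cases: "b = (fst b, 0) \<or> (b = (0, snd b) \<and> wt b = 2)" if "b \<in> Basis" for b :: "(complex ^ 'n) \<times> real"
      using that by (auto simp: Basis_prod_def wt_def)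
    have wt1: "wt b \<ge> 1" for b :: "(complex ^ 'n) \<times> real" by (simp add: wt_def)
    have d1: "dd [b] R 0 = 0" for b
      using l1(1)[of "(fst b, 0)" "(0, snd b)"] jets(2)[of "fst b"] u1[of "snd b"] by simp
    consider "vs = []" | b where "vs = [b]" | b b' where "vs = [b, b']" | b b' b'' where "vs = [b, b', b'']"
      | b b' b'' b3 ws where "vs = b # b' # b'' # b3 # ws"
      by (metis list.exhaust)
    then show "dd vs R 0 = 0"
    proof cases
      case 1
      then show ?thesis using jets(1) by simp
    next
      case 2
      then show ?thesis using d1 by simp
    next
      case 3
      then have "b \<in> Basis" "b' \<in> Basis" "wt b + wt b' < 4" using vs by auto
      with cases[of b] cases[of b'] consider "b = (fst b, 0)" "b' = (fst b', 0)" | "b = (fst b, 0)" "b' = (0, snd b')"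
        | "b = (0, snd b)" "b' = (fst b', 0)"
        by linarith
      then show ?thesis
        using 3 pol2[of "fst b" "fst b'"] zu[of "fst b" "snd b'"] zu[of "fst b'" "snd b"] dd_swap[OF R W0, of b b']
        by cases metis+
    next
      case 4
      then have b: "b \<in> Basis" "b' \<in> Basis" "b'' \<in> Basis" "wt b + wt b' + wt b'' < 4" using vs by auto
      then have "b = (fst b, 0)" "b' = (fst b', 0)" "b'' = (fst b'', 0)"
        using cases[of b] cases[of b'] cases[of b''] wt1[of b] wt1[of b'] wt1[of b''] by linarith+
      then show ?thesis using 4 pol3[of "fst b" "fst b'" "fst b''"] by metis
    next
      case 5
      then show ?thesis using vs wt1[of b] wt1[of b'] wt1[of b''] wt1[of b3] by simp
    qed
  qed
qed

subsection \<open>Local inverses and graphs\<close>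

text \<open>The inverse function theorem is applied to the derivative as a continuous map into
  bounded linear functions, whose continuity is checked direction by direction. The derivative of
  the inverse is part of the statement because both holomorphy of inverses and smoothness of graphs
  are deduced from it.\<close>

lemma smooth_local_inverse:
  fixes f :: "'a::euclidean_space \<Rightarrow> 'a"
  assumes f: "cinf_on U f" and x0: "x0 \<in> U" and bij: "bij (\<lambda>v. dd [v] f x0)"
  obtains U' V g where "open U'" "U' \<subseteq> U" "x0 \<in> U'" "open V" "homeomorphism U' V f g"
    "\<forall>y\<in>V. bij (\<lambda>v. dd [v] f (g y)) \<and> (g has_derivative inv (\<lambda>v. dd [v] f (g y))) (at y)"
proof -
  define f' where "f' x = Blinfun (\<lambda>v. dd [v] f x)" for x
  have ap: "blinfun_apply (f' x) = (\<lambda>v. dd [v] f x)" if "x \<in> U" for x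
    unfolding f'_def by (rule bounded_linear_Blinfun_apply)
      (rule has_derivative_bounded_linear[OF cinf_on_has_derivative[OF f that]])
  have "continuous_on U f'"
  proof (rule continuous_on_blinfun_componentwise)
    fix i :: 'a
    show "continuous_on U (\<lambda>x. blinfun_apply (f' x) i)"
      by (rule continuous_on_eq[OF cinf_on_continuous_dd[OF f, of "[i]"]]) (simp add: ap)
  qed
  moreover have "(f has_derivative blinfun_apply (f' x)) (at x)" if "x \<in> U" for x
    unfolding ap[OF that] by (rule cinf_on_has_derivative[OF f that])
  moreover have "Blinfun (inv (\<lambda>v. dd [v] f x0)) o\<^sub>L f' x0 = id_blinfun"
  proof (rule blinfun_eqI)
    fix v
    have "linear (inv (\<lambda>v. dd [v] f x0))"
      by (rule inj_linear_imp_inv_linear[OF linear_dd[OF f x0] bij_is_inj[OF bij]])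
    then have "blinfun_apply (Blinfun (inv (\<lambda>v. dd [v] f x0))) = inv (\<lambda>v. dd [v] f x0)"
      by (intro bounded_linear_Blinfun_apply) (simp add: linear_conv_bounded_linear)
    then show "blinfun_apply (Blinfun (inv (\<lambda>v. dd [v] f x0)) o\<^sub>L f' x0) v = blinfun_apply id_blinfun v"
      using inv_f_f[OF bij_is_inj[OF bij], of v] by (simp add: ap[OF x0])
  qed
  ultimately obtain U' V g g' where *: "open U'" "U' \<subseteq> U" "x0 \<in> U'" "open V" "f x0 \<in> V" "homeomorphism U' V f g"
    "\<And>y. y \<in> V \<Longrightarrow> (g has_derivative (g' y)) (at y)"
    "\<And>y. y \<in> V \<Longrightarrow> g' y = inv (blinfun_apply (f'(g y)))"
    "\<And>y. y \<in> V \<Longrightarrow> bij (blinfun_apply (f'(g y)))"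
    using inverse_function_theorem[OF cinf_on_open[OF f] _ _ x0, of f f' "Blinfun (inv (\<lambda>v. dd [v] f x0))"] by metis
  have "g y \<in> U" if "y \<in> V" for y
    using *(2,6) that unfolding homeomorphism_def by blast
  then have "\<forall>y\<in>V. bij (\<lambda>v. dd [v] f (g y)) \<and> (g has_derivative inv (\<lambda>v. dd [v] f (g y))) (at y)"
    using *(7,8,9) ap by metis
  then show ?thesis using that *(1-4,6) by blast
qed

text \<open>The inverse of a bijective differential that commutes with \<open>Jc\<close> commutes
  with \<open>Jc\<close> as well, so the local inverse is holomorphic.\<close>

lemma hol_coords_local:
  assumes h: "holo_on U \<Phi>" and p: "p \<in> U" and bij: "bij (\<lambda>v. dd [v] \<Phi> p)"
  obtains U' where "p \<in> U'" "U' \<subseteq> U" "hol_coords U' \<Phi>"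
proof -
  obtain U' V g where *: "open U'" "U' \<subseteq> U" "p \<in> U'" "open V" "homeomorphism U' V \<Phi> g"
    "\<forall>y\<in>V. bij (\<lambda>v. dd [v] \<Phi> (g y)) \<and> (g has_derivative inv (\<lambda>v. dd [v] \<Phi> (g y))) (at y)"
    by (rule smooth_local_inverse[OF cinf_on_holo[OF h] p bij])
  have hom: "\<Phi> ` U' = V" "\<And>x. x \<in> U' \<Longrightarrow> g (\<Phi> x) = x" "\<And>y. y \<in> V \<Longrightarrow> g y \<in> U'"
    using *(5) by (auto simp: homeomorphism_def)
  have "holo_on V g"
    unfolding holo_on_def
  proof (intro conjI ballI)
    fix y assume y: "y \<in> V"
    let ?D = "\<lambda>v. dd [v] \<Phi> (g y)"
    have b: "bij ?D" using *(6) y by blast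
    have J: "?D (Jc v) = Jc (?D v)" for v by (rule holo_dd_Jc[OF h]) (use hom(3)[OF y] *(2) in blast)
    have "inv ?D (Jc v) = Jc (inv ?D v)" for v
    proof -
      have "?D (Jc (inv ?D v)) = Jc v" unfolding J using surj_f_inv_f[OF bij_is_surj[OF b]] by simp
      then show ?thesis using inv_f_f[OF bij_is_inj[OF b]] by metis
    qed
    then show "\<exists>D. (g has_derivative D) (at y) \<and> (\<forall>v. D (Jc v) = Jc (D v))"
      using *(6) y by blast
  qed fact
  moreover have "inj_on \<Phi> U'" using hom(2) by (rule inj_on_inverseI)
  ultimately have "hol_coords U' \<Phi>"
    unfolding hol_coords_def hom(1) using holo_on_subset[OF h *(1,2)] *(4) hom(2) by blast
  then show ?thesis using that *(2,3) by blast
qed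

text \<open>The map \<open>G\<close> replaces the coordinate \<open>Im w\<close> by the value of
  \<open>f\<close>. Its inverse on the slice where that coordinate is zero parametrizes the zero
  set, and \<open>\<phi>\<close> is the \<open>Im w\<close> of the parametrization
  \<open>\<Gamma>\<close>. The derivative of \<open>\<Gamma>\<close> is a smooth expression in the
  point \<open>\<Gamma> x\<close>, so the functions \<open>k (\<Gamma> x)\<close> with smooth
  \<open>k\<close> are a class for \<open>cinf_on_coinduct\<close>; smoothness of the inverse itself
  is never invoked.\<close>

lemma implicit_graph:
  fixes f :: "'n::finite amb \<Rightarrow> real"
  assumes f: "cinf_on V f" and V0: "0 \<in> V" and f0: "f 0 = 0" and nz: "dd [(0, \<i>)] f 0 \<noteq> 0"
  obtains U D \<phi> where "open U" "0 \<in> U" "U \<subseteq> V" "cinf_on D \<phi>" "(0 :: (complex ^ 'n) \<times> real) \<in> D" "\<phi> 0 = 0"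
    "\<forall>x\<in>D. (fst x, Complex (snd x) (\<phi> x)) \<in> V \<and> f (fst x, Complex (snd x) (\<phi> x)) = 0"
    "\<forall>Z\<in>U. f Z = 0 \<longleftrightarrow> Im (snd Z) = \<phi> (fst Z, Re (snd Z))"
proof -
  define V1 where "V1 = dd [(0, \<i>)] f -` (- {0}) \<inter> V"
  have oV1: "open V1"
    unfolding V1_def using continuous_on_open_vimage[OF cinf_on_open[OF f]] cinf_on_continuous_dd[OF f]
      open_Compl[OF closed_singleton] by blast
  have V1: "V1 \<subseteq> V" "0 \<in> V1" "\<And>Z. Z \<in> V1 \<Longrightarrow> dd [(0, \<i>)] f Z \<noteq> 0" using V0 nz by (auto simp: V1_def)
  have f1: "cinf_on V1 f" by (rule cinf_on_subset[OF f oV1 V1(1)])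
  define e :: "'n amb" where "e = (0, \<i>)"
  define P :: "'n amb \<Rightarrow> 'n amb" where "P Z = (fst Z, of_real (Re (snd Z)))" for Z
  have linP: "linear P" by (rule linearI) (simp_all add: P_def scaleR_conv_of_real)
  define G where "G Z = P Z + f Z *\<^sub>R e" for Z
  have sG: "cinf_on V1 G"
    unfolding G_def[abs_def] by (intro cinf_on_add cinf_on_linear[OF oV1 linP] cinf_on_scaleR f1 cinf_on_const oV1)
  have dG: "dd [v] G Z = P v + dd [v] f Z *\<^sub>R e" if "Z \<in> V1" for v Z
    unfolding G_def[abs_def]
    by (rule has_derivative_imp_dd)
      (auto intro!: derivative_eq_intros cinf_on_has_derivative[OF f1 that] bounded_linear_imp_has_derivative
        linP[unfolded linear_conv_bounded_linear])
  \<comment> \<open>The slope for which the derivative of \<open>f\<close> along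
    \<open>v + s v Z *\<^sub>R e\<close> vanishes.\<close>
  define s where "s v Z = - dd [v] f Z / dd [e] f Z" for v Z
  have inv: "dd [P v + s (P v) Z *\<^sub>R e] G Z = P v" if Z: "Z \<in> V1" for v Z
  proof -
    note l = linear_add[OF linear_dd[OF f1 Z]] linear_scale[OF linear_dd[OF f1 Z]]
    have PP: "P (P v + k *\<^sub>R e) = P v" for k by (simp add: P_def e_def)
    have "dd [P v] f Z + s (P v) Z * dd [e] f Z = 0"
      using V1(3)[OF Z] by (simp add: s_def e_def[symmetric])
    then show ?thesis unfolding dG[OF Z] PP l by simp
  qed
  have "bij (\<lambda>v. dd [v] G 0)"
  proof -
    have "v = 0" if "dd [v] G 0 = 0" for v
    proof -
      have 1: "P v + dd [v] f 0 *\<^sub>R e = 0" using that by (simp add: dG[OF V1(2)])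
      then have "fst v = 0" "Re (snd v) = 0" and d: "dd [v] f 0 = 0" by (simp_all add: P_def e_def prod_eq_iff complex_eq_iff)
      then have "v = Im (snd v) *\<^sub>R e" by (simp add: e_def prod_eq_iff complex_eq_iff)
      then have "dd [v] f 0 = Im (snd v) * dd [e] f 0" using linear_scale[OF linear_dd[OF f1 V1(2)], of "Im (snd v)" e] by simp
      then show ?thesis using d V1(3)[OF V1(2)] \<open>v = Im (snd v) *\<^sub>R e\<close> by (simp add: e_def[symmetric])
    qed
    then have "inj (\<lambda>v. dd [v] G 0)" unfolding linear_injective_0[OF linear_dd[OF sG V1(2)]] by blast
    then show ?thesis using linear_injective_imp_surjective[OF linear_dd[OF sG V1(2)]] by (simp add: bij_def)
  qed
  then obtain U2 V2 g where U2: "open U2" "U2 \<subseteq> V1" "0 \<in> U2" "open V2" "homeomorphism U2 V2 G g"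
    "\<forall>y\<in>V2. bij (\<lambda>v. dd [v] G (g y)) \<and> (g has_derivative inv (\<lambda>v. dd [v] G (g y))) (at y)"
    by (rule smooth_local_inverse[OF sG V1(2)])
  have hom: "G ` U2 = V2" "\<And>x. x \<in> U2 \<Longrightarrow> g (G x) = x" "\<And>y. y \<in> V2 \<Longrightarrow> g y \<in> U2" "\<And>y. y \<in> V2 \<Longrightarrow> G (g y) = y"
    using U2(5) by (auto simp: homeomorphism_def)
  define \<iota> :: "(complex ^ 'n) \<times> real \<Rightarrow> 'n amb" where "\<iota> x = (fst x, of_real (snd x))" for x
  have lini: "linear \<iota>" by (rule linearI) (simp_all add: \<iota>_def scaleR_conv_of_real)
  have bli: "bounded_linear \<iota>" using lini by (simp add: linear_conv_bounded_linear)
  have Pi: "P (\<iota> x) = \<iota> x" for x by (simp add: P_def \<iota>_def)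
  define D where "D = \<iota> -` V2"
  have oD: "open D" unfolding D_def
    by (rule open_vimage[OF U2(4)]) (rule linear_continuous_on[OF bli])
  have G0: "G 0 = 0" using f0 by (simp add: G_def P_def zero_prod_def)
  have i0: "\<iota> 0 = 0" by (simp add: \<iota>_def zero_prod_def)
  have D0: "0 \<in> D" using hom(1) U2(3) G0 by (force simp: D_def i0)
  define \<Gamma> where "\<Gamma> x = g (\<iota> x)" for x
  define \<phi> where "\<phi> x = Im (snd (\<Gamma> x))" for x
  have Gam: "\<Gamma> x \<in> U2" "\<Gamma> x = (fst x, Complex (snd x) (\<phi> x))" "f (\<Gamma> x) = 0" if x: "x \<in> D" for x
  proof -
    have y: "\<iota> x \<in> V2" using x by (simp add: D_def)
    show "\<Gamma> x \<in> U2" unfolding \<Gamma>_def by (rule hom(3)[OF y])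
    have "G (\<Gamma> x) = \<iota> x" unfolding \<Gamma>_def by (rule hom(4)[OF y])
    then show "\<Gamma> x = (fst x, Complex (snd x) (\<phi> x))" "f (\<Gamma> x) = 0"
      by (simp_all add: G_def P_def e_def \<iota>_def \<phi>_def prod_eq_iff complex_eq_iff)
  qed
  have dGam: "(\<Gamma> has_derivative (\<lambda>v. \<iota> v + s (\<iota> v) (\<Gamma> x) *\<^sub>R e)) (at x)" if x: "x \<in> D" for x
  proof -
    have y: "\<iota> x \<in> V2" using x by (simp add: D_def)
    have "(\<Gamma> has_derivative (\<lambda>v. inv (\<lambda>v. dd [v] G (g (\<iota> x))) (\<iota> v))) (at x)"
      unfolding \<Gamma>_def[abs_def]
      by (rule has_derivative_compose[OF bounded_linear_imp_has_derivative[OF bli]]) (use U2(6) y in blast)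
    also have "(\<lambda>v. inv (\<lambda>v. dd [v] G (g (\<iota> x))) (\<iota> v)) = (\<lambda>v. \<iota> v + s (\<iota> v) (\<Gamma> x) *\<^sub>R e)"
    proof
      fix v
      have "dd [\<iota> v + s (\<iota> v) (\<Gamma> x) *\<^sub>R e] G (\<Gamma> x) = \<iota> v"
        using inv[of "\<Gamma> x" "\<iota> v"] Gam(1)[OF x] U2(2) by (auto simp: Pi)
      then show "inv (\<lambda>v. dd [v] G (g (\<iota> x))) (\<iota> v) = \<iota> v + s (\<iota> v) (\<Gamma> x) *\<^sub>R e"
        using inv_f_f[OF bij_is_inj, of "\<lambda>v. dd [v] G (g (\<iota> x))"] U2(6) y unfolding \<Gamma>_def by metis
    qed
    finally show ?thesis .
  qed
  have f2: "cinf_on U2 f" by (rule cinf_on_subset[OF f1 U2(1,2)])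
  have "cinf_on D \<phi>"
  proof (rule cinf_on_coinduct[where P="\<lambda>h. \<exists>k. cinf_on U2 k \<and> h = (\<lambda>x. k (\<Gamma> x))"])
    show "open D" by (rule oD)
    have "linear (\<lambda>Z :: 'n amb. Im (snd Z))" by (rule linearI) auto
    from cinf_on_linear[OF U2(1) this] show "\<exists>k. cinf_on U2 k \<and> \<phi> = (\<lambda>x. k (\<Gamma> x))" unfolding \<phi>_def[abs_def] by blast
    fix h :: "(complex ^ 'n) \<times> real \<Rightarrow> real" assume "\<exists>k. cinf_on U2 k \<and> h = (\<lambda>x. k (\<Gamma> x))"
    then obtain k where k: "cinf_on U2 k" "h = (\<lambda>x. k (\<Gamma> x))" by blast
    have "continuous_on D \<Gamma>"
      by (rule continuous_at_imp_continuous_on) (use dGam has_derivative_continuous in blast)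
    then show "continuous_on D h"
      unfolding k(2) by (rule continuous_on_compose2[OF cinf_on_continuous[OF k(1)]]) (use Gam(1) in blast)
    fix v
    let ?k' = "\<lambda>Z. dd [\<iota> v] k Z + s (\<iota> v) Z * dd [e] k Z"
    have "cinf_on U2 ?k'"
      unfolding s_def
      by (intro cinf_on_add cinf_on_mult cinf_on_divide cinf_on_minus cinf_on_dd k f2) (use V1(3) U2(2) in \<open>auto simp: e_def\<close>)
    moreover have "((\<lambda>t. h (x + t *\<^sub>R v)) has_vector_derivative ?k' (\<Gamma> x)) (at 0)" if x: "x \<in> D" for x
    proof -
      note l = linear_add[OF linear_dd[OF k(1) Gam(1)[OF x]]] linear_scale[OF linear_dd[OF k(1) Gam(1)[OF x]]]
      have "(h has_derivative (\<lambda>v. dd [\<iota> v + s (\<iota> v) (\<Gamma> x) *\<^sub>R e] k (\<Gamma> x))) (at x)"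
        unfolding k(2) by (rule has_derivative_compose[OF dGam[OF x] cinf_on_has_derivative[OF k(1) Gam(1)[OF x]]])
      from has_derivative_along_line[OF this, of v] show ?thesis by (simp add: l)
    qed
    ultimately show "\<exists>g'. (\<exists>k. cinf_on U2 k \<and> g' = (\<lambda>x. k (\<Gamma> x))) \<and>
        (\<forall>x\<in>D. ((\<lambda>t. h (x + t *\<^sub>R v)) has_vector_derivative g' x) (at 0))"
      by (intro exI[of _ "\<lambda>x. ?k' (\<Gamma> x)"]) blast
  qed
  define U where "U = U2 \<inter> (\<lambda>Z. (fst Z, Re (snd Z))) -` D"
  have "continuous_on UNIV (\<lambda>Z :: 'n amb. (fst Z, Re (snd Z)))" by (intro continuous_intros)
  from open_vimage[OF oD this] have oU: "open U" unfolding U_def using U2(1) by blast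
  have g0: "\<Gamma> 0 = 0" unfolding \<Gamma>_def using hom(2)[OF U2(3)] G0 i0 by simp
  show ?thesis
  proof (rule that[OF oU _ _ \<open>cinf_on D \<phi>\<close> D0])
    show "0 \<in> U" using U2(3) D0 by (simp add: U_def flip: zero_prod_def)
    show "U \<subseteq> V" using U2(2) V1(1) by (auto simp: U_def)
    show "\<phi> 0 = 0" by (simp add: \<phi>_def g0)
    show "\<forall>x\<in>D. (fst x, Complex (snd x) (\<phi> x)) \<in> V \<and> f (fst x, Complex (snd x) (\<phi> x)) = 0"
      using Gam U2(2) V1(1) by (metis subsetD)
    show "\<forall>Z\<in>U. f Z = 0 \<longleftrightarrow> Im (snd Z) = \<phi> (fst Z, Re (snd Z))"
    proof (intro ballI iffI)
      fix Z assume "Z \<in> U"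
      then have Z: "Z \<in> U2" "(fst Z, Re (snd Z)) \<in> D" by (auto simp: U_def)
      {
        assume "f Z = 0"
        then have "\<Gamma> (fst Z, Re (snd Z)) = Z"
          using hom(2)[OF Z(1)] by (simp add: \<Gamma>_def \<iota>_def G_def P_def)
        then show "Im (snd Z) = \<phi> (fst Z, Re (snd Z))" by (simp add: \<phi>_def)
      next
        assume "Im (snd Z) = \<phi> (fst Z, Re (snd Z))"
        then have "\<Gamma> (fst Z, Re (snd Z)) = Z"
          using Gam(2)[OF Z(2)] by (simp add: prod_eq_iff complex_eq_iff)
        then show "f Z = 0" using Gam(3)[OF Z(2)] by simp
      }
    qed
  qed
qed

text \<open>Up to conjugation a real trilinear form has these four types. \<open>K p q r\<close> is
  a quarter of the complex multilinear extension of \<open>T\<close> at \<open>1 + p I\<close>,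
  \<open>1 + q I\<close>, \<open>1 + r I\<close>, where \<open>I\<close> is the real basis vector
  \<open>\<i>\<close>. The scalar \<open>- \<i>\<close> selects the part linear in that argument,
  \<open>\<i>\<close> the antilinear part. The three projections give \<open>1/8\<close>, and the
  real part joins two conjugate types.\<close>

lemma trilinear_complex_decomposition:
  fixes T :: "complex \<Rightarrow> complex \<Rightarrow> complex \<Rightarrow> real"
  assumes l: "\<And>v w. linear (\<lambda>u. T u v w)" "\<And>u w. linear (\<lambda>v. T u v w)" "\<And>u v. linear (\<lambda>w. T u v w)"
  shows "\<exists>c0 c1 c2 c3. \<forall>x y w. T x y w =
     Re (c0 * x * y * w + c1 * cnj x * cnj y * w + c2 * cnj x * y * cnj w + c3 * x * cnj y * cnj w)"
proof -
  note r = linear_add[OF l(1)] linear_add[OF l(2)] linear_add[OF l(3)]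
    linear_scale[OF l(1)] linear_scale[OF l(2)] linear_scale[OF l(3)]
  define K where "K p q r = (T 1 1 1 + r * T 1 1 \<i> + q * T 1 \<i> 1 + q * r * T 1 \<i> \<i>
     + p * T \<i> 1 1 + p * r * T \<i> 1 \<i> + p * q * T \<i> \<i> 1 + p * q * r * T \<i> \<i> \<i>) / 4" for p q r :: complex
  have "T x y w = Re (K (-\<i>) (-\<i>) (-\<i>) * x * y * w + K \<i> \<i> (-\<i>) * cnj x * cnj y * w
      + K \<i> (-\<i>) \<i> * cnj x * y * cnj w + K (-\<i>) \<i> \<i> * x * cnj y * cnj w)" for x y w
  proof -
    obtain x1 x2 y1 y2 w1 w2 where xyw: "x = Complex x1 x2" "y = Complex y1 y2" "w = Complex w1 w2"
      by (metis complex.exhaust)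
    have "T x y w = T (x1 *\<^sub>R 1 + x2 *\<^sub>R \<i>) (y1 *\<^sub>R 1 + y2 *\<^sub>R \<i>) (w1 *\<^sub>R 1 + w2 *\<^sub>R \<i>)"
      unfolding xyw by (simp add: Complex_eq scaleR_conv_of_real mult.commute)
    then show ?thesis unfolding r xyw by (simp add: K_def field_simps)
  qed
  then show ?thesis by blast
qed

subsection \<open>Cubic forms and holomorphic polynomials\<close>

text \<open>On the diagonal the three mixed types agree after renaming indices, because each has two
  conjugated factors. The coefficient is averaged over its first two indices to become symmetric;
  the factor \<open>2\<close> in front of the real part is that of the model.\<close>

lemma trilinear_vec_decomposition:
  fixes T :: "complex ^ 'n::finite \<Rightarrow> complex ^ 'n \<Rightarrow> complex ^ 'n \<Rightarrow> real"
  assumes l: "\<And>v w. linear (\<lambda>u. T u v w)" "\<And>u w. linear (\<lambda>v. T u v w)" "\<And>u v. linear (\<lambda>w. T u v w)"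
  shows "\<exists>B k. (\<forall>\<alpha> \<beta> \<gamma>. k \<alpha> \<beta> \<gamma> = k \<beta> \<alpha> \<gamma>) \<and>
    (\<forall>z. T z z z = Re (\<Sum>\<alpha>\<in>UNIV. \<Sum>\<beta>\<in>UNIV. \<Sum>\<gamma>\<in>UNIV. B \<alpha> \<beta> \<gamma> * z $ \<alpha> * z $ \<beta> * z $ \<gamma>) +
       2 * Re (\<Sum>\<alpha>\<in>UNIV. \<Sum>\<beta>\<in>UNIV. \<Sum>\<gamma>\<in>UNIV. k \<alpha> \<beta> \<gamma> * cnj (z $ \<alpha>) * cnj (z $ \<beta>) * z $ \<gamma>))"
proof -
  have lax: "linear (\<lambda>x. axis j x :: complex ^ 'n)" for j
    by (rule linearI) (auto simp: axis_def vec_eq_iff)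
  have "\<exists>c0 c1 c2 c3. \<forall>x y w. T (axis \<alpha> x) (axis \<beta> y) (axis \<gamma> w) =
     Re (c0 * x * y * w + c1 * cnj x * cnj y * w + c2 * cnj x * y * cnj w + c3 * x * cnj y * cnj w)" for \<alpha> \<beta> \<gamma>
    by (rule trilinear_complex_decomposition)
      (use linear_compose[OF lax l(1)] linear_compose[OF lax l(2)] linear_compose[OF lax l(3)] in \<open>simp_all add: o_def\<close>)
  then obtain c0 c1 c2 c3 where c: "\<And>\<alpha> \<beta> \<gamma> x y w. T (axis \<alpha> x) (axis \<beta> y) (axis \<gamma> w) =
     Re (c0 \<alpha> \<beta> \<gamma> * x * y * w + c1 \<alpha> \<beta> \<gamma> * cnj x * cnj y * w + c2 \<alpha> \<beta> \<gamma> * cnj x * y * cnj w + c3 \<alpha> \<beta> \<gamma> * x * cnj y * cnj w)"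
    by metis
  define k' where "k' \<alpha> \<beta> \<gamma> = (c1 \<alpha> \<beta> \<gamma> + c2 \<alpha> \<gamma> \<beta> + c3 \<gamma> \<alpha> \<beta>) / 2" for \<alpha> \<beta> \<gamma>
  define k where "k \<alpha> \<beta> \<gamma> = (k' \<alpha> \<beta> \<gamma> + k' \<beta> \<alpha> \<gamma>) / 2" for \<alpha> \<beta> \<gamma>
  have "T z z z = Re (\<Sum>\<alpha>\<in>UNIV. \<Sum>\<beta>\<in>UNIV. \<Sum>\<gamma>\<in>UNIV. c0 \<alpha> \<beta> \<gamma> * z $ \<alpha> * z $ \<beta> * z $ \<gamma>) +
       2 * Re (\<Sum>\<alpha>\<in>UNIV. \<Sum>\<beta>\<in>UNIV. \<Sum>\<gamma>\<in>UNIV. k \<alpha> \<beta> \<gamma> * cnj (z $ \<alpha>) * cnj (z $ \<beta>) * z $ \<gamma>)" for z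
  proof -
    have z: "z = (\<Sum>\<alpha>\<in>UNIV. axis \<alpha> (z $ \<alpha>))"
      by (simp add: vec_eq_iff axis_def if_distrib[of "\<lambda>f. f _"] sum.delta cong: if_cong)
    let ?S = "\<lambda>f. \<Sum>\<alpha>\<in>UNIV. \<Sum>\<beta>\<in>UNIV. \<Sum>\<gamma>\<in>UNIV. (f \<alpha> \<beta> \<gamma> :: complex)"
    have "T z z z = (\<Sum>\<alpha>\<in>UNIV. \<Sum>\<beta>\<in>UNIV. \<Sum>\<gamma>\<in>UNIV. T (axis \<alpha> (z $ \<alpha>)) (axis \<beta> (z $ \<beta>)) (axis \<gamma> (z $ \<gamma>)))"
    proof -
      have "T z z z = (\<Sum>\<alpha>\<in>UNIV. T (axis \<alpha> (z $ \<alpha>)) z z)"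
        by (subst (1) z) (rule linear_sum[OF l(1)])
      also have "\<dots> = (\<Sum>\<alpha>\<in>UNIV. \<Sum>\<beta>\<in>UNIV. T (axis \<alpha> (z $ \<alpha>)) (axis \<beta> (z $ \<beta>)) z)"
        by (rule sum.cong[OF refl]) (metis (no_types) z linear_sum[OF l(2)])
      also have "\<dots> = (\<Sum>\<alpha>\<in>UNIV. \<Sum>\<beta>\<in>UNIV. \<Sum>\<gamma>\<in>UNIV. T (axis \<alpha> (z $ \<alpha>)) (axis \<beta> (z $ \<beta>)) (axis \<gamma> (z $ \<gamma>)))"
        by (intro sum.cong[OF refl]) (metis (no_types) z linear_sum[OF l(3)])
      finally show ?thesis .
    qed
    also have "\<dots> = Re (?S (\<lambda>\<alpha> \<beta> \<gamma>. c0 \<alpha> \<beta> \<gamma> * z $ \<alpha> * z $ \<beta> * z $ \<gamma>)) + Re (?S (\<lambda>\<alpha> \<beta> \<gamma>. c1 \<alpha> \<beta> \<gamma> * cnj (z $ \<alpha>) * cnj (z $ \<beta>) * z $ \<gamma>)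
       + ?S (\<lambda>\<alpha> \<beta> \<gamma>. c2 \<alpha> \<beta> \<gamma> * cnj (z $ \<alpha>) * z $ \<beta> * cnj (z $ \<gamma>)) + ?S (\<lambda>\<alpha> \<beta> \<gamma>. c3 \<alpha> \<beta> \<gamma> * z $ \<alpha> * cnj (z $ \<beta>) * cnj (z $ \<gamma>)))"
      unfolding c by (simp only: plus_complex.simps Re_sum sum.distrib add.assoc)
    also have "?S (\<lambda>\<alpha> \<beta> \<gamma>. c2 \<alpha> \<beta> \<gamma> * cnj (z $ \<alpha>) * z $ \<beta> * cnj (z $ \<gamma>)) = ?S (\<lambda>\<alpha> \<beta> \<gamma>. c2 \<alpha> \<gamma> \<beta> * cnj (z $ \<alpha>) * cnj (z $ \<beta>) * z $ \<gamma>)"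
    proof (rule sum.cong[OF refl])
      fix \<alpha>
      show "(\<Sum>\<beta>\<in>UNIV. \<Sum>\<gamma>\<in>UNIV. c2 \<alpha> \<beta> \<gamma> * cnj (z $ \<alpha>) * z $ \<beta> * cnj (z $ \<gamma>)) = (\<Sum>\<beta>\<in>UNIV. \<Sum>\<gamma>\<in>UNIV. c2 \<alpha> \<gamma> \<beta> * cnj (z $ \<alpha>) * cnj (z $ \<beta>) * z $ \<gamma>)"
        by (subst sum.swap) (simp add: mult_ac)
    qed
    also have "?S (\<lambda>\<alpha> \<beta> \<gamma>. c3 \<alpha> \<beta> \<gamma> * z $ \<alpha> * cnj (z $ \<beta>) * cnj (z $ \<gamma>)) = ?S (\<lambda>\<alpha> \<beta> \<gamma>. c3 \<gamma> \<alpha> \<beta> * cnj (z $ \<alpha>) * cnj (z $ \<beta>) * z $ \<gamma>)"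
    proof -
      have "?S (\<lambda>\<alpha> \<beta> \<gamma>. c3 \<alpha> \<beta> \<gamma> * z $ \<alpha> * cnj (z $ \<beta>) * cnj (z $ \<gamma>)) = (\<Sum>\<beta>\<in>UNIV. \<Sum>\<alpha>\<in>UNIV. \<Sum>\<gamma>\<in>UNIV. c3 \<alpha> \<beta> \<gamma> * z $ \<alpha> * cnj (z $ \<beta>) * cnj (z $ \<gamma>))"
        by (rule sum.swap)
      also have "\<dots> = (\<Sum>\<beta>\<in>UNIV. \<Sum>\<gamma>\<in>UNIV. \<Sum>\<alpha>\<in>UNIV. c3 \<alpha> \<beta> \<gamma> * z $ \<alpha> * cnj (z $ \<beta>) * cnj (z $ \<gamma>))"
        by (rule sum.cong[OF refl]) (rule sum.swap)
      finally show ?thesis by (simp add: mult_ac)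
    qed
    also have "?S (\<lambda>\<alpha> \<beta> \<gamma>. c1 \<alpha> \<beta> \<gamma> * cnj (z $ \<alpha>) * cnj (z $ \<beta>) * z $ \<gamma>)
       + ?S (\<lambda>\<alpha> \<beta> \<gamma>. c2 \<alpha> \<gamma> \<beta> * cnj (z $ \<alpha>) * cnj (z $ \<beta>) * z $ \<gamma>) + ?S (\<lambda>\<alpha> \<beta> \<gamma>. c3 \<gamma> \<alpha> \<beta> * cnj (z $ \<alpha>) * cnj (z $ \<beta>) * z $ \<gamma>)
       = 2 * ?S (\<lambda>\<alpha> \<beta> \<gamma>. k' \<alpha> \<beta> \<gamma> * cnj (z $ \<alpha>) * cnj (z $ \<beta>) * z $ \<gamma>)"
      unfolding sum.distrib[symmetric] sum_distrib_left by (intro sum.cong refl) (simp add: k'_def algebra_simps)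
    also have "?S (\<lambda>\<alpha> \<beta> \<gamma>. k' \<alpha> \<beta> \<gamma> * cnj (z $ \<alpha>) * cnj (z $ \<beta>) * z $ \<gamma>) = ?S (\<lambda>\<alpha> \<beta> \<gamma>. k \<alpha> \<beta> \<gamma> * cnj (z $ \<alpha>) * cnj (z $ \<beta>) * z $ \<gamma>)"
    proof -
      have sw: "?S (\<lambda>\<alpha> \<beta> \<gamma>. k' \<beta> \<alpha> \<gamma> * cnj (z $ \<alpha>) * cnj (z $ \<beta>) * z $ \<gamma>) = ?S (\<lambda>\<alpha> \<beta> \<gamma>. k' \<alpha> \<beta> \<gamma> * cnj (z $ \<alpha>) * cnj (z $ \<beta>) * z $ \<gamma>)"
        by (subst sum.swap) (simp add: mult_ac)
      have "2 * ?S (\<lambda>\<alpha> \<beta> \<gamma>. k \<alpha> \<beta> \<gamma> * cnj (z $ \<alpha>) * cnj (z $ \<beta>) * z $ \<gamma>) =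
        ?S (\<lambda>\<alpha> \<beta> \<gamma>. k' \<alpha> \<beta> \<gamma> * cnj (z $ \<alpha>) * cnj (z $ \<beta>) * z $ \<gamma>) + ?S (\<lambda>\<alpha> \<beta> \<gamma>. k' \<beta> \<alpha> \<gamma> * cnj (z $ \<alpha>) * cnj (z $ \<beta>) * z $ \<gamma>)"
        unfolding sum.distrib[symmetric] sum_distrib_left by (intro sum.cong refl) (simp add: k_def field_simps)
      then show ?thesis unfolding sw by simp
    qed
    finally show ?thesis by simp
  qed
  moreover have "k \<alpha> \<beta> \<gamma> = k \<beta> \<alpha> \<gamma>" for \<alpha> \<beta> \<gamma> by (simp add: k_def add.commute)
  ultimately show ?thesis by blast
qed

section \<open>Holomorphic polynomials, checked coordinate by coordinate\<close>

definition chol :: "('n::finite amb \<Rightarrow> complex) \<Rightarrow> bool" where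
  "chol f \<longleftrightarrow> (\<forall>x. \<exists>D. (f has_derivative D) (at x) \<and> (\<forall>v. D (Jc v) = \<i> * D v))"

lemma chol_const: "chol (\<lambda>x. c)"
  unfolding chol_def by (intro allI exI[of _ "\<lambda>v. 0"]) auto

lemma chol_add:
  assumes "chol f" "chol g"
  shows "chol (\<lambda>x. f x + g x)"
  unfolding chol_def
proof
  fix x
  obtain D E where D: "(f has_derivative D) (at x)" "\<forall>v. D (Jc v) = \<i> * D v"
    and E: "(g has_derivative E) (at x)" "\<forall>v. E (Jc v) = \<i> * E v"
    using assms unfolding chol_def by blast
  show "\<exists>D. ((\<lambda>x. f x + g x) has_derivative D) (at x) \<and> (\<forall>v. D (Jc v) = \<i> * D v)"
    using has_derivative_add[OF D(1) E(1)] D(2) E(2)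
    by (intro exI[of _ "\<lambda>v. D v + E v"]) (simp add: distrib_left)
qed

lemma chol_mult:
  assumes "chol f" "chol g"
  shows "chol (\<lambda>x. f x * g x)"
  unfolding chol_def
proof
  fix x
  obtain D E where D: "(f has_derivative D) (at x)" "\<forall>v. D (Jc v) = \<i> * D v"
    and E: "(g has_derivative E) (at x)" "\<forall>v. E (Jc v) = \<i> * E v"
    using assms unfolding chol_def by blast
  show "\<exists>D. ((\<lambda>x. f x * g x) has_derivative D) (at x) \<and> (\<forall>v. D (Jc v) = \<i> * D v)"
    using has_derivative_mult[OF D(1) E(1)] D(2) E(2)
    by (intro exI[of _ "\<lambda>v. f x * E v + D v * g x"]) (simp add: algebra_simps)
qed

lemma chol_sum: "(\<And>i. i \<in> I \<Longrightarrow> chol (f i)) \<Longrightarrow> chol (\<lambda>x. \<Sum>i\<in>I. f i x)"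
  by (induction I rule: infinite_finite_induct) (auto intro: chol_const chol_add)

lemma chol_linear:
  assumes "linear l" "\<And>v. l (Jc v) = \<i> * l v"
  shows "chol l"
  unfolding chol_def using assms bounded_linear_imp_has_derivative
  by (intro allI exI[of _ l]) (simp add: linear_conv_bounded_linear)

lemma chol_quadratic:
  fixes P :: "'n::finite amb \<Rightarrow> 'n amb \<Rightarrow> complex"
  assumes l: "\<And>v. linear (\<lambda>u. P u v)" "\<And>u. linear (\<lambda>v. P u v)"
    and J: "\<And>u v. P (Jc u) v = \<i> * P u v" "\<And>u v. P u (Jc v) = \<i> * P u v"
  shows "chol (\<lambda>x. P x x)"
  unfolding chol_def
proof
  fix x
  have "bilinear P" using l by (simp add: bilinear_def)
  then have "bounded_bilinear P" by (simp add: bilinear_conv_bounded_bilinear)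
  from bounded_bilinear.FDERIV[OF this has_derivative_ident has_derivative_ident, of x UNIV]
  show "\<exists>D. ((\<lambda>x. P x x) has_derivative D) (at x) \<and> (\<forall>v. D (Jc v) = \<i> * D v)"
    by (intro exI[of _ "\<lambda>v. P x v + P v x"]) (simp add: J distrib_left)
qed

lemma chol_coordinates: "chol (\<lambda>x. fst x $ j)" "chol (\<lambda>x. snd x)"
  by (rule chol_linear; (auto intro!: linearI)?)+

lemma holo_on_components:
  fixes F :: "'n::finite amb \<Rightarrow> 'n amb"
  assumes "open U" "\<And>j. chol (\<lambda>x. fst (F x) $ j)" "chol (\<lambda>x. snd (F x))"
  shows "holo_on U F"
  unfolding holo_on_def
proof (intro conjI ballI)
  fix x assume "x \<in> U"
  have "\<forall>j. \<exists>D. ((\<lambda>x. fst (F x) $ j) has_derivative D) (at x) \<and> (\<forall>v. D (Jc v) = \<i> * D v)"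
    using assms(2) unfolding chol_def by blast
  then obtain D where D: "\<And>j. ((\<lambda>x. fst (F x) $ j) has_derivative D j) (at x)" "\<And>j v. D j (Jc v) = \<i> * D j v"
    by metis
  obtain E where E: "((\<lambda>x. snd (F x)) has_derivative E) (at x)" "\<And>v. E (Jc v) = \<i> * E v"
    using assms(3) unfolding chol_def by blast
  have lin: "bounded_linear (axis j :: complex \<Rightarrow> complex ^ 'n)" for j
    unfolding linear_conv_bounded_linear[symmetric] by (rule linearI) (auto simp: axis_def vec_eq_iff)
  have ax: "(\<Sum>j\<in>UNIV. axis j (f j)) = (\<chi> j. f j)" for f :: "'n \<Rightarrow> complex"
    by (simp add: vec_eq_iff axis_def if_distrib[of "\<lambda>f. f _"] sum.delta cong: if_cong)
  have "((\<lambda>x. (\<Sum>j\<in>UNIV. axis j (fst (F x) $ j), snd (F x))) has_derivative (\<lambda>v. (\<Sum>j\<in>UNIV. axis j (D j v), E v))) (at x)"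
    by (intro has_derivative_Pair has_derivative_sum bounded_linear.has_derivative[OF lin] D E)
  then have "(F has_derivative (\<lambda>v. (\<chi> j. D j v, E v))) (at x)" by (simp add: ax)
  then show "\<exists>D. (F has_derivative D) (at x) \<and> (\<forall>v. D (Jc v) = Jc (D v))"
    by (intro exI[of _ "\<lambda>v. (\<chi> j. D j v, E v)"]) (simp add: amb_eq_iff D(2) E(2))
qed fact

section \<open>Orders of multilinear expressions along a curve\<close>

lemma order_ge_sum: "(\<And>i. i \<in> I \<Longrightarrow> order_ge k (f i)) \<Longrightarrow> order_ge k (\<lambda>t. \<Sum>i\<in>I. f i t)"
proof (induction I rule: infinite_finite_induct)
  case (insert x F)
  then show ?case by (simp add: order_ge_add)
qed (simp_all add: order_ge_def exI[of _ 0] exI[of _ 1])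

lemma order_ge_trilinear:
  fixes T :: "'a::euclidean_space \<Rightarrow> 'b::euclidean_space \<Rightarrow> 'c::euclidean_space \<Rightarrow> 'd::real_normed_vector"
  assumes l: "\<And>v w. linear (\<lambda>u. T u v w)" "\<And>u w. linear (\<lambda>v. T u v w)" "\<And>u v. linear (\<lambda>w. T u v w)"
    and o: "order_ge i f" "order_ge j g" "order_ge k h"
  shows "order_ge (i + (j + k)) (\<lambda>t. T (f t) (g t) (h t))"
proof -
  have "bounded_bilinear (T b)" for b
    using l(2,3) by (simp add: bilinear_def flip: bilinear_conv_bounded_bilinear)
  then have "order_ge (i + (j + k)) (\<lambda>t. (f t \<bullet> b) *\<^sub>R T b (g t) (h t))" for b
    by (intro order_ge_bilinear[OF bounded_bilinear_scaleR] order_ge_bilinear o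
        order_ge_linear[OF bounded_linear_inner_left o(1)])
  then have "order_ge (i + (j + k)) (\<lambda>t. \<Sum>b\<in>Basis. (f t \<bullet> b) *\<^sub>R T b (g t) (h t))"
    by (rule order_ge_sum)
  then show ?thesis by (simp flip: linear_basis_expand[OF l(1)])
qed

lemma order_ge_bilinear_form:
  fixes B :: "'a::euclidean_space \<Rightarrow> 'b::euclidean_space \<Rightarrow> 'd::real_normed_vector"
  assumes l: "\<And>v. linear (\<lambda>u. B u v)" "\<And>u. linear (\<lambda>v. B u v)"
    and o: "order_ge i f" "order_ge j g"
  shows "order_ge (i + j) (\<lambda>t. B (f t) (g t))"
proof -
  have "bounded_bilinear B"
    using l by (simp add: bilinear_def flip: bilinear_conv_bounded_bilinear)
  then show ?thesis using o by (rule order_ge_bilinear)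
qed

lemma order_ge_eventually_mem:
  assumes "order_ge 1 v" "open D" "0 \<in> D"
  shows "\<exists>d>0. \<forall>t. 0 < t \<and> t < d \<longrightarrow> v t \<in> D"
proof -
  obtain C e where C: "C \<ge> 0" "e > 0" "e \<le> 1" "\<And>t. 0 < t \<Longrightarrow> t < e \<Longrightarrow> norm (v t) \<le> C * t ^ 1"
    using order_geE[OF assms(1)] by metis
  obtain r where r: "r > 0" "ball 0 r \<subseteq> D" using assms(2,3) by (meson open_contains_ball)
  show ?thesis
  proof (intro exI[of _ "min e (r / (C + 1))"] conjI allI impI)
    show "min e (r / (C + 1)) > 0" using C r by simp
    fix t assume t: "0 < t \<and> t < min e (r / (C + 1))"
    have "norm (v t) \<le> C * t" using C(4)[of t] t by simp
    also have "\<dots> \<le> (C + 1) * t" using t by simp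
    also have "\<dots> < r" using t C by (simp add: pos_less_divide_eq mult.commute)
    finally show "v t \<in> D" using r by auto
  qed
qed

text \<open>Replacing \<open>z\<close> by \<open>z + q\<close> changes the quadratic part of the
  model by \<open>2 * Re (model2 r s z q)\<close> up to order four. As \<open>eps\<close> squares to
  one on the nondegenerate directions and vanishes on the others, this choice of \<open>q\<close>
  produces exactly the cubic terms with third index up to \<open>r + s\<close>; the rest is what the
  model retains.\<close>

lemma model3_split:
  fixes z :: "complex ^ ('n::{finite,linorder})"
  assumes q: "\<And>\<gamma>. q $ \<gamma> = eps r s \<gamma> * (\<Sum>\<alpha>\<in>UNIV. \<Sum>\<beta>\<in>UNIV. cnj (k \<alpha> \<beta> \<gamma>) * z $ \<alpha> * z $ \<beta>)"
  shows "Re (model2 r s z q) + Re (model3 r s k z z z) =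
    Re (\<Sum>\<alpha>\<in>UNIV. \<Sum>\<beta>\<in>UNIV. \<Sum>\<gamma>\<in>UNIV. k \<alpha> \<beta> \<gamma> * cnj (z $ \<alpha>) * cnj (z $ \<beta>) * z $ \<gamma>)"
proof -
  let ?m = "\<lambda>\<alpha> \<beta> \<gamma>. k \<alpha> \<beta> \<gamma> * cnj (z $ \<alpha>) * cnj (z $ \<beta>) * z $ \<gamma>"
  have "model2 r s z q = (\<Sum>\<gamma>\<in>UNIV. eps r s \<gamma> * cnj (z $ \<gamma>) * q $ \<gamma>)"
    by (simp add: model2_def gmat_def if_distrib[of "\<lambda>x. x * _"] sum.delta' cong: if_cong)
  also have "\<dots> = (\<Sum>\<gamma>\<in>UNIV. cnj (\<Sum>\<alpha>\<in>UNIV. \<Sum>\<beta>\<in>UNIV. if r + s < pos \<gamma> then 0 else ?m \<alpha> \<beta> \<gamma>))"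
    by (rule sum.cong[OF refl]) (simp add: q eps_def sum_distrib_left mult_ac)
  finally have "Re (model2 r s z q) = Re (\<Sum>\<gamma>\<in>UNIV. \<Sum>\<alpha>\<in>UNIV. \<Sum>\<beta>\<in>UNIV. if r + s < pos \<gamma> then 0 else ?m \<alpha> \<beta> \<gamma>)"
    by (simp only: Re_sum complex_cnj_cancel_iff cnj.sel)
  also have "(\<Sum>\<gamma>\<in>UNIV. \<Sum>\<alpha>\<in>UNIV. \<Sum>\<beta>\<in>UNIV. if r + s < pos \<gamma> then 0 else ?m \<alpha> \<beta> \<gamma>) =
      (\<Sum>\<alpha>\<in>UNIV. \<Sum>\<gamma>\<in>UNIV. \<Sum>\<beta>\<in>UNIV. if r + s < pos \<gamma> then 0 else ?m \<alpha> \<beta> \<gamma>)"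
    by (rule sum.swap)
  also have "\<dots> = (\<Sum>\<alpha>\<in>UNIV. \<Sum>\<beta>\<in>UNIV. \<Sum>\<gamma>\<in>UNIV. if r + s < pos \<gamma> then 0 else ?m \<alpha> \<beta> \<gamma>)"
    by (rule sum.cong[OF refl]) (rule sum.swap)
  finally have 1: "Re (model2 r s z q) = Re (\<Sum>\<alpha>\<in>UNIV. \<Sum>\<beta>\<in>UNIV. \<Sum>\<gamma>\<in>UNIV. if r + s < pos \<gamma> then 0 else ?m \<alpha> \<beta> \<gamma>)" .
  have 2: "model3 r s k z z z = (\<Sum>\<alpha>\<in>UNIV. \<Sum>\<beta>\<in>UNIV. \<Sum>\<gamma>\<in>UNIV. if r + s < pos \<gamma> then ?m \<alpha> \<beta> \<gamma> else 0)"
    unfolding model3_def by (rule sum.cong[OF refl], rule sum.cong[OF refl]) (simp add: sum.If_cases)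
  show ?thesis
    unfolding 1 2 plus_complex.simps(1)[symmetric] sum.distrib[symmetric]
    by (rule arg_cong[of _ _ Re], intro sum.cong refl) simp
qed

subsection \<open>Normalizing a defining function\<close>

text \<open>In the coordinates \<open>F (z, w) = (z + q z, w + a z + m z * w + b z)\<close> the quadratic polynomial \<open>a\<close> removes
  the pure second order terms, \<open>m\<close> the terms \<open>z * Re w\<close>, \<open>b\<close> the pure third order terms and \<open>q\<close> the
  third order terms along the nondegenerate directions of the Levi form.\<close>

lemma normalized_normal_form:
  fixes \<rho> :: "('n::{finite,linorder}) amb \<Rightarrow> real"
  assumes \<rho>: "cinf_on W \<rho>" and W0: "0 \<in> W" and \<rho>0: "\<rho> 0 = 0" and d1: "\<And>v. dd [v] \<rho> 0 = - Im (snd v)"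
    and levi: "\<And>u v. snd u = 0 \<Longrightarrow> snd v = 0 \<Longrightarrow> lev2 (\<lambda>u v. dd [u, v] \<rho> 0) u v = 4 * model2 r s (fst u) (fst v)"
  shows "\<exists>F U U' h R. 0 \<in> U \<and> U \<subseteq> W \<and> hol_coords U F \<and> F 0 = 0 \<and> (\<forall>v. dd [v] F 0 = v) \<and>
    (\<forall>\<alpha> \<beta> \<gamma>. h \<alpha> \<beta> \<gamma> = h \<beta> \<alpha> \<gamma>) \<and> weighted_vanish4 R \<and> open U' \<and> 0 \<in> U' \<and> U' \<subseteq> U \<and>
    (\<forall>x\<in>U'. \<rho> x = 0 \<longleftrightarrow> rho_model r s h R (F x) = 0)"
proof -
  define E :: "'n amb \<Rightarrow> 'n amb" where "E u = (fst u, 0)" for u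
  have E: "E (u + v) = E u + E v" "E (c *\<^sub>R u) = c *\<^sub>R E u" "E (Jc u) = Jc (E u)" "fst (E u) = fst u" "snd (E u) = 0" for u v c
    by (simp_all add: E_def amb_eq_iff)
  define D2 where "D2 u v = dd [u, v] \<rho> 0" for u v
  define D3 where "D3 t u v = dd [t, u, v] \<rho> 0" for t u v
  have l2: "linear (\<lambda>u. D2 u v)" "linear (\<lambda>v. D2 u v)" for u v
    unfolding D2_def by (rule linear_dd2[OF \<rho> W0])+
  have l3: "linear (\<lambda>t. D3 t u v)" "linear (\<lambda>u. D3 t u v)" "linear (\<lambda>v. D3 t u v)" for t u v
    unfolding D3_def by (rule linear_dd3[OF \<rho> W0])+
  note r2 = linear_add[OF l2(1)] linear_add[OF l2(2)] linear_scale[OF l2(1)] linear_scale[OF l2(2)] linear_neg[OF l2(1)] linear_neg[OF l2(2)]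
  note r3 = linear_add[OF l3(1)] linear_add[OF l3(2)] linear_add[OF l3(3)] linear_scale[OF l3(1)] linear_scale[OF l3(2)] linear_scale[OF l3(3)]
  have sym2: "D2 u v = D2 v u" for u v unfolding D2_def by (rule dd_swap[OF \<rho> W0])
  have levi': "D2 (Jc (E u)) (Jc (E v)) = 4 * Re (model2 r s (fst u) (fst v)) - D2 (E u) (E v)"
    "D2 (Jc (E u)) (E v) = 4 * Im (model2 r s (fst u) (fst v)) + D2 (E u) (Jc (E v))" for u v
    using levi[of "E u" "E v"] by (simp_all add: E lev2_def complex_eq_iff D2_def)
  \<comment> \<open>The Hessian in the directions of \<open>z\<close> without its Levi part. It
    changes sign when \<open>Jc\<close> is applied in both slots, and is therefore the real part of
    the complex bilinear form \<open>P\<close>.\<close>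
  define D' where "D' u v = D2 (E u) (E v) - 2 * Re (model2 r s (fst u) (fst v))" for u v
  have D'J: "D' (Jc u) (Jc v) = - D' u v" "D' (Jc u) v = D' u (Jc v)" for u v
    by (simp_all add: D'_def E levi' model2_simps)
  have D'l: "linear (\<lambda>u. D' u v)" "linear (\<lambda>v. D' u v)" for u v
    by (rule linearI; simp add: D'_def E r2 model2_simps algebra_simps)+
  note rD' = linear_add[OF D'l(1)] linear_add[OF D'l(2)] linear_scale[OF D'l(1)] linear_scale[OF D'l(2)] linear_neg[OF D'l(1)] linear_neg[OF D'l(2)]
  define P where "P u v = Complex (D' u v) (- D' (Jc u) v)" for u v
  have Pl: "linear (\<lambda>u. P u v)" "linear (\<lambda>v. P u v)" for u v
    by (rule linearI; simp add: P_def rD' Jc_simps complex_eq_iff)+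
  have PJ: "P (Jc u) v = \<i> * P u v" "P u (Jc v) = \<i> * P u v" for u v
    using D'J(1)[of u v] D'J(2)[of u v] by (simp_all add: P_def Jc_simps rD' complex_eq_iff)
  define l1 where "l1 u = D2 (E u) (0, 1)" for u
  define l2' where "l2' u = D2 (E u) (0, \<i>)" for u
  have ll: "linear l1" "linear l2'"
    by (rule linearI; simp add: l1_def l2'_def E r2)+
  \<comment> \<open>The complex linear form with imaginary part \<open>- l1\<close>: then
    \<open>Im (m u * w)\<close> cancels the term \<open>Re w * l1 u\<close> of the
    expansion.\<close>
  define m where "m u = Complex (- l1 (Jc u)) (- l1 u)" for u
  have ml: "linear m"
    by (rule linearI) (simp_all add: m_def linear_add[OF ll(1)] linear_scale[OF ll(1)] Jc_simps complex_eq_iff)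
  have mJ: "m (Jc u) = \<i> * m u" for u
    by (simp add: m_def Jc_simps linear_neg[OF ll(1)] complex_eq_iff)
  \<comment> \<open>That correction also creates \<open>Re (m u) * Im w\<close>, which joins the
    coefficient \<open>l2'\<close> of \<open>Im w\<close>.\<close>
  define l where "l u = l2' u + Re (m u)" for u
  have linl: "linear l"
    unfolding l_def by (intro linear_compose_add ll) (rule linearI; simp add: linear_add[OF ml] linear_scale[OF ml])
  \<comment> \<open>On the hypersurface \<open>Im w\<close> is half the Hessian in the directions of
    \<open>z\<close> up to order three, so \<open>Im w * l\<close> counts as cubic in
    \<open>z\<close> and is normalized together with the third derivative.\<close>
  define K where "K x y z = D2 (x, 0) (y, 0) * l (z, 0) / 2 + D3 (x, 0) (y, 0) (z, 0) / 6" for x y z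
  have pair: "(x + y, 0 :: complex) = (x, 0) + (y, 0)" "(c *\<^sub>R x, 0 :: complex) = c *\<^sub>R (x, 0)" for x y :: "complex ^ ('n::{finite,linorder})" and c
    by simp_all
  have Kl: "linear (\<lambda>x. K x y z)" "linear (\<lambda>y. K x y z)" "linear (\<lambda>z. K x y z)" for x y z
    by (rule linearI; unfold K_def pair; simp add: r2 r3 linear_add[OF linl] linear_scale[OF linl] field_simps del: add_Pair scaleR_Pair)+
  obtain B k where ksym: "\<forall>\<alpha> \<beta> \<gamma>. k \<alpha> \<beta> \<gamma> = k \<beta> \<alpha> \<gamma>" and BK: "\<And>z. K z z z =
      Re (\<Sum>\<alpha>\<in>UNIV. \<Sum>\<beta>\<in>UNIV. \<Sum>\<gamma>\<in>UNIV. B \<alpha> \<beta> \<gamma> * z $ \<alpha> * z $ \<beta> * z $ \<gamma>) +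
       2 * Re (\<Sum>\<alpha>\<in>UNIV. \<Sum>\<beta>\<in>UNIV. \<Sum>\<gamma>\<in>UNIV. k \<alpha> \<beta> \<gamma> * cnj (z $ \<alpha>) * cnj (z $ \<beta>) * z $ \<gamma>)"
    using trilinear_vec_decomposition[OF Kl] by blast
  define Bt where "Bt t u v = (\<Sum>\<alpha>\<in>UNIV. \<Sum>\<beta>\<in>UNIV. \<Sum>\<gamma>\<in>UNIV. B \<alpha> \<beta> \<gamma> * fst t $ \<alpha> * fst u $ \<beta> * fst v $ \<gamma>)" for t u v :: "'n amb"
  have Btl: "linear (\<lambda>t. Bt t u v)" "linear (\<lambda>u. Bt t u v)" "linear (\<lambda>v. Bt t u v)" for t u v
    by (rule linearI; simp add: Bt_def algebra_simps sum.distrib scaleR_sum_right)+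
  define qb where "qb u v = (\<chi> \<gamma>. eps r s \<gamma> * (\<Sum>\<alpha>\<in>UNIV. \<Sum>\<beta>\<in>UNIV. cnj (k \<alpha> \<beta> \<gamma>) * fst u $ \<alpha> * fst v $ \<beta>))" for u v :: "'n amb"
  have qbl: "linear (\<lambda>u. qb u v)" "linear (\<lambda>v. qb u v)" for u v
    by (rule linearI; simp add: qb_def vec_eq_iff algebra_simps sum.distrib sum_distrib_left scaleR_conv_of_real[where 'a=complex])+
  \<comment> \<open>The factors are such that the first and last terms have imaginary parts
    \<open>- D' u u / 2\<close> and \<open>- Re (Bt u u u)\<close>.\<close>
  define N where "N u = - (\<i> / 2) * P u u + m u * snd u + - \<i> * Bt u u u" for u
  define F where "F u = (fst u + qb u u, snd u + N u)" for u
  have holoF: "holo_on W F"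
  proof (rule holo_on_components[OF cinf_on_open[OF \<rho>]])
    show "chol (\<lambda>x. fst (F x) $ j)" for j
      unfolding F_def qb_def by (simp, intro chol_add chol_mult chol_sum chol_const chol_coordinates)
    show "chol (\<lambda>x. snd (F x))"
      unfolding F_def N_def Bt_def snd_conv
      by (intro chol_add chol_mult chol_sum chol_const chol_coordinates chol_quadratic[OF Pl PJ] chol_linear[OF ml mJ])
  qed
  note sF = cinf_on_holo[OF holoF]
  have F0: "F 0 = 0"
    using linear_0[OF Pl(1)] linear_0[OF ml] linear_0[OF Btl(1)] linear_0[OF qbl(1)] by (simp add: F_def N_def zero_prod_def)
  have dF: "dd [v] F 0 = v" for v
  proof (rule has_vector_derivative_imp_dd)
    note sc = linear_scale[OF Pl(1)] linear_scale[OF Pl(2)] linear_scale[OF ml] linear_scale[OF qbl(1)] linear_scale[OF qbl(2)]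
      linear_scale[OF Btl(1)] linear_scale[OF Btl(2)] linear_scale[OF Btl(3)]
    have "F (0 + t *\<^sub>R v) = t *\<^sub>R v + t\<^sup>2 *\<^sub>R (qb v v, - (\<i> / 2) * P v v + m v * snd v) + t ^ 3 *\<^sub>R (0, - \<i> * Bt v v v)" for t
      by (simp add: F_def N_def sc prod_eq_iff power2_eq_square power3_eq_cube scaleR_conv_of_real[where 'a=complex] algebra_simps)
    then show "((\<lambda>t. F (0 + t *\<^sub>R v)) has_vector_derivative v) (at 0)"
      by (auto intro!: derivative_eq_intros simp: zero_prod_def)
  qed
  have "bij (\<lambda>v. dd [v] F 0)" unfolding dF by (rule bij_id[unfolded id_def])
  then obtain U where U: "0 \<in> U" "U \<subseteq> W" "hol_coords U F"
    by (rule hol_coords_local[OF holoF W0])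
  obtain \<Psi> where \<Psi>: "holo_on (F ` U) \<Psi>" "\<And>x. x \<in> U \<Longrightarrow> \<Psi> (F x) = x" and hU: "holo_on U F" and oV: "open (F ` U)"
    using U(3) by (auto simp: hol_coords_def)
  define V where "V = F ` U"
  have V0: "0 \<in> V" using U(1) F0 by (force simp: V_def)
  have \<Psi>0: "\<Psi> 0 = 0" using \<Psi>(2)[OF U(1)] F0 by simp
  have V\<Psi>: "\<Psi> y \<in> U" "F (\<Psi> y) = y" if "y \<in> V" for y using that \<Psi>(2) by (auto simp: V_def)
  have s\<Psi>: "cinf_on V \<Psi>" unfolding V_def by (rule cinf_on_holo[OF \<Psi>(1)])
  have d\<Psi>: "dd [v] \<Psi> 0 = v" for v
  proof -
    have "dd [dd [v] F 0] \<Psi> (F 0) = dd [v] (\<lambda>x. \<Psi> (F x)) 0"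
      by (rule dd_field_compose(1)[OF s\<Psi> cinf_on_holo[OF hU] cinf_on_holo[OF hU] _ U(1), symmetric]) (simp add: V_def)
    also have "\<dots> = dd [v] (\<lambda>x. x) 0"
      by (rule dd_cong[OF cinf_on_open[OF cinf_on_holo[OF hU]] \<Psi>(2) U(1)])
    finally show ?thesis by (simp add: dF F0 dd_ident)
  qed
  define f where "f y = \<rho> (\<Psi> y)" for y
  have sf: "cinf_on V f" unfolding f_def[abs_def]
    by (rule cinf_on_compose[OF \<rho> s\<Psi>]) (use V\<Psi>(1) U(2) in blast)
  have f0: "f 0 = 0" by (simp add: f_def \<Psi>0 \<rho>0)
  have "dd [v] f 0 = - Im (snd v)" for v
    unfolding f_def[abs_def] using dd_field_compose(1)[OF \<rho> s\<Psi> s\<Psi> _ V0, of v] V\<Psi>(1) U(2) by (auto simp: d\<Psi> \<Psi>0 d1)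
  then have "dd [(0, \<i>)] f 0 \<noteq> 0" by simp
  then obtain U2 D \<phi> where U2: "open U2" "0 \<in> U2" "U2 \<subseteq> V" "cinf_on D \<phi>" "(0 :: (complex ^ ('n::{finite,linorder})) \<times> real) \<in> D" "\<phi> 0 = 0"
    "\<forall>x\<in>D. (fst x, Complex (snd x) (\<phi> x)) \<in> V \<and> f (fst x, Complex (snd x) (\<phi> x)) = 0"
    "\<forall>Z\<in>U2. f Z = 0 \<longleftrightarrow> Im (snd Z) = \<phi> (fst Z, Re (snd Z))"
    by (rule implicit_graph[OF sf V0 f0])
  define R where "R x = \<phi> x - Re (model2 r s (fst x) (fst x)) - 2 * Re (model3 r s k (fst x) (fst x) (fst x))" for x
  have oD: "open D" by (rule cinf_on_open[OF U2(4)])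
  have sR: "cinf_on D R"
  proof -
    have "cinf_on D (\<lambda>x. Re (model2 r s (fst x) (fst x)))"
      by (rule cinf_on_bilinear_diag[OF oD]; rule linearI; simp add: model2_simps)
    moreover have "cinf_on D (\<lambda>x. 2 * Re (model3 r s k (fst x) (fst x) (fst x)))"
      by (rule cinf_on_trilinear_diag[OF oD]; rule linearI; simp add: model3_simps)
    ultimately show ?thesis unfolding R_def[abs_def] by (intro cinf_on_diff U2(4))
  qed
  have wv: "weighted_vanish4 R"
  proof (rule weighted_vanish4I[OF sR U2(5)])
    fix z0 :: "complex ^ ('n::{finite,linorder})" and u0 :: real
    define x' where "x' t = (t *\<^sub>R z0, t\<^sup>2 * u0)" for t
    define Z' where "Z' t = (t *\<^sub>R z0, Complex (t\<^sup>2 * u0) (\<phi> (x' t)))" for t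
    \<comment> \<open>The curve is prescribed in the new coordinates, where the weighted order is
      tested; \<open>Z t\<close> is the same point in the old coordinates, where
      \<open>\<rho>\<close> is expanded.\<close>
    define Z where "Z t = \<Psi> (Z' t)" for t
    define w where "w t = snd (Z t)" for t
    have tz: "order_ge 1 (\<lambda>t. t *\<^sub>R z0)" using order_ge_power[of 1 z0] by simp
    have tu: "order_ge 2 (\<lambda>t. t\<^sup>2 * u0)" using order_ge_power[of 2 u0] by simp
    have ox: "order_ge 1 x'" unfolding x'_def[abs_def] by (intro order_ge_Pair tz order_ge_mono[OF tu]) auto
    have o\<phi>: "order_ge 1 (\<lambda>t. \<phi> (x' t))"
      by (rule order_ge_differentiable[OF cinf_on_has_derivative[OF U2(4,5)] U2(6) ox])
    have oZ': "order_ge 1 Z'"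
      unfolding Z'_def[abs_def] Complex_eq
      by (intro order_ge_Pair tz order_ge_add order_ge_linear[OF bounded_linear_of_real] order_ge_mono[OF tu]
          order_ge_linear[OF bounded_linear_mult_right] o\<phi>) auto
    have oZ: "order_ge 1 Z"
      unfolding Z_def[abs_def] by (rule order_ge_differentiable[OF cinf_on_has_derivative[OF s\<Psi> V0] \<Psi>0 oZ'])
    obtain d where d: "d > 0" "\<And>t. 0 < t \<Longrightarrow> t < d \<Longrightarrow> x' t \<in> D"
      using order_ge_eventually_mem[OF ox oD U2(5)] by blast
    have mem: "F (Z t) = Z' t" "\<rho> (Z t) = 0" if t: "0 < t" "t < d" for t
    proof -
      have "Z' t \<in> V" "f (Z' t) = 0" using U2(7) d(2)[OF t] by (auto simp: Z'_def x'_def)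
      then show "F (Z t) = Z' t" "\<rho> (Z t) = 0" using V\<Psi>(2) by (auto simp: Z_def f_def)
    qed
    have blE: "bounded_linear E" unfolding linear_conv_bounded_linear[symmetric] by (rule linearI) (simp_all add: E)
    have oE: "order_ge 1 (\<lambda>t. E (Z t))" by (rule order_ge_linear[OF blE oZ])
    have oD2: "order_ge 2 (\<lambda>t. D2 (g t) (h t))" if "order_ge 1 g" "order_ge 1 h" for g h
      using order_ge_bilinear_form[OF l2 that] by (simp add: numeral_2_eq_2)
    have oP: "order_ge 2 (\<lambda>t. P (Z t) (Z t))"
      using order_ge_bilinear_form[OF Pl oZ oZ] by (simp add: numeral_2_eq_2)
    have ow1: "order_ge 1 w" unfolding w_def[abs_def] by (rule order_ge_linear[OF bounded_linear_snd oZ])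
    have om: "order_ge 1 (\<lambda>t. m (Z t))" by (rule order_ge_linear[OF _ oZ]) (use ml in \<open>simp add: linear_conv_bounded_linear\<close>)
    have omw: "order_ge 2 (\<lambda>t. m (Z t) * w t)"
      using order_ge_bilinear[OF bounded_bilinear_mult om ow1] by (simp add: numeral_2_eq_2)
    have oB: "order_ge 3 (\<lambda>t. Bt (Z t) (Z t) (Z t))"
      using order_ge_trilinear[OF Btl oZ oZ oZ] by (simp add: numeral_3_eq_3)
    have oN: "order_ge 2 (\<lambda>t. N (Z t))"
      unfolding N_def w_def[symmetric]
      by (intro order_ge_add omw order_ge_linear[OF bounded_linear_mult_right] oP order_ge_mono[OF oB]) auto
    define e1 where "e1 t = \<rho> (Z t) - (\<rho> 0 + dd [Z t] \<rho> 0 + dd [Z t, Z t] \<rho> 0 / 2 + dd [Z t, Z t, Z t] \<rho> 0 / 6)" for t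
    have oe1: "order_ge 4 e1" unfolding e1_def[abs_def] by (rule order_ge_Taylor3[OF \<rho> W0 oZ])
    have oD3: "order_ge 3 (\<lambda>t. D3 (Z t) (Z t) (Z t))"
      using order_ge_trilinear[OF l3 oZ oZ oZ] by (simp add: numeral_3_eq_3)
    have y: "Im (w t) = e1 t + D2 (Z t) (Z t) / 2 + D3 (Z t) (Z t) (Z t) / 6" if "0 < t" "t < d" for t
      using mem(2)[OF that] by (simp add: e1_def \<rho>0 d1 w_def D2_def D3_def)
    have half: "order_ge j (\<lambda>t. g t / c)" if "order_ge j g" for j c and g :: "real \<Rightarrow> real"
      using order_ge_linear[OF bounded_linear_divide that] .
    \<comment> \<open>The equation \<open>\<rho> (Z t) = 0\<close> raises the order of
      \<open>Im w\<close> from one to two. For \<open>Re w\<close> the same follows from the new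
      coordinates, which prescribe it as \<open>t^2 u0\<close> up to \<open>N\<close>.\<close>
    have oy: "order_ge 2 (\<lambda>t. Im (w t))"
      by (rule order_ge_cong[OF order_ge_add[OF order_ge_add[OF order_ge_mono[OF oe1] half[OF oD2[OF oZ oZ]]] half[OF order_ge_mono[OF oD3]]] d(1)])
        (use y in auto)
    have ou: "order_ge 2 (\<lambda>t. Re (w t))"
    proof (rule order_ge_cong[OF order_ge_diff[OF tu order_ge_linear[OF bounded_linear_Re oN]] d(1)])
      fix t assume t: "0 < t" "t < d"
      have "snd (F (Z t)) = Complex (t\<^sup>2 * u0) (\<phi> (x' t))" using mem(1)[OF t] by (simp add: Z'_def)
      then show "t\<^sup>2 * u0 - Re (N (Z t)) = Re (w t)" by (simp add: F_def w_def complex_eq_iff)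
    qed
    have ow: "order_ge 2 w"
    proof (rule order_ge_cong[of _ "\<lambda>t. of_real (Re (w t)) + \<i> * of_real (Im (w t))" 1])
      show "order_ge 2 (\<lambda>t. of_real (Re (w t)) + \<i> * of_real (Im (w t)))"
        by (intro order_ge_add order_ge_linear[OF bounded_linear_mult_right] order_ge_linear[OF bounded_linear_of_real] ou oy)
    qed (simp_all add: complex_eq_iff)
    have oW: "order_ge 2 (\<lambda>t. (0 :: complex ^ ('n::{finite,linorder}), w t))"
      by (rule order_ge_linear[OF _ ow]) (intro bounded_linear_Pair bounded_linear_zero bounded_linear_ident)
    have Zs: "Z t = E (Z t) + (0, w t)" for t by (simp add: E_def w_def prod_eq_iff)
    have ws: "(0, w t) = Re (w t) *\<^sub>R (0, 1) + Im (w t) *\<^sub>R (0 :: complex ^ ('n::{finite,linorder}), \<i>)" for t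
      by (simp add: prod_eq_iff complex_eq_iff)
    define e2 where "e2 t = D2 (0, w t) (0, w t) / 2" for t
    have oe2: "order_ge 4 e2"
      unfolding e2_def[abs_def] using half[OF order_ge_bilinear_form[OF l2 oW oW]] by simp
    \<comment> \<open>The variable \<open>w\<close> has order two, so every cubic term that contains
      it has order four.\<close>
    define e3 where "e3 t = (D3 (0, w t) (Z t) (Z t) + D3 (E (Z t)) (0, w t) (Z t) + D3 (E (Z t)) (E (Z t)) (0, w t)) / 6" for t
    have oe3: "order_ge 4 e3"
      unfolding e3_def[abs_def]
      using order_ge_trilinear[OF l3 oW oZ oZ] order_ge_trilinear[OF l3 oE oW oZ] order_ge_trilinear[OF l3 oE oE oW]
      by (intro half order_ge_add) (simp_all add: numeral_eq_Suc)
    have D3s: "D3 (Z t) (Z t) (Z t) / 6 = D3 (E (Z t)) (E (Z t)) (E (Z t)) / 6 + e3 t" for t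
    proof -
      have "D3 (Z t) (Z t) (Z t) = D3 (E (Z t)) (Z t) (Z t) + D3 (0, w t) (Z t) (Z t)"
        by (subst (1) Zs) (simp only: r3)
      also have "D3 (E (Z t)) (Z t) (Z t) = D3 (E (Z t)) (E (Z t)) (Z t) + D3 (E (Z t)) (0, w t) (Z t)"
        by (subst (2) Zs) (simp only: r3)
      also have "D3 (E (Z t)) (E (Z t)) (Z t) = D3 (E (Z t)) (E (Z t)) (E (Z t)) + D3 (E (Z t)) (E (Z t)) (0, w t)"
        by (subst (3) Zs) (simp only: r3)
      finally show ?thesis by (simp add: e3_def)
    qed
    have D2s: "D2 (Z t) (Z t) / 2 = D2 (E (Z t)) (E (Z t)) / 2 + Re (w t) * l1 (Z t) + Im (w t) * l2' (Z t) + e2 t" for t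
    proof -
      have "D2 (E (Z t)) (0, w t) = Re (w t) * l1 (Z t) + Im (w t) * l2' (Z t)"
        unfolding l1_def l2'_def by (subst ws) (simp only: r2 real_scaleR_def)
      moreover have "D2 (Z t) (Z t) = D2 (E (Z t)) (E (Z t)) + 2 * D2 (E (Z t)) (0, w t) + D2 (0, w t) (0, w t)"
      proof -
        have "D2 (Z t) (Z t) = D2 (E (Z t) + (0, w t)) (E (Z t) + (0, w t))"
          using Zs[of t] by (rule arg_cong2[of _ _ _ _ D2, OF _ Zs])
        then show ?thesis unfolding r2 using sym2[of "(0, w t)" "E (Z t)"] by simp
      qed
      ultimately show ?thesis by (simp add: e2_def)
    qed
    \<comment> \<open>The error of replacing \<open>Im w\<close> by half the Hessian in
      \<open>Im w * l\<close>: order three from the difference, order one from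
      \<open>l\<close>.\<close>
    define e4 where "e4 t = (Im (w t) - D2 (E (Z t)) (E (Z t)) / 2) * l (Z t)" for t
    have oe4: "order_ge 4 e4"
    proof -
      have ol1: "order_ge 1 (\<lambda>t. l1 (Z t))" and ol2: "order_ge 1 (\<lambda>t. l2' (Z t))" and ol: "order_ge 1 (\<lambda>t. l (Z t))"
        by (rule order_ge_linear[OF _ oZ]; use ll linl in \<open>simp add: linear_conv_bounded_linear\<close>)+
      have 1: "order_ge 3 (\<lambda>t. Re (w t) * l1 (Z t))" "order_ge 3 (\<lambda>t. Im (w t) * l2' (Z t))"
        using order_ge_bilinear[OF bounded_bilinear_mult ou ol1] order_ge_bilinear[OF bounded_bilinear_mult oy ol2]
        by (simp_all add: numeral_eq_Suc)
      have "order_ge 3 (\<lambda>t. Im (w t) - D2 (E (Z t)) (E (Z t)) / 2)"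
      proof (rule order_ge_cong[OF _ d(1)])
        show "order_ge 3 (\<lambda>t. e1 t + D3 (Z t) (Z t) (Z t) / 6 + e2 t + (Re (w t) * l1 (Z t) + Im (w t) * l2' (Z t)))"
          by (intro order_ge_add 1 half oD3 order_ge_mono[OF oe1] order_ge_mono[OF oe2]) auto
        fix t assume "0 < t" "t < d"
        from y[OF this] show "e1 t + D3 (Z t) (Z t) (Z t) / 6 + e2 t + (Re (w t) * l1 (Z t) + Im (w t) * l2' (Z t)) =
            Im (w t) - D2 (E (Z t)) (E (Z t)) / 2"
          unfolding D2s by linarith
      qed
      from order_ge_bilinear[OF bounded_bilinear_mult this ol] show ?thesis
        unfolding e4_def[abs_def] by (simp add: numeral_eq_Suc)
    qed
    define q where "q t = qb (Z t) (Z t)" for t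
    have oq: "order_ge 2 q" unfolding q_def[abs_def] using order_ge_bilinear_form[OF qbl oZ oZ] by (simp add: numeral_2_eq_2)
    define z where "z t = fst (Z t)" for t
    have oz: "order_ge 1 z" unfolding z_def[abs_def] by (rule order_ge_linear[OF bounded_linear_fst oZ])
    have m2l: "linear (\<lambda>u. model2 r s u v)" "linear (\<lambda>v. model2 r s u v)" for u v :: "complex ^ ('n::{finite,linorder})"
      by (rule linearI; simp add: model2_simps scaleR_conv_of_real[where 'a=complex])+
    have m3l: "linear (\<lambda>t. model3 r s k t u v)" "linear (\<lambda>u. model3 r s k t u v)" "linear (\<lambda>v. model3 r s k t u v)" for t u v
      by (rule linearI; simp add: model3_simps scaleR_conv_of_real[where 'a=complex])+
    \<comment> \<open>\<open>e5\<close> and \<open>e6\<close> are the changes of the model terms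
      from \<open>z\<close> to \<open>z + q\<close>, apart from the cross term of
      \<open>model2\<close> that is used in \<open>model3_split\<close>.\<close>
    define e5 where "e5 t = Re (model2 r s (q t) (q t))" for t
    have oe5: "order_ge 4 e5"
      unfolding e5_def[abs_def] using order_ge_linear[OF bounded_linear_Re order_ge_bilinear_form[OF m2l oq oq]] by simp
    have tz0: "t *\<^sub>R z0 = z t + q t" if "0 < t" "t < d" for t
      using mem(1)[OF that] by (simp add: F_def Z'_def z_def q_def)
    have oz': "order_ge 1 (\<lambda>t. z t + q t)" by (intro order_ge_add oz order_ge_mono[OF oq]) auto
    define e6 where "e6 t = 2 * Re (model3 r s k (q t) (z t + q t) (z t + q t) + model3 r s k (z t) (q t) (z t + q t) + model3 r s k (z t) (z t) (q t))" for t
    have oe6: "order_ge 4 e6"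
      unfolding e6_def[abs_def]
      using order_ge_trilinear[OF m3l oq oz' oz'] order_ge_trilinear[OF m3l oz oq oz'] order_ge_trilinear[OF m3l oz oz oq]
      by (intro order_ge_linear[OF bounded_linear_mult_right] order_ge_linear[OF bounded_linear_Re] order_ge_add) (simp_all add: numeral_eq_Suc)
    have eq: "e1 t + e2 t + e3 t + e4 t - e5 t - e6 t = R (t *\<^sub>R z0, t\<^sup>2 * u0)" if t: "0 < t" "t < d" for t
    proof -
      have EZ: "E (Z t) = (z t, 0)" by (simp add: E_def z_def)
      have "snd (F (Z t)) = Complex (t\<^sup>2 * u0) (\<phi> (x' t))" using mem(1)[OF t] by (simp add: Z'_def)
      then have \<phi>: "\<phi> (x' t) = Im (w t) + Im (N (Z t))" by (simp add: F_def w_def complex_eq_iff)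
      have N: "Im (N (Z t)) = - D' (Z t) (Z t) / 2 + Re (m (Z t)) * Im (w t) - Re (w t) * l1 (Z t) - Re (Bt (Z t) (Z t) (Z t))"
        by (simp add: N_def P_def w_def) (simp add: m_def mult.commute)
      have D': "D' (Z t) (Z t) = D2 (E (Z t)) (E (Z t)) - 2 * Re (model2 r s (z t) (z t))"
        by (simp add: D'_def z_def)
      have BB: "K (z t) (z t) (z t) - Re (Bt (Z t) (Z t) (Z t)) = 2 * (Re (model2 r s (z t) (q t)) + Re (model3 r s k (z t) (z t) (z t)))"
        unfolding BK Bt_def z_def[symmetric]
        by (subst model3_split[of "q t" r s k "z t"]) (simp_all add: q_def qb_def z_def)
      have lZ: "l (Z t) = l (z t, 0)" 
        by (simp add: l_def l2'_def m_def l1_def E_def z_def Jc_def)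
      have KK: "K (z t) (z t) (z t) = D2 (E (Z t)) (E (Z t)) / 2 * l (Z t) + D3 (E (Z t)) (E (Z t)) (E (Z t)) / 6"
        by (simp add: K_def EZ lZ)
      have m2: "Re (model2 r s (z t + q t) (z t + q t)) = Re (model2 r s (z t) (z t)) + 2 * Re (model2 r s (z t) (q t)) + e5 t"
        using model2_hermitian[of r s "q t" "z t"] by (simp add: model2_simps e5_def)
      have m3: "2 * Re (model3 r s k (z t + q t) (z t + q t) (z t + q t)) = 2 * Re (model3 r s k (z t) (z t) (z t)) + e6 t"
        by (simp add: model3_simps e6_def)
      have c1: "R (t *\<^sub>R z0, t\<^sup>2 * u0) = Im (w t) + Im (N (Z t)) - Re (model2 r s (z t + q t) (z t + q t)) - 2 * Re (model3 r s k (z t + q t) (z t + q t) (z t + q t))"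
        unfolding R_def fst_conv tz0[OF t] using \<phi> by (simp add: x'_def tz0[OF t])
      have c2: "Im (w t) = e1 t + (D2 (E (Z t)) (E (Z t)) / 2 + Re (w t) * l1 (Z t) + Im (w t) * l2' (Z t) + e2 t) + (D3 (E (Z t)) (E (Z t)) (E (Z t)) / 6 + e3 t)"
        using y[OF t] unfolding D2s D3s .
      have c3: "Im (w t) * l (Z t) = e4 t + D2 (E (Z t)) (E (Z t)) / 2 * l (Z t)"
        by (simp add: e4_def algebra_simps)
      have c4: "Im (w t) * l (Z t) = Im (w t) * l2' (Z t) + Re (m (Z t)) * Im (w t)"
        by (simp add: l_def algebra_simps)
      \<comment> \<open>With the occurring quantities abstracted to variables, the cancellation is
        linear. The premises are the definition of \<open>R\<close> in the new coordinates, the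
        equation of the hypersurface in the old ones, two expressions for \<open>Im w * l\<close>,
        and the choice of \<open>B\<close> and \<open>q\<close>.\<close>
      have alg: "a1 + a2 + a3 + a4 - a5 - a6 = x"
        if "x = v + (- (d - 2 * g) / 2 + mv - ul - b) - (g + 2 * gq + a5) - (2 * h + a6)"
          "v = a1 + (d / 2 + ul + vl + a2) + (c / 6 + a3)" "vL = a4 + dl" "vL = vl + mv" "dl + c / 6 - b = 2 * (gq + h)"
        for a1 a2 a3 a4 a5 a6 x v d g mv ul b gq h vl c vL dl :: real
        using that by argo
      show ?thesis
        by (rule alg[OF c1[unfolded N D' m2 m3] c2 c3 c4 BB[unfolded KK]])
    qed
    have "order_ge 4 (\<lambda>t. e1 t + e2 t + e3 t + e4 t - e5 t - e6 t)"
      by (intro order_ge_add order_ge_diff oe1 oe2 oe3 oe4 oe5 oe6)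
    then show "order_ge 4 (\<lambda>t. R (t *\<^sub>R z0, t\<^sup>2 * u0))"
      by (rule order_ge_cong[OF _ d(1) eq])
  qed
  define U' where "U' = F -` U2 \<inter> U"
  have "open U'"
    unfolding U'_def using continuous_on_open_vimage[OF cinf_on_open[OF cinf_on_holo[OF hU]]]
      cinf_on_continuous[OF cinf_on_holo[OF hU]] U2(1) by blast
  moreover have "0 \<in> U'" "U' \<subseteq> U" using U(1) F0 U2(2) by (auto simp: U'_def)
  moreover have "\<forall>x\<in>U'. \<rho> x = 0 \<longleftrightarrow> rho_model r s k R (F x) = 0"
  proof
    fix x assume x: "x \<in> U'"
    then have "\<rho> x = f (F x)" using \<Psi>(2) by (simp add: U'_def f_def)
    also have "f (F x) = 0 \<longleftrightarrow> Im (snd (F x)) = \<phi> (fst (F x), Re (snd (F x)))"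
      using U2(8) x by (auto simp: U'_def)
    also have "\<dots> \<longleftrightarrow> rho_model r s k R (F x) = 0"
      unfolding rho_model_eq R_def by auto
    finally show "\<rho> x = 0 \<longleftrightarrow> rho_model r s k R (F x) = 0" .
  qed
  ultimately show ?thesis using U F0 dF ksym wv by blast
qed

subsection \<open>From frames to coordinates\<close>

lemma dd_translate: "dd vs (\<lambda>y. f (p + y)) y = dd vs f (p + y)"
  by (induction vs arbitrary: y) (simp_all add: dd.simps(2) add.assoc)

text \<open>The first slot enters as \<open>A + \<i> J A\<close>, antilinear in \<open>A\<close>;
  the second enters through the conjugate and is linear.\<close>

lemma lev2_cs:
  fixes T :: "'n::finite amb \<Rightarrow> 'n amb \<Rightarrow> real"
  assumes l: "\<And>v. linear (\<lambda>u. T u v)" "\<And>u. linear (\<lambda>v. T u v)"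
  shows "lev2 T (cs a u) v = cnj a * lev2 T u v" "lev2 T u (cs b v) = b * lev2 T u v"
proof -
  note r = linear_add[OF l(1)] linear_add[OF l(2)] linear_scale[OF l(1)] linear_scale[OF l(2)]
    linear_neg[OF l(1)] linear_neg[OF l(2)] linear_diff[OF l(1)] linear_diff[OF l(2)]
  show "lev2 T (cs a u) v = cnj a * lev2 T u v" "lev2 T u (cs b v) = b * lev2 T u v"
    by (simp_all add: lev2_def cs_eq_Jc Jc_simps r complex_eq_iff algebra_simps)
qed

lemma lev2_sum_cs:
  fixes T :: "'n::finite amb \<Rightarrow> 'n amb \<Rightarrow> real"
  assumes l: "\<And>v. linear (\<lambda>u. T u v)" "\<And>u. linear (\<lambda>v. T u v)"
  shows "lev2 T (\<Sum>\<alpha>\<in>I. cs (a \<alpha>) (A \<alpha>)) (\<Sum>\<beta>\<in>J. cs (b \<beta>) (B \<beta>)) = (\<Sum>\<alpha>\<in>I. \<Sum>\<beta>\<in>J. cnj (a \<alpha>) * b \<beta> * lev2 T (A \<alpha>) (B \<beta>))"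
proof -
  have 1: "linear (\<lambda>u. lev2 T u v)" "linear (\<lambda>v. lev2 T u v)" for u v
    by (rule linearI; simp add: lev2_def Jc_simps linear_add[OF l(1)] linear_add[OF l(2)]
        linear_scale[OF l(1)] linear_scale[OF l(2)] complex_eq_iff algebra_simps)+
  have "lev2 T (\<Sum>\<alpha>\<in>I. cs (a \<alpha>) (A \<alpha>)) (\<Sum>\<beta>\<in>J. cs (b \<beta>) (B \<beta>)) = (\<Sum>\<alpha>\<in>I. lev2 T (cs (a \<alpha>) (A \<alpha>)) (\<Sum>\<beta>\<in>J. cs (b \<beta>) (B \<beta>)))"
    by (rule linear_sum[OF 1(1)])
  also have "\<dots> = (\<Sum>\<alpha>\<in>I. \<Sum>\<beta>\<in>J. lev2 T (cs (a \<alpha>) (A \<alpha>)) (cs (b \<beta>) (B \<beta>)))"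
    by (rule sum.cong[OF refl]) (rule linear_sum[OF 1(2)])
  finally show ?thesis by (simp add: lev2_cs[OF l] mult_ac)
qed

lemma rho_model_cong:
  assumes "\<And>\<alpha> \<beta> \<gamma>. r + s < pos \<gamma> \<Longrightarrow> h \<alpha> \<beta> \<gamma> = h' \<alpha> \<beta> \<gamma>"
  shows "rho_model r s h R Z = rho_model r s h' R Z"
  unfolding rho_model_eq model3_def using assms by simp

lemma hol_coords_affine:
  fixes S :: "'n::finite amb \<Rightarrow> 'n amb"
  assumes hc: "hol_coords U F" and S: "linear S" "bij S" "\<And>v. S (Jc v) = Jc (S v)"
  shows "hol_coords {x. inv S (x - p) \<in> U} (\<lambda>x. F (inv S (x - p)))"
proof -
  let ?T = "inv S" and ?W = "{x. inv S (x - p) \<in> U}"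
  have TS: "?T (S v) = v" and ST: "S (?T v) = v" for v
    using S(2) by (simp_all add: bij_is_inj bij_is_surj surj_f_inv_f)
  have T: "linear ?T" by (rule inj_linear_imp_inv_linear[OF S(1) bij_is_inj[OF S(2)]])
  have bT: "bounded_linear ?T" "bounded_linear S" using T S(1) by (simp_all add: linear_conv_bounded_linear)
  have TJ: "?T (Jc v) = Jc (?T v)" for v by (metis S(3) ST TS)
  obtain \<Psi> where hU: "holo_on U F" "inj_on F U" "open (F ` U)" and \<Psi>: "holo_on (F ` U) \<Psi>" "\<forall>x\<in>U. \<Psi> (F x) = x"
    using hc by (auto simp: hol_coords_def)
  have img: "(\<lambda>x. F (?T (x - p))) ` ?W = F ` U"
  proof
    show "F ` U \<subseteq> (\<lambda>x. F (?T (x - p))) ` ?W"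
    proof
      fix y assume "y \<in> F ` U"
      then obtain u where u: "u \<in> U" "y = F u" by blast
      then show "y \<in> (\<lambda>x. F (?T (x - p))) ` ?W"
        by (intro image_eqI[of _ _ "p + S u"]) (simp_all add: TS)
    qed
  qed auto
  have "holo_on ?W (\<lambda>x. F (?T (x - p)))"
    unfolding holo_on_def
  proof (intro conjI ballI)
    have "continuous_on UNIV (\<lambda>x. ?T (x - p))"
      by (intro bounded_linear.continuous_on[OF bT(1)] continuous_intros)
    from open_vimage[OF _ this, of U] show "open ?W" using hU(1) by (simp add: vimage_def holo_on_def)
    fix x assume "x \<in> ?W"
    then obtain D where D: "(F has_derivative D) (at (?T (x - p)))" "\<forall>v. D (Jc v) = Jc (D v)"
      using hU(1) unfolding holo_on_def by blast
    have "((\<lambda>x. ?T (x - p)) has_derivative ?T) (at x)"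
      by (rule bounded_linear.has_derivative[OF bT(1)]) (auto intro!: derivative_eq_intros)
    from has_derivative_compose[OF this D(1)]
    show "\<exists>D. ((\<lambda>x. F (?T (x - p))) has_derivative D) (at x) \<and> (\<forall>v. D (Jc v) = Jc (D v))"
      using D(2) by (intro exI[of _ "\<lambda>v. D (?T v)"]) (simp add: TJ del: split_paired_All)
  qed
  moreover have "holo_on (F ` U) (\<lambda>y. p + S (\<Psi> y))"
    unfolding holo_on_def
  proof (intro conjI ballI)
    show "open (F ` U)" by fact
    fix y assume "y \<in> F ` U"
    then obtain D where D: "(\<Psi> has_derivative D) (at y)" "\<forall>v. D (Jc v) = Jc (D v)"
      using \<Psi>(1) unfolding holo_on_def by blast
    have "((\<lambda>y. p + S (\<Psi> y)) has_derivative (\<lambda>v. S (D v))) (at y)"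
      by (auto intro!: derivative_eq_intros bounded_linear.has_derivative[OF bT(2)] D(1))
    then show "\<exists>D. ((\<lambda>y. p + S (\<Psi> y)) has_derivative D) (at y) \<and> (\<forall>v. D (Jc v) = Jc (D v))"
      using D(2) by (intro exI[of _ "\<lambda>v. S (D v)"]) (simp add: S(3) del: split_paired_All)
  qed
  moreover have inv: "\<forall>x\<in>?W. p + S (\<Psi> (F (?T (x - p)))) = x" using \<Psi>(2) by (simp add: ST)
  moreover have "inj_on (\<lambda>x. F (?T (x - p))) ?W"
    by (rule inj_on_inverseI[of _ "\<lambda>y. p + S (\<Psi> y)"]) (use inv in blast)
  ultimately show ?thesis
    unfolding hol_coords_def img using hU(3) by blast
qed

lemma frame_imp_normal_form:
  fixes M :: "('n::{finite,linorder}) amb set"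
  assumes hyp: "real_hypersurface M" and pM: "p \<in> M" and U: "open U" "p \<in> U"
    and CR: "CR_basis M U Lb" and c: "char_form M U c"
    and T2: "\<forall>\<alpha> \<beta>. Top (Lb \<alpha>) (thform c) (cnjv (Lb \<beta>)) p = gmat r s \<alpha> \<beta>"
    and T3: "\<forall>\<alpha> \<beta> \<gamma>. r + s < pos \<gamma> \<longrightarrow> Top (Lb \<alpha>) (Top (Lb \<beta>) (thform c)) (cnjv (Lb \<gamma>)) p = h \<alpha> \<beta> \<gamma>"
  shows "\<exists>U \<Phi> R. p \<in> U \<and> hol_coords U \<Phi> \<and> \<Phi> p = 0 \<and> weighted_vanish4 R \<and>
            (\<exists>U'. open U' \<and> p \<in> U' \<and> U' \<subseteq> U \<and> M \<inter> U' = {x \<in> U'. rho_model r s h R (\<Phi> x) = 0})"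
proof -
  obtain U0 and \<rho> :: "'n amb \<Rightarrow> real" where U0: "p \<in> U0" "cinf_on U0 \<rho>" "\<forall>x\<in>U0. \<exists>v. dd [v] \<rho> x \<noteq> 0" "M \<inter> U0 = {x \<in> U0. \<rho> x = 0}"
    using hyp[unfolded real_hypersurface_def, THEN bspec, OF pM] by blast
  define W where "W = U \<inter> U0"
  have oW: "open W" unfolding W_def using U(1) cinf_on_open[OF U0(2)] by blast
  interpret hypersurface_nbhd M W \<rho>
  proof
    show "cinf_on W \<rho>" by (rule cinf_on_subset[OF U0(2) oW]) (simp add: W_def)
    show "\<exists>v. dd [v] \<rho> x \<noteq> 0" if "x \<in> W" for x using that U0(3) unfolding W_def by blast
    show "M \<inter> W = {x \<in> W. \<rho> x = 0}" using U0(4) unfolding W_def by blast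
  qed
  interpret hypersurface_form M W \<rho> c
    by unfold_locales (rule char_form_subset[OF c oW], simp add: W_def)
  have pW: "p \<in> W" and pMW: "p \<in> M \<inter> W" using pM U(2) U0(1) by (auto simp: W_def)
  have CRU: "CR_field M U (Lb \<alpha>)" for \<alpha> using CR by (simp add: CR_basis_def)
  have CRW: "CR_field M W (Lb \<alpha>)" for \<alpha> by (rule CR_field_subset[OF CRU oW]) (simp add: W_def)
  define A where "A \<alpha> = fst (Lb \<alpha>) p" for \<alpha>
  have tA: "dd [A \<alpha>] \<rho> p = 0" "dd [Jc (A \<alpha>)] \<rho> p = 0" for \<alpha>
    using CR_fieldD(4,5)[OF CRW pMW] by (simp_all add: A_def tangent_iff[OF pMW])
  have indep: "\<forall>\<alpha>. d \<alpha> = 0" if "(\<Sum>\<alpha>\<in>UNIV. cs (d \<alpha>) (A \<alpha>)) = 0" for d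
  proof -
    have *: "\<forall>c. (\<Sum>\<alpha>\<in>UNIV. cscal (c \<alpha>) (fst (Lb \<alpha>) p, snd (Lb \<alpha>) p)) = (0, 0) \<longrightarrow> (\<forall>\<alpha>. c \<alpha> = 0)"
      using CR pM U(2) unfolding CR_basis_def by blast
    have "(\<Sum>\<alpha>\<in>UNIV. cscal (cnj (d \<alpha>)) (fst (Lb \<alpha>) p, snd (Lb \<alpha>) p)) = (0, 0)"
      using sum_cscal[of "\<lambda>\<alpha>. cnj (d \<alpha>)" A] that CR_fieldD(3)[OF CRW pMW] by (simp add: A_def Jc_simps)
    then have "\<forall>\<alpha>. cnj (d \<alpha>) = 0"
      using spec[OF *, of "\<lambda>\<alpha>. cnj (d \<alpha>)"] by blast
    then show ?thesis by simp
  qed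
  define k where "k = lam p"
  have k: "k \<noteq> 0"
  proof -
    obtain v where "tangent_vec M p v" "c p \<bullet> v \<noteq> 0" using c pM U(2) unfolding char_form_def by blast
    then show ?thesis using char_tangent[OF pMW] by (auto simp: k_def)
  qed
  note lin\<rho> = linear_dd[OF smooth pW]
  define \<nu> where "\<nu> = grad \<rho> p"
  have g: "dd [v] \<rho> p = \<nu> \<bullet> v" for v using grad_inner[OF smooth pW] by (simp add: \<nu>_def)
  have \<nu>: "\<nu> \<bullet> \<nu> \<noteq> 0" using grad_nonzero[OF pW] by (simp add: \<nu>_def)
  \<comment> \<open>A tangent vector scaled by \<open>d\<rho> (Jc n) = - 1 / k\<close>. After
    multiplication of \<open>\<rho>\<close> by \<open>k\<close>, the differential in the coordinates
    given by \<open>S\<close> is \<open>- Im w\<close>, as in the model.\<close>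
  define n where "n = (1 / (k * (\<nu> \<bullet> \<nu>))) *\<^sub>R Jc \<nu>"
  have dn: "dd [n] \<rho> p = 0" "dd [Jc n] \<rho> p = - 1 / k"
    using \<nu> k by (simp_all add: g n_def inner_Jc_self Jc_simps)
  \<comment> \<open>The factor \<open>2 * \<i>\<close> is inverse to \<open>- \<i> / 2\<close>, so
    the frame acquires the coordinates that \<open>normal_form_tensors\<close> asks for. Its squared
    modulus is the \<open>4\<close> of the Levi form of the model.\<close>
  define S where "S Z = (\<Sum>\<alpha>\<in>UNIV. cs (2 * \<i> * fst Z $ \<alpha>) (A \<alpha>)) + cs (snd Z) n" for Z
  have linS: "linear S"
    by (rule linearI) (simp_all add: S_def distrib_left cs_simps sum.distrib linear_scale[OF linear_cs_left] scaleR_add_right scaleR_sum_right)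
  have SJ: "S (Jc Z) = Jc (S Z)" for Z
  proof -
    have "Jc (\<Sum>\<alpha>\<in>UNIV. cs (2 * \<i> * fst Z $ \<alpha>) (A \<alpha>)) = (\<Sum>\<alpha>\<in>UNIV. Jc (cs (2 * \<i> * fst Z $ \<alpha>) (A \<alpha>)))"
      by (rule linear_sum) (rule bounded_linear.linear[OF bounded_linear_Jc])
    then show ?thesis by (simp add: S_def Jc_simps(1)) (simp add: Jc_eq_cs cs_simps mult_ac)
  qed
  have dS: "dd [S Z] \<rho> p = - Im (snd Z) / k" for Z
    unfolding S_def linear_add[OF lin\<rho>] linear_sum[OF lin\<rho>] cs_eq_Jc linear_scale[OF lin\<rho>] tA dn by simp
  have injS: "inj S"
    unfolding linear_injective_0[OF linS]
  proof (intro allI impI)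
    fix Z assume Z: "S Z = 0"
    then have "dd [S Z] \<rho> p = 0" "dd [S (Jc Z)] \<rho> p = 0" using linear_0[OF lin\<rho>] by (simp_all add: SJ Jc_simps)
    then have s: "snd Z = 0" using k by (simp add: dS complex_eq_iff)
    then have "\<forall>\<alpha>. 2 * \<i> * fst Z $ \<alpha> = 0" using indep[of "\<lambda>\<alpha>. 2 * \<i> * fst Z $ \<alpha>"] Z by (simp add: S_def cs_simps)
    then show "Z = 0" using s by (simp add: amb_eq_iff)
  qed
  then have bijS: "bij S" using linear_injective_imp_surjective[OF linS] by (simp add: bij_def)
  have TS: "inv S (S v) = v" and ST: "S (inv S v) = v" for v
    using bijS by (simp_all add: bij_is_inj bij_is_surj surj_f_inv_f)
  have linT: "linear (inv S)" by (rule inj_linear_imp_inv_linear[OF linS injS])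
  have bT: "bounded_linear (inv S)" using linT by (simp add: linear_conv_bounded_linear)
  define W1 where "W1 = {Z. p + S Z \<in> W}"
  have bS: "bounded_linear S" using linS by (simp add: linear_conv_bounded_linear)
  have oW1: "open W1"
  proof -
    have "continuous_on UNIV (\<lambda>Z. p + S Z)" by (intro continuous_intros bounded_linear.continuous_on[OF bS])
    from open_vimage[OF oW this] show ?thesis by (simp add: W1_def vimage_def)
  qed
  have s0: "cinf_on W1 (\<lambda>Z. \<rho> (p + S Z))"
    by (rule cinf_on_compose[OF smooth cinf_on_add[OF cinf_on_const[OF oW1] cinf_on_linear[OF oW1 linS]]]) (simp add: W1_def)
  \<comment> \<open>With the coefficient \<open>k\<close> of the form absorbed, the Levi form of the
    given frame and form becomes that of the defining function.\<close>
  define f where "f Z = k * \<rho> (p + S Z)" for Z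
  have sf: "cinf_on W1 f" unfolding f_def by (rule cinf_on_bounded_linear_apply[OF s0 bounded_linear_mult_right])
  have W10: "0 \<in> W1" using pW linear_0[OF linS] by (simp add: W1_def)
  have df: "dd vs f 0 = k * dd (map S vs) \<rho> p" for vs
  proof -
    have "dd vs f 0 = k * dd vs (\<lambda>Z. \<rho> (p + S Z)) 0"
      unfolding f_def by (rule dd_bounded_linear_apply[OF s0 bounded_linear_mult_right W10])
    also have "dd vs (\<lambda>Z. \<rho> (p + S Z)) 0 = dd (map S vs) (\<lambda>y. \<rho> (p + y)) (S 0)"
      by (rule dd_compose_linear[OF linS])
    also have "\<dots> = dd (map S vs) \<rho> p" by (simp add: dd_translate linear_0[OF linS])
    finally show ?thesis .
  qed
  have levi: "lev2 (\<lambda>u v. dd [u, v] f 0) u v = 4 * model2 r s (fst u) (fst v)" if uv: "snd u = 0" "snd v = 0" for u v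
  proof -
    have "lev2 (\<lambda>u v. dd [u, v] f 0) u v = of_real k * lev2 (\<lambda>u v. dd [u, v] \<rho> p) (S u) (S v)"
      by (simp add: lev2_def df SJ complex_eq_iff algebra_simps)
    also have "\<dots> = of_real k * (\<Sum>\<alpha>\<in>UNIV. \<Sum>\<beta>\<in>UNIV. cnj (2 * \<i> * fst u $ \<alpha>) * (2 * \<i> * fst v $ \<beta>) * lev2 (\<lambda>u v. dd [u, v] \<rho> p) (A \<alpha>) (A \<beta>))"
      using uv by (simp add: S_def cs_simps(8) lev2_sum_cs[OF linear_dd2[OF smooth pW]])
    also have "\<dots> = (\<Sum>\<alpha>\<in>UNIV. \<Sum>\<beta>\<in>UNIV. 4 * (cnj (fst u $ \<alpha>) * fst v $ \<beta> * (of_real k * lev2 (\<lambda>u v. dd [u, v] \<rho> p) (A \<alpha>) (A \<beta>))))"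
      by (simp add: sum_distrib_left mult_ac)
    also have "\<dots> = 4 * model2 r s (fst u) (fst v)"
      using T2 Top_cnjv[OF CRW CRW pMW] by (simp add: k_def A_def model2_def sum_distrib_left mult_ac)
    finally show ?thesis .
  qed
  have "f 0 = 0" using pMW zero linear_0[OF linS] by (auto simp: f_def)
  moreover have "dd [v] f 0 = - Im (snd v)" for v using k by (simp add: df dS)
  ultimately obtain F U1 U2 h' R where F: "0 \<in> U1" "U1 \<subseteq> W1" "hol_coords U1 F" "F 0 = 0" "\<forall>v. dd [v] F 0 = v"
    "\<forall>\<alpha> \<beta> \<gamma>. h' \<alpha> \<beta> \<gamma> = h' \<beta> \<alpha> \<gamma>" "weighted_vanish4 R" "open U2" "0 \<in> U2" "U2 \<subseteq> U1"
    "\<forall>x\<in>U2. f x = 0 \<longleftrightarrow> rho_model r s h' R (F x) = 0"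
    using normalized_normal_form[OF sf W10 _ _ levi] by blast
  define \<Phi> where "\<Phi> x = F (inv S (x - p))" for x
  define V where "V = {x. inv S (x - p) \<in> U1}"
  define V' where "V' = {x. inv S (x - p) \<in> U2}"
  have hc: "hol_coords V \<Phi>" unfolding V_def \<Phi>_def[abs_def] by (rule hol_coords_affine[OF F(3) linS bijS SJ])
  have T0: "inv S 0 = 0" by (rule linear_0[OF linT])
  have pV: "p \<in> V" using F(1) by (simp add: V_def T0)
  have \<Phi>p: "\<Phi> p = 0" using F(4) by (simp add: \<Phi>_def T0)
  have V': "open V'" "p \<in> V'" "V' \<subseteq> V"
  proof -
    have "continuous_on UNIV (\<lambda>x. inv S (x - p))"
      by (intro bounded_linear.continuous_on[OF bT] continuous_intros)
    from open_vimage[OF F(8) this] show "open V'" by (simp add: V'_def vimage_def)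
    show "p \<in> V'" "V' \<subseteq> V" using F(9,10) by (auto simp: V_def V'_def T0)
  qed
  have M: "M \<inter> V' = {x \<in> V'. rho_model r s h' R (\<Phi> x) = 0}"
  proof -
    have "x \<in> M \<longleftrightarrow> rho_model r s h' R (\<Phi> x) = 0" if x: "x \<in> V'" for x
    proof -
      have u: "inv S (x - p) \<in> U2" using x by (simp add: V'_def)
      then have "inv S (x - p) \<in> W1" using F(2,10) by blast
      then have "x \<in> W" by (simp add: W1_def ST)
      then have "x \<in> M \<longleftrightarrow> f (inv S (x - p)) = 0" using zero k by (auto simp: f_def ST)
      then show ?thesis using F(11) u by (simp add: \<Phi>_def)
    qed
    then show ?thesis by blast
  qed
  \<comment> \<open>Since \<open>F\<close> has the identity as differential at the origin, the
    nonlinear corrections do not disturb the values of the frame at \<open>p\<close>.\<close>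
  have d\<Phi>: "dd [v] \<Phi> p = inv S v" for v
  proof (rule has_derivative_imp_dd)
    have "holo_on U1 F" using F(3) by (simp add: hol_coords_def)
    then have F': "(F has_derivative (\<lambda>v. dd [v] F (inv S (p - p)))) (at (inv S (p - p)))"
      using cinf_on_has_derivative[OF cinf_on_holo F(1)] by (simp add: T0)
    have "((\<lambda>x. inv S (x - p)) has_derivative inv S) (at p)"
      by (rule bounded_linear.has_derivative[OF bT]) (auto intro!: derivative_eq_intros)
    from has_derivative_compose[OF this F']
    have "((\<lambda>x. F (inv S (x - p))) has_derivative (\<lambda>v. dd [inv S v] F (inv S (p - p)))) (at p)" .
    then show "(\<Phi> has_derivative inv S) (at p)" using F(5) by (simp add: \<Phi>_def[abs_def] T0)
  qed
  have val: "dd [fst (Lb \<alpha>) p] \<Phi> p = (axis \<alpha> (- \<i> / 2), 0)" for \<alpha>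
  proof -
    have "(\<Sum>\<beta>\<in>UNIV. cs (2 * \<i> * axis \<alpha> (- \<i> / 2) $ \<beta>) (A \<beta>)) = (\<Sum>\<beta>\<in>UNIV. if \<beta> = \<alpha> then A \<alpha> else 0)"
      by (intro sum.cong refl) (auto simp: axis_def cs_simps)
    then have "S (axis \<alpha> (- \<i> / 2), 0) = A \<alpha>" by (simp add: S_def cs_simps)
    then show ?thesis unfolding d\<Phi> A_def[symmetric] using TS by metis
  qed
  have cval: "c p \<bullet> v = - Re (snd (dd [v] \<Phi> p))" if "tangent_vec M p v" for v
  proof -
    have "c p \<bullet> v = k * dd [Jc v] \<rho> p" using char_tangent[OF pMW that] by (simp add: k_def)
    also have "Jc v = S (Jc (inv S v))" by (simp add: SJ ST)
    finally show ?thesis using k by (simp add: dS d\<Phi>)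
  qed
  have "h \<alpha> \<beta> \<gamma> = h' \<alpha> \<beta> \<gamma>" if "r + s < pos \<gamma>" for \<alpha> \<beta> \<gamma>
  proof -
    have "\<forall>\<alpha> \<beta> \<gamma>. r + s < pos \<gamma> \<longrightarrow> h' \<alpha> \<beta> \<gamma> = h' \<beta> \<alpha> \<gamma>" using F(6) by blast
    from normal_form_tensors(2)[OF hc pV \<Phi>p F(7) V' M U pM CRU c val cval this that, of \<alpha> \<beta>] T3 that
    show ?thesis by simp
  qed
  then have "rho_model r s h' R (\<Phi> x) = rho_model r s h R (\<Phi> x)" for x
    by (intro rho_model_cong) simp
  then show ?thesis using pV hc \<Phi>p F(7) V' M by auto
qed

theorem theorem4p15:
  fixes M :: "('n::{finite,linorder}) amb set"
    and p :: "'n amb"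
    and r s :: nat
    and h :: "'n \<Rightarrow> 'n \<Rightarrow> 'n \<Rightarrow> complex"
  assumes hyp: "real_hypersurface M"
    and pM: "p \<in> M"
    and levi: "\<exists>U Lb c. open U \<and> p \<in> U \<and> CR_basis M U Lb \<and> char_form M U c \<and>
                 herm_inertia (\<lambda>\<alpha> \<beta>. Top (Lb \<alpha>) (thform c) (cnjv (Lb \<beta>)) p) r s"
    and rs: "r + s < CARD('n)"
    and hsym: "\<forall>\<alpha> \<beta> \<gamma>. r + s < pos \<gamma> \<longrightarrow> h \<alpha> \<beta> \<gamma> = h \<beta> \<alpha> \<gamma>"
  shows "(\<exists>U \<Phi> R. p \<in> U \<and> hol_coords U \<Phi> \<and> \<Phi> p = 0 \<and> weighted_vanish4 R \<and>
            (\<exists>U'. open U' \<and> p \<in> U' \<and> U' \<subseteq> U \<and>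
                  M \<inter> U' = {x \<in> U'. rho_model r s h R (\<Phi> x) = 0}))
     \<longleftrightarrow>
         (\<exists>U Lb c. open U \<and> p \<in> U \<and> CR_basis M U Lb \<and> char_form M U c \<and>
            (\<forall>\<alpha> \<beta>. Top (Lb \<alpha>) (thform c) (cnjv (Lb \<beta>)) p = gmat r s \<alpha> \<beta>) \<and>
            (\<forall>\<alpha> \<beta> \<gamma>. r + s < pos \<gamma> \<longrightarrow>
               Top (Lb \<alpha>) (Top (Lb \<beta>) (thform c)) (cnjv (Lb \<gamma>)) p = h \<alpha> \<beta> \<gamma>))"
    (is "?L \<longleftrightarrow> ?R")
proof
  assume ?L
  then obtain U \<Phi> R U' where *: "hol_coords U \<Phi>" "p \<in> U" "\<Phi> p = 0" "weighted_vanish4 R" "open U'" "p \<in> U'" "U' \<subseteq> U"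
    "M \<inter> U' = {x \<in> U'. rho_model r s h R (\<Phi> x) = 0}" by blast
  show ?R by (rule normal_form_imp_frame[OF * pM hsym])
next
  assume ?R
  then obtain U Lb c where *: "open U" "p \<in> U" "CR_basis M U Lb" "char_form M U c"
    "\<forall>\<alpha> \<beta>. Top (Lb \<alpha>) (thform c) (cnjv (Lb \<beta>)) p = gmat r s \<alpha> \<beta>"
    "\<forall>\<alpha> \<beta> \<gamma>. r + s < pos \<gamma> \<longrightarrow> Top (Lb \<alpha>) (Top (Lb \<beta>) (thform c)) (cnjv (Lb \<gamma>)) p = h \<alpha> \<beta> \<gamma>"
    by blast
  show ?L by (rule frame_imp_normal_form[OF hyp pM *])
qed

end
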